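(* Let $T>0$, let $k,m\in\mathbb{N}$, and let $(\Omega,\mathcal{F},\mathbb{P})$ be a fixed probability space. Let $X$ be a real separable Hilbert space. For each $n\in\mathbb{N}$, let $W_n$ be an $\mathbb{R}^k$-valued Wiener process on the filtered probability space $(\Omega,\mathcal{F},\{\mathcal{F}^n_t\}_{t\in[0,T]},\mathbb{P})$, and let $W$ be an $\mathbb{R}^k$-valued Wiener process on $(\Omega,\mathcal{F},\{\mathcal{F}_t\}_{t\in[0,T]},\mathbb{P})$. Fix $p>2$. For each $n$, let $V_n$ be an $X^{m\times k}$-valued $\{\mathcal{F}^n_t\}$-predictable process, and let $V$ be an $X^{m\times k}$-valued $\{\mathcal{F}_t\}$-predictable process. Suppose $$V_n\rightharpoonup V \text{ weakly in } L^p(\Omega\times[0,T];X^{m\times k}) \text{ as } n\to\infty,$$ $$W_n\to W \text{ in } C([0,T];\mathbb{R}^k),\ \mathbb{P}\text{-almost surely}.$$ Suppose that for a given $\beta\in X^*$, $$\mathbb{E}\int_h^T\big|\langle\beta,V_n\rangle_{X^*,X}(t)-\langle\beta,V_n\rangle_{X^*,X}(t-h)\big|\,\mathrm{d}t\longrightarrow 0\quad\text{as } h\downarrow 0,\ \text{uniformly in } n.$$ Then for every $t\in[0,T]$, $$\int_0^t\langle\beta,V_n\rangle_{X^*,X}\,\mathrm{d}W_n\rightharpoonup\int_0^t\langle\beta,V\rangle_{X^*,X}\,\mathrm{d}W\quad\text{weakly in } L^2(\Omega;\mathbb{R}^m)\text{ as } n\to\infty.$$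
   Context: $X^{m\times k}$ denotes $m\times k$ matrices with entries in $X$. The duality bracket $\langle\beta,\cdot\rangle_{X^*,X}$ is applied entrywise, so $\langle\beta,V_n\rangle_{X^*,X}$ is an $\mathbb{R}^{m\times k}$-valued process, and $\int_0^t\langle\beta,V_n\rangle\,\mathrm{d}W_n$ is the $\mathbb{R}^m$-valued Itô integral (matrix acting on the vector increment). $|\cdot|$ is the Euclidean norm. *)

theory Defs
  imports "HOL-Probability.Probability"
begin

text \<open>
  The spaces \<open>L\<^sup>p(M; E)\<close> for real \<open>p \<ge> 1\<close>, without passing to the quotient by equality almost
  everywhere: elements are functions, and \<open>Lp_norm\<close> is a seminorm on them. A functional that is
  bounded with respect to this seminorm identifies almost everywhere equal functions, so
  \<open>Lp_dual\<close> is the topological dual of the quotient space.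
\<close>

definition Lp_space :: "'a measure \<Rightarrow> real \<Rightarrow> ('a \<Rightarrow> 'e::real_normed_vector) set" where
  "Lp_space M p = {f \<in> borel_measurable M. integrable M (\<lambda>x. norm (f x) powr p)}"

definition Lp_norm :: "'a measure \<Rightarrow> real \<Rightarrow> ('a \<Rightarrow> 'e::real_normed_vector) \<Rightarrow> real" where
  "Lp_norm M p f = (\<integral>x. norm (f x) powr p \<partial>M) powr (1 / p)"

definition Lp_dual :: "'a measure \<Rightarrow> real \<Rightarrow> (('a \<Rightarrow> 'e::real_normed_vector) \<Rightarrow> real) set" where
  "Lp_dual M p = {\<phi>.
     (\<forall>f\<in>Lp_space M p. \<forall>g\<in>Lp_space M p. \<phi> (\<lambda>x. f x + g x) = \<phi> f + \<phi> g) \<and>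
     (\<forall>c. \<forall>f\<in>Lp_space M p. \<phi> (\<lambda>x. c *\<^sub>R f x) = c * \<phi> f) \<and>
     (\<exists>C. \<forall>f\<in>Lp_space M p. \<bar>\<phi> f\<bar> \<le> C * Lp_norm M p f)}"

definition Lp_converges ::
    "'a measure \<Rightarrow> real \<Rightarrow> (nat \<Rightarrow> 'a \<Rightarrow> 'e::real_normed_vector) \<Rightarrow> ('a \<Rightarrow> 'e) \<Rightarrow> bool" where
  "Lp_converges M p f g \<longleftrightarrow>
     (\<forall>n. f n \<in> Lp_space M p) \<and> g \<in> Lp_space M p \<and>
     (\<lambda>n. Lp_norm M p (\<lambda>x. f n x - g x)) \<longlonglongrightarrow> 0"

definition Lp_converges_weakly ::
    "'a measure \<Rightarrow> real \<Rightarrow> (nat \<Rightarrow> 'a \<Rightarrow> 'e::real_normed_vector) \<Rightarrow> ('a \<Rightarrow> 'e) \<Rightarrow> bool" where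
  "Lp_converges_weakly M p f g \<longleftrightarrow>
     (\<forall>n. f n \<in> Lp_space M p) \<and> g \<in> Lp_space M p \<and>
     (\<forall>\<phi>\<in>Lp_dual M p. (\<lambda>n. \<phi> (f n)) \<longlonglongrightarrow> \<phi> g)"


text \<open>
  Only the times in \<open>{0..T}\<close> matter. Neither completeness nor right-continuity of the filtration is
  required.
\<close>

locale filtered_prob_space = prob_space M for M :: "'a measure" +
  fixes F :: "real \<Rightarrow> 'a measure" and T :: real
  assumes subalgebra_F: "\<And>t. t \<in> {0..T} \<Longrightarrow> subalgebra M (F t)"
    and sets_F_mono: "\<And>s t. 0 \<le> s \<Longrightarrow> s \<le> t \<Longrightarrow> t \<le> T \<Longrightarrow> sets (F s) \<subseteq> sets (F t)"

text \<open>
  A standard Wiener process relative to the filtration \<open>F\<close>. The density in \<open>increment_normal\<close> is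
  that of the centred normal distribution on \<open>real ^ 'k\<close> with covariance matrix \<open>(t - s)\<close> times the
  identity.
\<close>

locale wiener_process = filtered_prob_space M F T
  for M :: "'a measure" and F :: "real \<Rightarrow> 'a measure" and T :: real +
  fixes W :: "real \<Rightarrow> 'a \<Rightarrow> real ^ 'k"
  assumes adapted: "\<And>t. t \<in> {0..T} \<Longrightarrow> W t \<in> borel_measurable (F t)"
    and start_zero: "AE \<omega> in M. W 0 \<omega> = 0"
    and continuous_paths: "AE \<omega> in M. continuous_on {0..T} (\<lambda>t. W t \<omega>)"
    and increment_indep: "\<And>s t. 0 \<le> s \<Longrightarrow> s < t \<Longrightarrow> t \<le> T \<Longrightarrow>
      indep_set (sets (F s)) (sets (vimage_algebra (space M) (\<lambda>\<omega>. W t \<omega> - W s \<omega>) borel))"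
    and increment_normal: "\<And>s t. 0 \<le> s \<Longrightarrow> s < t \<Longrightarrow> t \<le> T \<Longrightarrow>
      distributed M lborel (\<lambda>\<omega>. W t \<omega> - W s \<omega>)
        (\<lambda>x. ennreal (\<Prod>i\<in>UNIV. normal_density 0 (sqrt (t - s)) (x $ i)))"

definition predictable_sigma :: "'a measure \<Rightarrow> (real \<Rightarrow> 'a measure) \<Rightarrow> real \<Rightarrow> ('a \<times> real) measure" where
  "predictable_sigma M F T = sigma (space M \<times> {0..T})
     ({A \<times> {0} | A. A \<in> sets (F 0)} \<union>
      {A \<times> {s<..t} | A s t. 0 \<le> s \<and> s < t \<and> t \<le> T \<and> A \<in> sets (F s)})"

definition predictable ::
    "'a measure \<Rightarrow> (real \<Rightarrow> 'a measure) \<Rightarrow> real \<Rightarrow> (real \<Rightarrow> 'a \<Rightarrow> 'e::topological_space) \<Rightarrow> bool" where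
  "predictable M F T V \<longleftrightarrow> (\<lambda>(\<omega>, t). V t \<omega>) \<in> borel_measurable (predictable_sigma M F T)"

definition time_product :: "'a measure \<Rightarrow> real \<Rightarrow> ('a \<times> real) measure" where
  "time_product M T = M \<Otimes>\<^sub>M restrict_space lborel {0..T}"


text \<open>
  An elementary process on \<open>{0..t}\<close> is given by a number \<open>N\<close> of steps, a grid
  \<open>\<tau> 0 \<le> \<dots> \<le> \<tau> N\<close> in \<open>{0..t}\<close> and, for each \<open>i < N\<close>, a bounded \<open>F (\<tau> i)\<close>-measurable random
  matrix \<open>\<xi> i\<close>, the value on the interval \<open>{\<tau> i<..\<tau> (Suc i)}\<close>.
\<close>

definition elementary ::
    "'a measure \<Rightarrow> (real \<Rightarrow> 'a measure) \<Rightarrow> real \<Rightarrow> nat \<Rightarrow> (nat \<Rightarrow> real) \<Rightarrow>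
     (nat \<Rightarrow> 'a \<Rightarrow> real ^ 'k ^ 'm) \<Rightarrow> bool" where
  "elementary M F t N \<tau> \<xi> \<longleftrightarrow>
     mono_on {..N} \<tau> \<and> \<tau> ` {..N} \<subseteq> {0..t} \<and>
     (\<forall>i<N. \<xi> i \<in> borel_measurable (F (\<tau> i)) \<and> (\<exists>C. \<forall>\<omega>\<in>space M. norm (\<xi> i \<omega>) \<le> C))"

definition elementary_process ::
    "nat \<Rightarrow> (nat \<Rightarrow> real) \<Rightarrow> (nat \<Rightarrow> 'a \<Rightarrow> real ^ 'k ^ 'm) \<Rightarrow> real \<Rightarrow> 'a \<Rightarrow> real ^ 'k ^ 'm" where
  "elementary_process N \<tau> \<xi> s \<omega> = (\<Sum>i<N. indicator {\<tau> i<..\<tau> (Suc i)} s *\<^sub>R \<xi> i \<omega>)"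

definition elementary_integral ::
    "(real \<Rightarrow> 'a \<Rightarrow> real ^ 'k) \<Rightarrow> nat \<Rightarrow> (nat \<Rightarrow> real) \<Rightarrow> (nat \<Rightarrow> 'a \<Rightarrow> real ^ 'k ^ 'm) \<Rightarrow>
     'a \<Rightarrow> real ^ 'm" where
  "elementary_integral W N \<tau> \<xi> \<omega> = (\<Sum>i<N. \<xi> i \<omega> *v (W (\<tau> (Suc i)) \<omega> - W (\<tau> i) \<omega>))"

text \<open>
  \<open>has_ito_integral M F W \<Phi> t Y\<close>: the random vector \<open>Y\<close> is (a version of) the Ito integral of \<open>\<Phi>\<close>
  against \<open>W\<close> over \<open>{0..t}\<close>, i.e. the \<open>L\<^sup>2(\<Omega>)\<close>-limit of the integrals of elementary processes
  converging to \<open>\<Phi>\<close> in \<open>L\<^sup>2(\<Omega> \<times> {0..t})\<close>. The integral is determined only up to almost sure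
  equality; \<open>ito_integral\<close> picks a version.
\<close>

definition has_ito_integral ::
    "'a measure \<Rightarrow> (real \<Rightarrow> 'a measure) \<Rightarrow> (real \<Rightarrow> 'a \<Rightarrow> real ^ 'k) \<Rightarrow>
     (real \<Rightarrow> 'a \<Rightarrow> real ^ 'k ^ 'm) \<Rightarrow> real \<Rightarrow> ('a \<Rightarrow> real ^ 'm) \<Rightarrow> bool" where
  "has_ito_integral M F W \<Phi> t Y \<longleftrightarrow>
     (\<exists>N \<tau> \<xi>. (\<forall>j. elementary M F t (N j) (\<tau> j) (\<xi> j)) \<and>
        Lp_converges (time_product M t) 2
          (\<lambda>j (\<omega>, s). elementary_process (N j) (\<tau> j) (\<xi> j) s \<omega>) (\<lambda>(\<omega>, s). \<Phi> s \<omega>) \<and>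
        Lp_converges M 2 (\<lambda>j. elementary_integral W (N j) (\<tau> j) (\<xi> j)) Y)"

definition ito_integral ::
    "'a measure \<Rightarrow> (real \<Rightarrow> 'a measure) \<Rightarrow> (real \<Rightarrow> 'a \<Rightarrow> real ^ 'k) \<Rightarrow>
     (real \<Rightarrow> 'a \<Rightarrow> real ^ 'k ^ 'm) \<Rightarrow> real \<Rightarrow> 'a \<Rightarrow> real ^ 'm" where
  "ito_integral M F W \<Phi> t = (SOME Y. has_ito_integral M F W \<Phi> t Y)"


definition dual_pairing ::
    "('x::real_normed_vector \<Rightarrow>\<^sub>L real) \<Rightarrow> (real \<Rightarrow> 'a \<Rightarrow> 'x ^ 'k ^ 'm) \<Rightarrow>
     real \<Rightarrow> 'a \<Rightarrow> real ^ 'k ^ 'm" where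
  "dual_pairing \<beta> V t \<omega> = (\<chi> i j. blinfun_apply \<beta> (V t \<omega> $ i $ j))"

end

theory Submission
  imports Defs
begin

text \<open>
  By the Ito isometry it suffices to replace the integrands $f_n = \langle\beta, V_n\rangle$ by step
  processes with an error that is small in $L^2(\Omega \times [0,t])$ uniformly in $n$. The step
  process takes on each interval of a grid of mesh $\delta$ the average of $f_n$ over the preceding
  interval, so it is adapted and its error is controlled by the time increments of $f_n$ over lags
  at most $2\delta$. These are uniformly small in $L^1$ by hypothesis, and a weakly convergent
  sequence is bounded in $L^p$ with $p > 2$, so they are uniformly small in $L^2$; by weak lower
  semicontinuity the same holds for the limit $f$. In particular all the Ito integrals exist.

  For a fixed grid the integral is a finite sum of products of an average of $f_n$, which is a
  bounded linear function of $f_n$ and so converges weakly, and an increment of $W_n$, which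
  converges strongly. Truncating the increment makes multiplication by it a bounded operator from
  $L^2$ to $L^2$, so a functional on $L^2(\Omega)$ pulls back to one on $L^2(\Omega \times [0,T])$
  and need not be represented by a function. The truncation error is independent of the average,
  and its law does not depend on $n$.
\<close>

section \<open>The spaces $L^p$\<close>

text \<open>The obstacle is that neither factor can be handled alone: the integrands converge only
  weakly, and uniform convergence of the paths of \<open>Wn\<close> does not by itself control
  integrals of integrands that vary with n, because stochastic integration is not continuous in the
  paths. Uniform smallness of the lags gives one grid that serves all n and the limit, and on a
  fixed grid only finitely many increments occur. A second obstacle is that the filtrations differ.
  The average of \<open>f n\<close> is independent of the later increment of \<open>Wn n\<close>,
  but in general not of the increment of \<open>W\<close>, so its product with the latter cannot be
  estimated by independence. Hence each increment is truncated against an average adapted to its own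
  filtration, where independence is available, and the two filtrations meet only in products with
  bounded factors. There the difference of the truncated increments tends to zero in L2, and the
  bound of the averages in an exponent p > 2 takes the place of independence.\<close>

lemma Lp_space_2_iff:
  "f \<in> Lp_space M 2 \<longleftrightarrow> f \<in> borel_measurable M \<and> integrable M (\<lambda>x. (norm (f x))\<^sup>2)"
  by (simp add: Lp_space_def)

lemma Lp_norm_2: "Lp_norm M 2 f = sqrt (LINT x|M. (norm (f x))\<^sup>2)"
  by (simp add: Lp_norm_def powr_half_sqrt)

lemma square_norm_add_le:
  fixes a b :: "'e::real_normed_vector"
  shows "(norm (a + b))\<^sup>2 \<le> 2 * (norm a)\<^sup>2 + 2 * (norm b)\<^sup>2"
proof -
  have "(norm (a + b))\<^sup>2 \<le> (norm a + norm b)\<^sup>2"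
    by (intro power_mono norm_triangle_ineq) auto
  also have "\<dots> \<le> 2 * (norm a)\<^sup>2 + 2 * (norm b)\<^sup>2"
    using sum_squares_bound[of "norm a" "norm b"] by (simp add: power2_eq_square algebra_simps)
  finally show ?thesis .
qed

lemma square_norm_diff_le:
  fixes a b :: "'e::real_normed_vector"
  shows "(norm (a - b))\<^sup>2 \<le> 2 * (norm a)\<^sup>2 + 2 * (norm b)\<^sup>2"
  using square_norm_add_le[of a "- b"] by simp

lemma powr_norm_add_le:
  fixes a b :: "'e::real_normed_vector"
  assumes "p \<ge> 0"
  shows "norm (a + b) powr p \<le> 2 powr p * (norm a powr p + norm b powr p)"
proof -
  have *: "norm (a + b) \<le> 2 * max (norm a) (norm b)"
    by (rule order_trans[OF norm_triangle_ineq]) auto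
  have "norm (a + b) powr p \<le> (2 * max (norm a) (norm b)) powr p"
    using * assms by (intro powr_mono2) auto
  also have "\<dots> = 2 powr p * max (norm a) (norm b) powr p"
    by (simp add: powr_mult)
  also have "max (norm a) (norm b) powr p \<le> norm a powr p + norm b powr p"
    by (auto simp: max_def)
  finally show ?thesis by simp
qed

lemma square_le_powr_above:
  fixes x K p :: real
  assumes "x > K" "K > 0" "p \<ge> 2"
  shows "x\<^sup>2 \<le> K powr (2 - p) * x powr p"
proof -
  have "x\<^sup>2 = x powr (2 - p) * x powr p"
    using assms by (simp flip: powr_add)
  also have "\<dots> \<le> K powr (2 - p) * x powr p"
    using assms by (intro mult_right_mono powr_mono2') auto
  finally show ?thesis .
qed

text \<open>Splitting at a level K: up to K, one or both factors x are replaced by K; above K the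
  nonpositive exponent \<open>2 - p\<close> turns the square into a multiple of
  \<open>x powr p\<close>. Since \<open>K powr (2 - p)\<close> is small for large K when p > 2,
  these inequalities do the work of interpolation between Lp spaces and of uniform
  integrability.\<close>

lemma
  fixes x K p :: real
  assumes "x \<ge> 0" "K > 0" "p \<ge> 2"
  shows square_le_linear_plus_powr: "x\<^sup>2 \<le> K * x + K powr (2 - p) * x powr p"
    and square_le_const_plus_powr: "x\<^sup>2 \<le> K\<^sup>2 + K powr (2 - p) * x powr p"
proof -
  have small: "x\<^sup>2 \<le> K * x" "x\<^sup>2 \<le> K\<^sup>2" if "x \<le> K"
    using mult_right_mono[OF that assms(1)] power_mono[OF that assms(1), of 2]
    by (simp_all add: power2_eq_square)
  have "0 \<le> K * x" "0 \<le> K\<^sup>2" "0 \<le> K powr (2 - p) * x powr p" using assms by simp_all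
  then show "x\<^sup>2 \<le> K * x + K powr (2 - p) * x powr p" "x\<^sup>2 \<le> K\<^sup>2 + K powr (2 - p) * x powr p"
    using small square_le_powr_above[OF _ assms(2,3), of x] by (cases "x \<le> K"; linarith)+
qed

lemma Lp_space_add:
  fixes f g :: "'a \<Rightarrow> 'e::{real_normed_vector, second_countable_topology}"
  assumes "f \<in> Lp_space M p" "g \<in> Lp_space M p" "p \<ge> 0"
  shows "(\<lambda>x. f x + g x) \<in> Lp_space M p"
proof -
  have [measurable]: "f \<in> borel_measurable M" "g \<in> borel_measurable M"
    using assms by (auto simp: Lp_space_def)
  have "integrable M (\<lambda>x. norm (f x + g x) powr p)"
  proof (rule Bochner_Integration.integrable_bound)
    show "integrable M (\<lambda>x. 2 powr p * (norm (f x) powr p + norm (g x) powr p))"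
      using assms by (auto simp: Lp_space_def)
  qed (use powr_norm_add_le[OF assms(3)] in \<open>auto intro!: AE_I2 simp: abs_of_nonneg\<close>)
  then show ?thesis by (auto simp: Lp_space_def)
qed

lemma Lp_space_scaleR:
  assumes "f \<in> Lp_space M p"
  shows "(\<lambda>x. c *\<^sub>R f x) \<in> Lp_space M p"
  using assms by (auto simp: Lp_space_def powr_mult)

lemma Lp_space_uminus:
  assumes "f \<in> Lp_space M p"
  shows "(\<lambda>x. - f x) \<in> Lp_space M p"
  using Lp_space_scaleR[OF assms, of "-1"] by simp

lemma Lp_space_diff:
  fixes f g :: "'a \<Rightarrow> 'e::{real_normed_vector, second_countable_topology}"
  assumes "f \<in> Lp_space M p" "g \<in> Lp_space M p" "p \<ge> 0"
  shows "(\<lambda>x. f x - g x) \<in> Lp_space M p"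
  using Lp_space_add[OF assms(1) Lp_space_uminus[OF assms(2)] assms(3)] by simp

lemma Lp_space_zero: "(\<lambda>x. 0) \<in> Lp_space M p"
  by (auto simp: Lp_space_def)

lemma Lp_space_sum:
  fixes f :: "'i \<Rightarrow> 'a \<Rightarrow> 'e::{real_normed_vector, second_countable_topology}"
  assumes "\<And>i. i \<in> I \<Longrightarrow> f i \<in> Lp_space M p" "p \<ge> 0"
  shows "(\<lambda>x. \<Sum>i\<in>I. f i x) \<in> Lp_space M p"
  using assms
  by (induction I rule: infinite_finite_induct) (auto intro!: Lp_space_add Lp_space_zero)

lemma Lp_space_bounded_linear:
  assumes B: "bounded_linear B" and f: "f \<in> Lp_space M p" and "p \<ge> 0"
  shows "(\<lambda>x. B (f x)) \<in> Lp_space M p"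
proof -
  obtain K where K: "\<And>x. norm (B x) \<le> norm x * K" and "K > 0"
    using bounded_linear.pos_bounded[OF B] by blast
  have [measurable]: "f \<in> borel_measurable M" "B \<in> borel_measurable borel"
    using f B by (auto simp: Lp_space_def intro!: borel_measurable_continuous_onI linear_continuous_on)
  have "integrable M (\<lambda>x. norm (B (f x)) powr p)"
  proof (rule Bochner_Integration.integrable_bound)
    show "integrable M (\<lambda>x. K powr p * norm (f x) powr p)"
      using f by (auto simp: Lp_space_def)
    have "norm (B y) powr p \<le> K powr p * norm y powr p" for y
      using K[of y] \<open>K > 0\<close> \<open>p \<ge> 0\<close>
      by (subst mult.commute, subst powr_mult[symmetric]) (auto intro!: powr_mono2)
    then show "AE x in M. norm (norm (B (f x)) powr p) \<le> norm (K powr p * norm (f x) powr p)"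
      by (auto simp: abs_of_nonneg)
  qed measurable
  then show ?thesis by (auto simp: Lp_space_def)
qed

text \<open>The level split with K = 1, integrated; finiteness of the measure makes the constant
  term integrable.\<close>

lemma (in finite_measure) Lp_space_2:
  assumes "f \<in> Lp_space M p" "p \<ge> 2"
  shows "f \<in> Lp_space M 2"
    and "(LINT x|M. (norm (f x))\<^sup>2) \<le> measure M (space M) + (LINT x|M. norm (f x) powr p)"
proof -
  have [measurable]: "f \<in> borel_measurable M" using assms by (auto simp: Lp_space_def)
  have le: "(norm (f x))\<^sup>2 \<le> 1 + norm (f x) powr p" for x
    using square_le_const_plus_powr[of "norm (f x)" 1 p] assms by simp
  have int: "integrable M (\<lambda>x. 1 + norm (f x) powr p)"
    using assms by (auto simp: Lp_space_def)
  have int2: "integrable M (\<lambda>x. (norm (f x))\<^sup>2)"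
    by (rule Bochner_Integration.integrable_bound[OF int])
       (use le in \<open>auto intro!: AE_I2 simp: abs_of_nonneg add_nonneg_nonneg\<close>)
  then show "f \<in> Lp_space M 2" by (auto simp: Lp_space_2_iff)
  have "(LINT x|M. (norm (f x))\<^sup>2) \<le> (LINT x|M. 1 + norm (f x) powr p)"
    by (intro integral_mono int int2 le)
  also have "\<dots> = measure M (space M) + (LINT x|M. norm (f x) powr p)"
    using assms by (subst Bochner_Integration.integral_add) (auto simp: Lp_space_def)
  finally show "(LINT x|M. (norm (f x))\<^sup>2) \<le> measure M (space M) + (LINT x|M. norm (f x) powr p)" .
qed

lemma integrable_inner_L2:
  fixes f g :: "'a \<Rightarrow> 'e::euclidean_space"
  assumes "f \<in> Lp_space M 2" "g \<in> Lp_space M 2"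
  shows "integrable M (\<lambda>x. f x \<bullet> g x)"
proof (rule Bochner_Integration.integrable_bound)
  show "integrable M (\<lambda>x. (norm (f x))\<^sup>2 + (norm (g x))\<^sup>2)"
    using assms by (auto simp: Lp_space_2_iff)
  have "\<bar>f x \<bullet> g x\<bar> \<le> (norm (f x))\<^sup>2 + (norm (g x))\<^sup>2" for x
    using Cauchy_Schwarz_ineq2[of "f x" "g x"] sum_squares_bound[of "norm (f x)" "norm (g x)"]
      mult_nonneg_nonneg[of "norm (f x)" "norm (g x)"] by simp
  then show "AE x in M. norm (f x \<bullet> g x) \<le> norm ((norm (f x))\<^sup>2 + (norm (g x))\<^sup>2)"
    by (auto simp: abs_of_nonneg add_nonneg_nonneg)
qed (use assms in \<open>auto simp: Lp_space_2_iff\<close>)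

text \<open>Squared distances become combinations of inner products, so an isometry shown for inner
  products transfers to differences in \<open>ito_isometry_diff\<close>.\<close>

lemma integral_square_norm_diff:
  fixes f g :: "'a \<Rightarrow> 'e::euclidean_space"
  assumes "f \<in> Lp_space M 2" "g \<in> Lp_space M 2"
  shows "(LINT x|M. (norm (f x - g x))\<^sup>2) =
    (LINT x|M. f x \<bullet> f x) - 2 * (LINT x|M. f x \<bullet> g x) + (LINT x|M. g x \<bullet> g x)"
proof -
  have "(norm (f x - g x))\<^sup>2 = f x \<bullet> f x - 2 * (f x \<bullet> g x) + g x \<bullet> g x" for x
    by (simp add: power2_norm_eq_inner inner_diff_left inner_diff_right inner_commute)
  then show ?thesis
    using integrable_inner_L2[OF assms(1,1)] integrable_inner_L2[OF assms(1,2)]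
      integrable_inner_L2[OF assms(2,2)] by simp
qed

lemma integral_square_norm_diff_le:
  fixes f g :: "'a \<Rightarrow> 'e::{real_normed_vector, second_countable_topology}"
  assumes "f \<in> Lp_space M 2" "g \<in> Lp_space M 2"
  shows "(LINT x|M. (norm (f x - g x))\<^sup>2) \<le>
    2 * (LINT x|M. (norm (f x))\<^sup>2) + 2 * (LINT x|M. (norm (g x))\<^sup>2)"
proof -
  have "(LINT x|M. (norm (f x - g x))\<^sup>2) \<le> (LINT x|M. 2 * (norm (f x))\<^sup>2 + 2 * (norm (g x))\<^sup>2)"
    using Lp_space_diff[OF assms] assms
    by (intro integral_mono square_norm_diff_le) (auto simp: Lp_space_2_iff)
  also have "\<dots> = 2 * (LINT x|M. (norm (f x))\<^sup>2) + 2 * (LINT x|M. (norm (g x))\<^sup>2)"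
    using assms by (auto simp: Lp_space_2_iff)
  finally show ?thesis .
qed

lemma integral_square_norm_triangle:
  fixes f g h :: "'a \<Rightarrow> 'e::{real_normed_vector, second_countable_topology}"
  assumes "f \<in> Lp_space M 2" "g \<in> Lp_space M 2" "h \<in> Lp_space M 2"
  shows "(LINT x|M. (norm (f x - h x))\<^sup>2) \<le>
    2 * (LINT x|M. (norm (f x - g x))\<^sup>2) + 2 * (LINT x|M. (norm (g x - h x))\<^sup>2)"
  using integral_square_norm_diff_le[OF Lp_space_diff[OF assms(1,2)] Lp_space_diff[OF assms(3,2)]]
  by (simp add: norm_minus_commute)

subsection \<open>Bounded functionals\<close>

lemma Lp_dual_add:
  "\<phi> \<in> Lp_dual M p \<Longrightarrow> f \<in> Lp_space M p \<Longrightarrow> g \<in> Lp_space M p \<Longrightarrow> \<phi> (\<lambda>x. f x + g x) = \<phi> f + \<phi> g"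
  by (auto simp: Lp_dual_def)

lemma Lp_dual_scaleR:
  "\<phi> \<in> Lp_dual M p \<Longrightarrow> f \<in> Lp_space M p \<Longrightarrow> \<phi> (\<lambda>x. c *\<^sub>R f x) = c * \<phi> f"
  by (auto simp: Lp_dual_def)

lemma Lp_dual_zero:
  assumes "\<phi> \<in> Lp_dual M p"
  shows "\<phi> (\<lambda>x. 0) = 0"
  using Lp_dual_scaleR[OF assms Lp_space_zero, of 0] by simp

lemma Lp_dual_diff:
  fixes f g :: "'a \<Rightarrow> 'e::{real_normed_vector, second_countable_topology}"
  assumes "\<phi> \<in> Lp_dual M p" "f \<in> Lp_space M p" "g \<in> Lp_space M p"
  shows "\<phi> (\<lambda>x. f x - g x) = \<phi> f - \<phi> g"
  using Lp_dual_add[OF assms(1,2) Lp_space_uminus[OF assms(3)]]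
    Lp_dual_scaleR[OF assms(1,3), of "-1"] by simp

lemma Lp_dual_sum:
  fixes f :: "'i \<Rightarrow> 'a \<Rightarrow> 'e::{real_normed_vector, second_countable_topology}"
  assumes "\<phi> \<in> Lp_dual M p" "\<And>i. i \<in> I \<Longrightarrow> f i \<in> Lp_space M p" "p \<ge> 0"
  shows "\<phi> (\<lambda>x. \<Sum>i\<in>I. f i x) = (\<Sum>i\<in>I. \<phi> (f i))"
  using assms(2)
proof (induction I rule: infinite_finite_induct)
  case (insert i I)
  then show ?case
    using Lp_dual_add[OF assms(1), of "f i" "\<lambda>x. \<Sum>i\<in>I. f i x"] assms(3)
    by (simp add: Lp_space_sum)
qed (simp_all add: Lp_dual_zero[OF assms(1)])

text \<open>The constant in \<open>Lp_dual\<close> may be any real number. Enlarging it to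
  \<open>\<bar>C\<bar> + 1\<close> allows division by it when a tolerance for \<phi> is turned into
  a tolerance for the norm.\<close>

lemma Lp_dual_bound:
  assumes "\<phi> \<in> Lp_dual M p"
  obtains C where "C > 0" "\<And>f. f \<in> Lp_space M p \<Longrightarrow> \<bar>\<phi> f\<bar> \<le> C * Lp_norm M p f"
proof -
  have "\<exists>C. \<forall>f\<in>Lp_space M p. \<bar>\<phi> f\<bar> \<le> C * Lp_norm M p f"
    using assms by (simp add: Lp_dual_def)
  then obtain C where C: "\<And>f. f \<in> Lp_space M p \<Longrightarrow> \<bar>\<phi> f\<bar> \<le> C * Lp_norm M p f"
    by blast
  show ?thesis
  proof (rule that[of "\<bar>C\<bar> + 1"])
    fix f :: "'a \<Rightarrow> 'b" assume "f \<in> Lp_space M p"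
    then have "\<bar>\<phi> f\<bar> \<le> C * Lp_norm M p f" by (rule C)
    also have "\<dots> \<le> (\<bar>C\<bar> + 1) * Lp_norm M p f"
      by (intro mult_right_mono) (auto simp: Lp_norm_def)
    finally show "\<bar>\<phi> f\<bar> \<le> (\<bar>C\<bar> + 1) * Lp_norm M p f" .
  qed simp
qed

text \<open>The difference has seminorm zero, so boundedness of \<phi> kills it. This is used
  because time averages are additive only almost everywhere.\<close>

lemma Lp_dual_cong_AE:
  fixes f g :: "'a \<Rightarrow> 'e::{real_normed_vector, second_countable_topology}"
  assumes \<phi>: "\<phi> \<in> Lp_dual M p" and f: "f \<in> Lp_space M p" and g: "g \<in> Lp_space M p"
    and p: "p > 0" and ae: "AE x in M. f x = g x"
  shows "\<phi> f = \<phi> g"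
proof -
  obtain C where C: "\<And>f. f \<in> Lp_space M p \<Longrightarrow> \<bar>\<phi> f\<bar> \<le> C * Lp_norm M p f"
    using Lp_dual_bound[OF \<phi>] by metis
  have "(LINT x|M. norm (f x - g x) powr p) = (LINT x|M. 0)"
    using ae Lp_space_diff[OF f g] p by (intro integral_cong_AE) (auto simp: Lp_space_def)
  then have "Lp_norm M p (\<lambda>x. f x - g x) = 0"
    using p by (simp add: Lp_norm_def)
  then have "\<bar>\<phi> f - \<phi> g\<bar> \<le> 0"
    using C[OF Lp_space_diff[OF f g]] Lp_dual_diff[OF \<phi> f g] p by simp
  then show ?thesis by simp
qed

text \<open>By homogeneity a bound on the unit ball suffices, so pointwise estimates replace Holder's inequality.\<close>

lemma linear_bound_from_unit_ball:
  assumes scale: "\<And>c f. f \<in> Lp_space M p \<Longrightarrow> \<phi> (\<lambda>x. c *\<^sub>R f x) = c * \<phi> f"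
    and bound: "\<And>f. f \<in> Lp_space M p \<Longrightarrow> (LINT x|M. norm (f x) powr p) \<le> 1 \<Longrightarrow> \<bar>\<phi> f\<bar> \<le> C"
    and p: "p > 0" and f: "f \<in> Lp_space M p"
  shows "\<bar>\<phi> f\<bar> \<le> C * Lp_norm M p f"
proof -
  define A where "A = (LINT x|M. norm (f x) powr p)"
  have "A \<ge> 0" by (simp add: A_def)
  have int: "(LINT x|M. norm (c *\<^sub>R f x) powr p) = \<bar>c\<bar> powr p * A" for c
    by (simp add: A_def powr_mult)
  show ?thesis
  proof (cases "A = 0")
    case True
    \<comment> \<open>All multiples of f stay in the unit ball, so the left side is bounded in c,
      which forces \<open>\<phi> f = 0\<close>.\<close>
    have "\<bar>c\<bar> * \<bar>\<phi> f\<bar> \<le> C" for c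
      using bound[OF Lp_space_scaleR[OF f], of c] scale[OF f, of c] int[of c] True
      by (simp add: abs_mult)
    note * = this
    have "\<phi> f = 0"
    proof (rule ccontr)
      assume "\<phi> f \<noteq> 0"
      then show False using *[of "(C + 1) / \<bar>\<phi> f\<bar>"] *[of 0] by simp
    qed
    then show ?thesis using True p by (simp add: Lp_norm_def A_def)
  next
    case False
    then have "A > 0" using \<open>A \<ge> 0\<close> by simp
    define c where "c = A powr (- (1 / p))"
    have "c > 0" using \<open>A > 0\<close> by (simp add: c_def)
    have "\<bar>c\<bar> powr p * A = 1"
    proof -
      have "c powr p = A powr (- 1)"
        using p by (simp add: c_def powr_powr)
      then show ?thesis using \<open>A > 0\<close> \<open>c > 0\<close> by (simp add: powr_minus)
    qed
    then have "c * \<bar>\<phi> f\<bar> \<le> C"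
      using bound[OF Lp_space_scaleR[OF f], of c] scale[OF f, of c] int[of c] \<open>c > 0\<close>
      by (simp add: abs_mult)
    then have "\<bar>\<phi> f\<bar> \<le> C / c" using \<open>c > 0\<close> by (simp add: field_simps)
    also have "\<dots> = C * Lp_norm M p f"
      using \<open>A > 0\<close> by (simp add: Lp_norm_def c_def powr_minus divide_simps flip: A_def)
    finally show ?thesis .
  qed
qed

lemma Lp_dualI:
  assumes add: "\<And>f g. f \<in> Lp_space M p \<Longrightarrow> g \<in> Lp_space M p \<Longrightarrow> \<phi> (\<lambda>x. f x + g x) = \<phi> f + \<phi> g"
    and scale: "\<And>c f. f \<in> Lp_space M p \<Longrightarrow> \<phi> (\<lambda>x. c *\<^sub>R f x) = c * \<phi> f"
    and bound: "\<And>f. f \<in> Lp_space M p \<Longrightarrow> (LINT x|M. norm (f x) powr p) \<le> 1 \<Longrightarrow> \<bar>\<phi> f\<bar> \<le> C"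
    and p: "p > 0"
  shows "\<phi> \<in> Lp_dual M p"
proof -
  have "\<bar>\<phi> f\<bar> \<le> C * Lp_norm M p f" if "f \<in> Lp_space M p" for f
    by (rule linear_bound_from_unit_ball[where \<phi> = \<phi>]) (use scale bound p that in auto)
  then show ?thesis
    using add scale unfolding Lp_dual_def by blast
qed

text \<open>On a finite measure space the Lp unit ball is bounded in L2, by
  \<open>Lp_space_2\<close>, so a functional on L2 restricts to a bounded one on Lp.\<close>

lemma (in finite_measure) Lp_dual_2_subset:
  assumes \<phi>: "\<phi> \<in> Lp_dual M 2" and p: "p \<ge> 2"
  shows "\<phi> \<in> Lp_dual M p"
proof -
  obtain C where C: "C > 0" "\<And>f. f \<in> Lp_space M 2 \<Longrightarrow> \<bar>\<phi> f\<bar> \<le> C * Lp_norm M 2 f"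
    using Lp_dual_bound[OF \<phi>] by metis
  show ?thesis
  proof (rule Lp_dualI[where C = "C * sqrt (measure M (space M) + 1)"])
    fix f :: "'a \<Rightarrow> 'b"
    assume f: "f \<in> Lp_space M p" and "(LINT x|M. norm (f x) powr p) \<le> 1"
    then have "Lp_norm M 2 f \<le> sqrt (measure M (space M) + 1)"
      using Lp_space_2(2)[OF f p] by (simp add: Lp_norm_2)
    then show "\<bar>\<phi> f\<bar> \<le> C * sqrt (measure M (space M) + 1)"
      using C(2)[OF Lp_space_2(1)[OF f p]] \<open>C > 0\<close> by (smt (verit) mult_left_mono)
  next
    fix f g :: "'a \<Rightarrow> 'b" assume "f \<in> Lp_space M p" "g \<in> Lp_space M p"
    then show "\<phi> (\<lambda>x. f x + g x) = \<phi> f + \<phi> g"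
      using Lp_dual_add[OF \<phi>] Lp_space_2(1) p by blast
  next
    fix c and f :: "'a \<Rightarrow> 'b" assume "f \<in> Lp_space M p"
    then show "\<phi> (\<lambda>x. c *\<^sub>R f x) = c * \<phi> f"
      using Lp_dual_scaleR[OF \<phi>] Lp_space_2(1) p by blast
  qed (use p in simp)
qed

lemma (in finite_measure) Lp_converges_weakly_2:
  assumes "Lp_converges_weakly M p f g" "p \<ge> 2"
  shows "Lp_converges_weakly M 2 f g"
  using assms Lp_dual_2_subset Lp_space_2(1) unfolding Lp_converges_weakly_def by blast

text \<open>Composition with B is a bounded operator on Lp, so \<phi> preceded by it is again an
  admissible test functional. The bound \<open>(K powr p) powr (1 / p)\<close> is K, left
  unsimplified.\<close>

lemma Lp_converges_weakly_bounded_linear: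
  assumes conv: "Lp_converges_weakly M p f g" and B: "bounded_linear B" and p: "p > 0"
  shows "Lp_converges_weakly M p (\<lambda>n x. B (f n x)) (\<lambda>x. B (g x))"
proof -
  interpret bounded_linear B by (rule B)
  obtain K where K: "\<And>x. norm (B x) \<le> norm x * K" and "K > 0"
    using pos_bounded by blast
  have "(\<lambda>n. \<phi> (\<lambda>x. B (f n x))) \<longlonglongrightarrow> \<phi> (\<lambda>x. B (g x))" if \<phi>: "\<phi> \<in> Lp_dual M p" for \<phi>
  proof -
    obtain C where C: "C > 0" "\<And>f. f \<in> Lp_space M p \<Longrightarrow> \<bar>\<phi> f\<bar> \<le> C * Lp_norm M p f"
      using Lp_dual_bound[OF \<phi>] by metis
    have "(\<lambda>u. \<phi> (\<lambda>x. B (u x))) \<in> Lp_dual M p"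
    proof (rule Lp_dualI[where C = "C * (K powr p) powr (1 / p)"])
      fix u :: "'a \<Rightarrow> 'b" assume u: "u \<in> Lp_space M p" "(LINT x|M. norm (u x) powr p) \<le> 1"
      note Bu = Lp_space_bounded_linear[OF B u(1) less_imp_le[OF p]]
      have le: "norm (B y) powr p \<le> K powr p * norm y powr p" for y
        using K[of y] \<open>K > 0\<close> p
        by (subst mult.commute, subst powr_mult[symmetric]) (auto intro!: powr_mono2)
      have "(LINT x|M. norm (B (u x)) powr p) \<le> (LINT x|M. K powr p * norm (u x) powr p)"
        using u(1) Bu le by (intro integral_mono) (auto simp: Lp_space_def)
      also have "\<dots> \<le> K powr p" using u(2) by (simp add: mult_left_le)
      finally have "Lp_norm M p (\<lambda>x. B (u x)) \<le> (K powr p) powr (1 / p)"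
        unfolding Lp_norm_def using p by (intro powr_mono2) auto
      then show "\<bar>\<phi> (\<lambda>x. B (u x))\<bar> \<le> C * (K powr p) powr (1 / p)"
        using C(2)[OF Bu] \<open>C > 0\<close> by (smt (verit) mult_left_mono)
    next
      fix u v :: "'a \<Rightarrow> 'b" assume "u \<in> Lp_space M p" "v \<in> Lp_space M p"
      then show "\<phi> (\<lambda>x. B (u x + v x)) = \<phi> (\<lambda>x. B (u x)) + \<phi> (\<lambda>x. B (v x))"
        using Lp_dual_add[OF \<phi> Lp_space_bounded_linear[OF B] Lp_space_bounded_linear[OF B], of u v] p
        by (simp add: add)
    next
      fix c and u :: "'a \<Rightarrow> 'b" assume "u \<in> Lp_space M p"
      then show "\<phi> (\<lambda>x. B (c *\<^sub>R u x)) = c * \<phi> (\<lambda>x. B (u x))"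
        using Lp_dual_scaleR[OF \<phi> Lp_space_bounded_linear[OF B], of u c] p by (simp add: scaleR)
    qed (rule p)
    moreover have "\<psi> \<in> Lp_dual M p \<Longrightarrow> (\<lambda>n. \<psi> (f n)) \<longlonglongrightarrow> \<psi> g" for \<psi>
      using conv by (simp add: Lp_converges_weakly_def)
    ultimately show ?thesis by blast
  qed
  then show ?thesis
    using conv Lp_space_bounded_linear[OF B _ less_imp_le[OF p]]
    unfolding Lp_converges_weakly_def by blast
qed

subsection \<open>Weakly convergent sequences are bounded\<close>

text \<open>Coefficients of the gliding hump series. The sign is chosen so that in column k the k-th
  term does not cancel the sum of the earlier ones. The ratio 1/5 makes the tail beyond k at most
  half of the k-th term when the entries of the column are at most twice the diagonal one:
  \<open>1/5 * 5/4 * 2 = 1/2\<close>.\<close>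

fun hump_coeff :: "(nat \<Rightarrow> nat \<Rightarrow> real) \<Rightarrow> nat \<Rightarrow> real" where
  "hump_coeff c k = (if (\<Sum>j\<in>{..<k}. hump_coeff c j * c j k) \<ge> 0 then 1 else - 1) * (1 / 5) ^ k"

declare hump_coeff.simps [simp del]

lemma abs_hump_coeff: "\<bar>hump_coeff c k\<bar> = (1 / 5) ^ k"
  by (subst hump_coeff.simps) (simp add: abs_mult power_abs)

text \<open>The head of column k up to the diagonal is at least the diagonal term, by the choice of
  sign, and the tail is at most half of it. The growth \<open>10 ^ k\<close> beats the weight
  \<open>(1 / 5) ^ k\<close> and leaves \<open>2 ^ k\<close>. The factor 2 in the first hypothesis
  is the bound that \<open>norming_functional\<close> provides.\<close>

lemma hump_lower_bound:
  assumes le: "\<And>j. \<bar>c j k\<bar> \<le> 2 * c k k" and large: "c k k \<ge> 10 ^ k"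
  shows "\<bar>\<Sum>j. hump_coeff c j * c j k\<bar> \<ge> 2 ^ k / 2"
proof -
  have abs_le: "\<bar>hump_coeff c j * c j k\<bar> \<le> (1 / 5) ^ j * (2 * c k k)" for j
    using le[of j] by (auto simp: abs_mult abs_hump_coeff intro!: mult_left_mono)
  have geom: "summable (\<lambda>j. (1 / 5) ^ j * (2 * c k k))"
    by (intro summable_mult2) simp
  have sm: "summable (\<lambda>j. hump_coeff c j * c j k)"
    by (rule summable_comparison_test[OF _ geom]) (use abs_le in auto)
  have "\<bar>\<Sum>j. hump_coeff c (j + Suc k) * c (j + Suc k) k\<bar>
      \<le> (\<Sum>j. (1 / 5) ^ j * ((1 / 5) ^ Suc k * (2 * c k k)))"
  proof (rule order_trans[OF summable_rabs])
    have *: "\<bar>hump_coeff c (j + Suc k) * c (j + Suc k) k\<bar>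
        \<le> (1 / 5) ^ j * ((1 / 5) ^ Suc k * (2 * c k k))" for j
      using abs_le[of "j + Suc k"] by (simp add: power_add mult_ac)
    have s2: "summable (\<lambda>j. (1 / 5) ^ j * ((1 / 5) ^ Suc k * (2 * c k k)))"
      by (intro summable_mult2) simp
    show sa: "summable (\<lambda>j. \<bar>hump_coeff c (j + Suc k) * c (j + Suc k) k\<bar>)"
      by (rule summable_comparison_test[OF _ s2]) (use * in auto)
    show "(\<Sum>j. \<bar>hump_coeff c (j + Suc k) * c (j + Suc k) k\<bar>)
        \<le> (\<Sum>j. (1 / 5) ^ j * ((1 / 5) ^ Suc k * (2 * c k k)))"
      by (intro suminf_le * sa s2)
  qed
  also have "\<dots> = (1 / 5) ^ k * c k k / 2"
    by (subst suminf_mult2[symmetric]) (simp_all add: suminf_geometric)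
  finally have tail: "\<bar>\<Sum>j. hump_coeff c (j + Suc k) * c (j + Suc k) k\<bar> \<le> (1 / 5) ^ k * c k k / 2" .
  have head: "\<bar>\<Sum>j<Suc k. hump_coeff c j * c j k\<bar> \<ge> (1 / 5) ^ k * c k k"
  proof -
    define x where "x = (\<Sum>j<k. hump_coeff c j * c j k)"
    have ck: "c k k \<ge> 0" using large by (rule order_trans[rotated]) simp
    have "hump_coeff c k = (if x \<ge> 0 then 1 else - 1) * (1 / 5) ^ k"
      by (subst hump_coeff.simps) (simp add: x_def)
    then have "hump_coeff c k * c k k = (if x \<ge> 0 then 1 else - 1) * ((1 / 5) ^ k * c k k)"
      by simp
    moreover have "(1 / 5) ^ k * c k k \<ge> 0" using ck by simp
    ultimately have "\<bar>x + hump_coeff c k * c k k\<bar> \<ge> (1 / 5) ^ k * c k k"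
      by (auto split: if_splits)
    then show ?thesis by (simp add: x_def)
  qed
  have split: "(\<Sum>j. hump_coeff c j * c j k) =
      (\<Sum>j. hump_coeff c (j + Suc k) * c (j + Suc k) k) + (\<Sum>j<Suc k. hump_coeff c j * c j k)"
    by (rule suminf_split_initial_segment[OF sm])
  have "(2::real) ^ k = (1 / 5) ^ k * 10 ^ k"
    by (simp flip: power_mult_distrib)
  also have "\<dots> \<le> (1 / 5) ^ k * c k k"
    using large by (intro mult_left_mono) auto
  finally show ?thesis
    using tail head split by linarith
qed

text \<open>The functional is integration against the duality map of g: h is \<open>g / a\<close>
  times the power \<open>p - 2\<close> of its norm. Hoelder's inequality would give the bound 1; the
  pointwise estimate used here gives 2, which the gliding hump tolerates.\<close>

lemma norming_functional:
  fixes g :: "'a \<Rightarrow> 'e::euclidean_space"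
  assumes g: "g \<in> Lp_space M p" and p: "p \<ge> 2"
  obtains \<phi> where "\<phi> \<in> Lp_dual M p" "\<phi> g = Lp_norm M p g"
    "\<And>f. f \<in> Lp_space M p \<Longrightarrow> \<bar>\<phi> f\<bar> \<le> 2 * Lp_norm M p f"
proof (cases "Lp_norm M p g = 0")
  case True
  show ?thesis
    by (rule that[of "\<lambda>_. 0"]) (use True in \<open>auto simp: Lp_dual_def Lp_norm_def intro!: exI[of _ 0]\<close>)
next
  case False
  define a where "a = Lp_norm M p g"
  have "a > 0" using False by (simp add: a_def Lp_norm_def less_le)
  define h where "h x = (norm (g x) / a) powr (p - 2) *\<^sub>R (g x /\<^sub>R a)" for x
  define \<phi> where "\<phi> f = (LINT x|M. f x \<bullet> h x)" for f :: "'a \<Rightarrow> 'e"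
  have [measurable]: "g \<in> borel_measurable M" using g by (auto simp: Lp_space_def)
  have [measurable]: "h \<in> borel_measurable M" unfolding h_def by measurable
  have intg: "integrable M (\<lambda>x. norm (g x) powr p)" using g by (auto simp: Lp_space_def)
  have ap: "a powr p = (LINT x|M. norm (g x) powr p)"
    using p by (simp add: a_def Lp_norm_def powr_powr)
  have normh: "norm (h x) = (norm (g x) / a) powr (p - 1)" for x
  proof (cases "g x = 0")
    case False
    then have "norm (h x) = (norm (g x) / a) powr (p - 2) * (norm (g x) / a) powr 1"
      using \<open>a > 0\<close> by (simp add: h_def field_simps)
    also have "\<dots> = (norm (g x) / a) powr (p - 1)" by (simp only: powr_add[symmetric]) simp
    finally show ?thesis .
  qed (simp add: h_def)
  have le: "norm (f x \<bullet> h x) \<le> norm (f x) powr p + norm (g x) powr p / a powr p"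
    for f :: "'a \<Rightarrow> 'e" and x
  proof -
    define y where "y = norm (g x) / a"
    \<comment> \<open>Replacing both factors by their maximum turns the product into
      \<open>m powr p\<close>, a crude substitute for Young's inequality.\<close>
    define m where "m = max (norm (f x)) y"
    have "y \<ge> 0" using \<open>a > 0\<close> by (simp add: y_def)
    have "norm (f x \<bullet> h x) \<le> norm (f x) * y powr (p - 1)"
      using Cauchy_Schwarz_ineq2[of "f x" "h x"] by (simp add: normh y_def)
    also have "\<dots> \<le> m * m powr (p - 1)"
      using p \<open>y \<ge> 0\<close> by (intro mult_mono powr_mono2) (auto simp: m_def)
    also have "\<dots> = m powr p"
      using powr_add[of m 1 "p - 1"] \<open>y \<ge> 0\<close> by (simp add: m_def)
    also have "\<dots> \<le> norm (f x) powr p + y powr p"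
      using p by (auto simp: m_def max_def)
    also have "y powr p = norm (g x) powr p / a powr p"
      using \<open>a > 0\<close> by (simp add: y_def powr_divide)
    finally show ?thesis .
  qed
  have int: "integrable M (\<lambda>x. f x \<bullet> h x)" if f: "f \<in> Lp_space M p" for f :: "'a \<Rightarrow> 'e"
  proof (rule Bochner_Integration.integrable_bound)
    show "integrable M (\<lambda>x. norm (f x) powr p + norm (g x) powr p / a powr p)"
      using f intg by (auto simp: Lp_space_def)
    show "AE x in M. norm (f x \<bullet> h x) \<le> norm (norm (f x) powr p + norm (g x) powr p / a powr p)"
      using le by (auto simp: abs_of_nonneg intro!: AE_I2)
  qed (use f in \<open>auto simp: Lp_space_def\<close>)
  have unit: "\<bar>\<phi> f\<bar> \<le> 2" if f: "f \<in> Lp_space M p" and f1: "(LINT x|M. norm (f x) powr p) \<le> 1"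
    for f :: "'a \<Rightarrow> 'e"
  proof -
    have "\<bar>\<phi> f\<bar> \<le> (LINT x|M. norm (f x) powr p + norm (g x) powr p / a powr p)"
      unfolding \<phi>_def
      by (rule order_trans[OF integral_abs_bound], rule integral_mono)
        (use int[OF f] f intg le[of f] in \<open>auto simp: Lp_space_def\<close>)
    also have "\<dots> = (LINT x|M. norm (f x) powr p) + a powr p / a powr p"
      using f intg by (subst Bochner_Integration.integral_add) (auto simp: Lp_space_def ap)
    also have "\<dots> \<le> 2" using f1 \<open>a > 0\<close> by simp
    finally show ?thesis .
  qed
  have add: "\<phi> (\<lambda>x. f x + u x) = \<phi> f + \<phi> u"
    if "f \<in> Lp_space M p" "u \<in> Lp_space M p" for f u
    using int that by (simp add: \<phi>_def inner_add_left)
  have scale: "\<phi> (\<lambda>x. c *\<^sub>R f x) = c * \<phi> f" for c f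
    by (simp add: \<phi>_def)
  have "\<phi> \<in> Lp_dual M p"
    by (rule Lp_dualI[OF add scale unit]) (use p in auto)
  moreover have "\<phi> g = a"
  proof -
    have "g x \<bullet> h x = norm (g x) powr p * a powr (1 - p)" for x
    proof (cases "g x = 0")
      case False
      have "g x \<bullet> h x = (norm (g x) powr (p - 2) * norm (g x) powr 2) * (a powr (- (p - 2)) * a powr (- 1))"
      proof -
        have "a powr (- (p - 2)) = inverse (a powr (p - 2))" by (rule powr_minus)
        then show ?thesis
          using \<open>a > 0\<close>
          by (simp add: h_def powr_divide divide_simps power2_norm_eq_inner del: minus_diff_eq)
      qed
      also have "\<dots> = norm (g x) powr p * a powr (1 - p)"
        unfolding powr_add[symmetric] by simp
      finally show ?thesis .
    qed simp
    then have "\<phi> g = a powr p * a powr (1 - p)"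
      by (simp add: \<phi>_def ap)
    also have "\<dots> = a" using \<open>a > 0\<close> by (simp flip: powr_add)
    finally show ?thesis .
  qed
  moreover have "\<bar>\<phi> f\<bar> \<le> 2 * Lp_norm M p f" if "f \<in> Lp_space M p" for f
    by (rule linear_bound_from_unit_ball[OF scale unit _ that]) (use p in auto)
  ultimately show ?thesis using that by (simp add: a_def)
qed

text \<open>
  The gliding hump runs inside the dual space, whose completeness is the convergence of a
  geometric series; completeness of $L^q$ or a representation of its functionals is not needed.
\<close>

lemma Lp_converges_weakly_bounded:
  fixes f :: "nat \<Rightarrow> 'a \<Rightarrow> 'e::euclidean_space"
  assumes conv: "Lp_converges_weakly M p f g" and p: "p \<ge> 2"
  obtains C where "\<And>n. (LINT x|M. norm (f n x) powr p) \<le> C"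
proof -
  have f: "f n \<in> Lp_space M p" for n
    using conv by (auto simp: Lp_converges_weakly_def)
  have "\<exists>D. \<forall>n. Lp_norm M p (f n) \<le> D"
  proof (rule ccontr)
    assume unbdd: "\<nexists>D. \<forall>n. Lp_norm M p (f n) \<le> D"
    \<comment> \<open>Only the growth along k matters; the indices obtained from this need not
      increase.\<close>
    have "\<exists>n. Lp_norm M p (f n) \<ge> 10 ^ k" for k :: nat
      using unbdd by (meson linear)
    then obtain n where n: "\<And>k. Lp_norm M p (f (n k)) \<ge> 10 ^ k" by metis
    have "\<exists>\<phi>. \<phi> \<in> Lp_dual M p \<and> \<phi> (f (n k)) = Lp_norm M p (f (n k)) \<and>
        (\<forall>u\<in>Lp_space M p. \<bar>\<phi> u\<bar> \<le> 2 * Lp_norm M p u)" for k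
      using norming_functional[OF f p, of "n k"] by metis
    then obtain \<phi> where \<phi>: "\<And>k. \<phi> k \<in> Lp_dual M p"
      "\<And>k. \<phi> k (f (n k)) = Lp_norm M p (f (n k))"
      "\<And>k u. u \<in> Lp_space M p \<Longrightarrow> \<bar>\<phi> k u\<bar> \<le> 2 * Lp_norm M p u"
      by metis
    \<comment> \<open>Column k lists all the functionals at the single function
      \<open>f (n k)\<close>; its diagonal entry is the norm of that function and every other entry
      is at most twice that norm.\<close>
    define c where "c j k = \<phi> j (f (n k))" for j k
    define \<Phi> where "\<Phi> u = (\<Sum>j. hump_coeff c j * \<phi> j u)" for u
    have abs_le: "\<bar>hump_coeff c j * \<phi> j u\<bar> \<le> (1 / 5) ^ j * (2 * Lp_norm M p u)"
      if "u \<in> Lp_space M p" for j u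
      using \<phi>(3)[OF that, of j] by (auto simp: abs_mult abs_hump_coeff intro!: mult_left_mono)
    have geom: "summable (\<lambda>j. (1 / 5) ^ j * (2 * Lp_norm M p u))" for u :: "'a \<Rightarrow> 'e"
      by (intro summable_mult2) simp
    have sma: "summable (\<lambda>j. \<bar>hump_coeff c j * \<phi> j u\<bar>)" if "u \<in> Lp_space M p" for u
      by (rule summable_comparison_test[OF _ geom]) (use abs_le[OF that] in auto)
    have sm: "summable (\<lambda>j. hump_coeff c j * \<phi> j u)" if "u \<in> Lp_space M p" for u
      using sma[OF that] by (rule summable_rabs_cancel)
    have "\<Phi> \<in> Lp_dual M p"
      unfolding Lp_dual_def mem_Collect_eq
    proof (intro conjI ballI allI exI)
      fix u v :: "'a \<Rightarrow> 'e" assume "u \<in> Lp_space M p" "v \<in> Lp_space M p"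
      then show "\<Phi> (\<lambda>x. u x + v x) = \<Phi> u + \<Phi> v"
        using Lp_dual_add[OF \<phi>(1)] sm by (simp add: \<Phi>_def suminf_add algebra_simps)
    next
      fix r and u :: "'a \<Rightarrow> 'e" assume "u \<in> Lp_space M p"
      then show "\<Phi> (\<lambda>x. r *\<^sub>R u x) = r * \<Phi> u"
        using Lp_dual_scaleR[OF \<phi>(1)] sm by (simp add: \<Phi>_def mult.left_commute suminf_mult)
    next
      fix u :: "'a \<Rightarrow> 'e" assume u: "u \<in> Lp_space M p"
      have "\<bar>\<Phi> u\<bar> \<le> (\<Sum>j. (1 / 5) ^ j * (2 * Lp_norm M p u))"
        unfolding \<Phi>_def using sma[OF u] abs_le[OF u] geom
        by (intro order_trans[OF summable_rabs] suminf_le) auto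
      also have "\<dots> = 5 / 2 * Lp_norm M p u"
        by (subst suminf_mult2[symmetric]) (simp_all add: suminf_geometric)
      finally show "\<bar>\<Phi> u\<bar> \<le> 5 / 2 * Lp_norm M p u" .
    qed
    then have "convergent (\<lambda>i. \<Phi> (f i))"
      using conv by (auto simp: Lp_converges_weakly_def convergent_def)
    then have "Bseq (\<lambda>i. \<Phi> (f i))" by (rule convergent_imp_Bseq)
    then obtain B where B: "\<And>i. \<bar>\<Phi> (f i)\<bar> \<le> B" by (auto simp: Bseq_def)
    have "2 ^ k / 2 \<le> \<bar>\<Phi> (f (n k))\<bar>" for k
      using hump_lower_bound[of c k] \<phi>(2)[of k] \<phi>(3)[OF f, of _ "n k"] n[of k]
      by (simp add: c_def \<Phi>_def)
    with B have "2 ^ k \<le> 2 * B" for k :: nat by (smt (verit) field_sum_of_halves)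
    moreover obtain k where "2 * B < 2 ^ k"
      using real_arch_pow[of 2 "2 * B"] by auto
    ultimately show False by (meson not_le)
  qed
  then obtain D where D: "\<And>n. Lp_norm M p (f n) \<le> D" by blast
  show ?thesis
  proof (rule that)
    fix n
    have "(LINT x|M. norm (f n x) powr p) = Lp_norm M p (f n) powr p"
      using p by (simp add: Lp_norm_def powr_powr)
    also have "\<dots> \<le> D powr p"
      using D[of n] p by (intro powr_mono2) (auto simp: Lp_norm_def)
    finally show "(LINT x|M. norm (f n x) powr p) \<le> D powr p" .
  qed
qed

section \<open>Gaussian moments of Wiener increments\<close>

lemma vec_Basis_real: "(Basis :: (real^'k) set) = range (\<lambda>i. axis i 1)"
  by (auto simp: Basis_vec_def)

text \<open>\<open>lborel\<close> on \<open>real ^ 'k\<close> is the image of a product measure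
  indexed by the basis vectors, and there the integral factorizes; the rest is the change of index
  between components and basis vectors.\<close>

lemma lborel_prod_component:
  fixes g :: "'k::finite \<Rightarrow> real \<Rightarrow> real"
  assumes "\<And>i. integrable lborel (g i)"
  shows "integrable lborel (\<lambda>x :: real^'k. \<Prod>i\<in>UNIV. g i (x $ i))"
    and "(LINT x|(lborel :: (real^'k) measure). (\<Prod>i\<in>UNIV. g i (x $ i))) = (\<Prod>i\<in>UNIV. LINT x|lborel. g i x)"
proof -
  interpret product_sigma_finite "\<lambda>_::real^'k. lborel :: real measure" ..
  \<comment> \<open>The factor of component i, indexed by the basis vector \<open>axis i 1\<close>;
    \<open>THE\<close> inverts this injective indexing.\<close>
  define h where "h b = g (THE i. b = axis i (1::real))" for b :: "real^'k"
  have h: "h (axis i 1) = g i" for i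
    unfolding h_def by (rule arg_cong[of _ _ g], rule the_equality) (auto simp: axis_eq_axis)
  have inj: "inj (\<lambda>i::'k. axis i (1::real))"
    by (auto simp: inj_on_def axis_eq_axis)
  have prod_eq: "(\<Prod>b\<in>Basis. F b) = (\<Prod>i\<in>UNIV. F (axis i 1))" for F :: "real^'k \<Rightarrow> real"
    unfolding vec_Basis_real by (subst prod.reindex) (use inj in auto)
  have comp: "(\<Sum>b\<in>Basis. f b *\<^sub>R b) $ i = f (axis i 1)" for f :: "real^'k \<Rightarrow> real" and i
  proof -
    have "(\<Sum>b\<in>Basis. f b *\<^sub>R b) $ i = (\<Sum>b\<in>Basis. f b *\<^sub>R b) \<bullet> axis i 1"
      by (simp add: inner_axis)
    also have "\<dots> = f (axis i 1)"
      by (subst inner_sum_left_Basis) (auto simp: Basis_vec_def)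
    finally show ?thesis .
  qed
  have meas [measurable]: "g i \<in> borel_measurable borel" for i
    using assms[of i] by (simp add: borel_measurable_integrable measurable_lborel1)
  have inth: "integrable lborel (h b)" if "b \<in> Basis" for b
    using that h assms by (auto simp: vec_Basis_real)
  have eq: "(\<Prod>i\<in>UNIV. g i ((\<Sum>b\<in>Basis. f b *\<^sub>R b) $ i)) = (\<Prod>b\<in>Basis. h b (f b))" for f
    by (simp only: prod_eq h comp)
  have M: "(\<lambda>f. \<Sum>b\<in>Basis. f b *\<^sub>R b) \<in> (\<Pi>\<^sub>M b\<in>Basis. lborel) \<rightarrow>\<^sub>M (borel :: (real^'k) measure)"
    by measurable
  show "integrable lborel (\<lambda>x :: real^'k. \<Prod>i\<in>UNIV. g i (x $ i))"
    by (subst lborel_eq, subst integrable_distr_eq[OF M], measurable)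
      (simp only: eq, intro product_integrable_prod inth, simp)
  show "(LINT x|(lborel :: (real^'k) measure). (\<Prod>i\<in>UNIV. g i (x $ i))) = (\<Prod>i\<in>UNIV. LINT x|lborel. g i x)"
    by (subst lborel_eq, subst integral_distr[OF M], measurable)
      (simp only: eq, subst product_integral_prod, auto intro: inth simp: prod_eq h)
qed

context wiener_process
begin

lemma space_F: "t \<in> {0..T} \<Longrightarrow> space (F t) = space M"
  and sets_F: "t \<in> {0..T} \<Longrightarrow> sets (F t) \<subseteq> sets M"
  using subalgebra_F[of t] by (auto simp: subalgebra_def)

lemma measurable_F:
  "t \<in> {0..T} \<Longrightarrow> f \<in> F t \<rightarrow>\<^sub>M N \<Longrightarrow> f \<in> M \<rightarrow>\<^sub>M N"
  using subalgebra_F[of t] by (auto intro: measurable_from_subalg)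

lemma measurable_F_mono:
  "0 \<le> s \<Longrightarrow> s \<le> t \<Longrightarrow> t \<le> T \<Longrightarrow> f \<in> F s \<rightarrow>\<^sub>M N \<Longrightarrow> f \<in> F t \<rightarrow>\<^sub>M N"
  using sets_F_mono[of s t] subalgebra_F[of s] subalgebra_F[of t]
  by (intro measurable_from_subalg[of "F t" "F s"]) (auto simp: subalgebra_def)

lemma measurable_W [measurable (raw)]:
  "t \<in> {0..T} \<Longrightarrow> W t \<in> borel_measurable M"
  using adapted measurable_F by blast

text \<open>Independence is inherited by smaller sigma-algebras: X generates one inside
  \<open>F s\<close>, and g of the increment generates one inside that of the increment.\<close>

lemma indep_var_increment:
  fixes X :: "'a \<Rightarrow> real"
  assumes st: "0 \<le> s" "s < t" "t \<le> T"
    and X: "X \<in> borel_measurable (F s)" and g: "g \<in> borel_measurable borel"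
  shows "indep_var borel X borel (\<lambda>\<omega>. g (W t \<omega> - W s \<omega>))"
proof -
  have "s \<in> {0..T}" "t \<in> {0..T}" using st by auto
  note F = space_F[OF this(1)] sets_F[OF this(1)]
  have D: "(\<lambda>\<omega>. W t \<omega> - W s \<omega>) \<in> borel_measurable M"
    using \<open>s \<in> {0..T}\<close> \<open>t \<in> {0..T}\<close> by measurable
  have gD: "(\<lambda>\<omega>. g (W t \<omega> - W s \<omega>)) \<in> borel_measurable M"
    using measurable_compose[OF D g] .
  have a: "sigma_sets (space M) {X -` A \<inter> space M |A. A \<in> sets borel} \<subseteq> sets (F s)"
    using sets.sigma_sets_subset[of "{X -` A \<inter> space M |A. A \<in> sets borel}" "F s"] measurable_sets[OF X]
    by (auto simp: F(1))
  have b: "sigma_sets (space M) {(\<lambda>\<omega>. g (W t \<omega> - W s \<omega>)) -` A \<inter> space M |A. A \<in> sets borel}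
      \<subseteq> sets (vimage_algebra (space M) (\<lambda>\<omega>. W t \<omega> - W s \<omega>) borel)"
  proof (rule sets.sigma_sets_subset[of _ "vimage_algebra (space M) (\<lambda>\<omega>. W t \<omega> - W s \<omega>) borel", simplified])
    show "{(\<lambda>\<omega>. g (W t \<omega> - W s \<omega>)) -` A \<inter> space M |A. A \<in> sets borel}
      \<subseteq> sets (vimage_algebra (space M) (\<lambda>\<omega>. W t \<omega> - W s \<omega>) borel)"
    proof safe
      fix A :: "real set" assume "A \<in> sets borel"
      then have "g -` A \<in> sets borel" using measurable_sets[OF g, of A] by simp
      then have "(\<lambda>\<omega>. W t \<omega> - W s \<omega>) -` (g -` A) \<inter> space M
          \<in> sets (vimage_algebra (space M) (\<lambda>\<omega>. W t \<omega> - W s \<omega>) borel)"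
        by (rule in_vimage_algebra)
      then show "(\<lambda>\<omega>. g (W t \<omega> - W s \<omega>)) -` A \<inter> space M
          \<in> sets (vimage_algebra (space M) (\<lambda>\<omega>. W t \<omega> - W s \<omega>) borel)"
        by (simp add: vimage_def)
    qed
  qed
  have "indep_set (sigma_sets (space M) {X -` A \<inter> space M |A. A \<in> sets borel})
     (sigma_sets (space M) {(\<lambda>\<omega>. g (W t \<omega> - W s \<omega>)) -` A \<inter> space M |A. A \<in> sets borel})"
    unfolding indep_set_def
    by (rule indep_sets_mono_sets[OF increment_indep[OF st, unfolded indep_set_def]])
      (use a b in \<open>auto split: bool.split\<close>)
  then show ?thesis
    unfolding indep_var_eq using measurable_F[OF \<open>s \<in> {0..T}\<close> X] gD by simp
qed

text \<open>The right-hand sides involve only g and the length \<open>t - s\<close>. Wiener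
  processes on different filtrations thus give the same value, which later lets one truncation level
  serve all n.\<close>

lemma increment_integral:
  assumes st: "0 \<le> s" "s < t" "t \<le> T" and g: "g \<in> borel_measurable borel"
  shows "(LINT \<omega>|M. g (W t \<omega> - W s \<omega>)) =
      (LINT x|lborel. (\<Prod>i\<in>UNIV. normal_density 0 (sqrt (t - s)) (x $ i)) * (g x :: real))"
    and "integrable M (\<lambda>\<omega>. g (W t \<omega> - W s \<omega>)) \<longleftrightarrow>
      integrable lborel (\<lambda>x. (\<Prod>i\<in>UNIV. normal_density 0 (sqrt (t - s)) (x $ i)) * g x)"
proof -
  have "0 \<le> (\<Prod>i\<in>UNIV. normal_density 0 (sqrt (t - s)) (x $ i))" for x :: "real^'k"
    by (intro prod_nonneg) auto
  note * = distributed_integral[OF increment_normal[OF st] _ this, of g]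
    distributed_integrable[OF increment_normal[OF st] _ this, of g]
  show "(LINT \<omega>|M. g (W t \<omega> - W s \<omega>)) =
      (LINT x|lborel. (\<Prod>i\<in>UNIV. normal_density 0 (sqrt (t - s)) (x $ i)) * (g x :: real))"
    using *(1) g by simp
  show "integrable M (\<lambda>\<omega>. g (W t \<omega> - W s \<omega>)) \<longleftrightarrow>
      integrable lborel (\<lambda>x. (\<Prod>i\<in>UNIV. normal_density 0 (sqrt (t - s)) (x $ i)) * g x)"
    using *(2) g by simp
qed

text \<open>A monomial in the coordinates can be absorbed into the factors of the product density,
  which reduces everything to the moments of order 0, 1 and 2 of a normal law on the line.\<close>

lemma increment_moments:
  assumes st: "0 \<le> s" "s < t" "t \<le> T"
  shows "integrable M (\<lambda>\<omega>. (W t \<omega> - W s \<omega>) $ i)"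
    and "(LINT \<omega>|M. (W t \<omega> - W s \<omega>) $ i) = 0"
    and "integrable M (\<lambda>\<omega>. (W t \<omega> - W s \<omega>) $ i * (W t \<omega> - W s \<omega>) $ j)"
    and "(LINT \<omega>|M. (W t \<omega> - W s \<omega>) $ i * (W t \<omega> - W s \<omega>) $ j) = (if i = j then t - s else 0)"
proof -
  define \<sigma> where "\<sigma> = sqrt (t - s)"
  have \<sigma>: "\<sigma> > 0" "\<sigma>\<^sup>2 = t - s" using st by (auto simp: \<sigma>_def)
  define d where "d = normal_density 0 \<sigma>"
  have d0: "has_bochner_integral lborel d 1"
    using normal_moment_even[OF \<sigma>(1), of 0 0] by (simp add: d_def)
  have d1: "has_bochner_integral lborel (\<lambda>x. d x * x) 0"
    using normal_moment_odd[OF \<sigma>(1), of 0 0] by (simp add: d_def)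
  have d2: "has_bochner_integral lborel (\<lambda>x. d x * (x * x)) (t - s)"
    using normal_moment_even[OF \<sigma>(1), of 0 1] \<sigma>(2)
    by (simp add: d_def power2_eq_square fact_numeral)
  define g1 where "g1 l x = (if l = i then d x * x else d x)" for l :: 'k and x
  have i1: "integrable lborel (g1 l)" for l
  proof -
    have "g1 l = (if l = i then (\<lambda>x. d x * x) else d)" by (auto simp: g1_def)
    then show ?thesis using d0 d1 by (auto simp: has_bochner_integral_iff)
  qed
  have e1: "(\<Prod>l\<in>UNIV. d (x $ l)) * x $ i = (\<Prod>l\<in>UNIV. g1 l (x $ l))" for x :: "real^'k"
    by (subst (1 2) prod.remove[of _ i]) (auto simp: g1_def intro!: prod.cong)
  have m1: "(\<lambda>x::real^'k. x $ i) \<in> borel_measurable borel" by measurable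
  show "integrable M (\<lambda>\<omega>. (W t \<omega> - W s \<omega>) $ i)"
    unfolding increment_integral(2)[OF st m1] \<sigma>_def[symmetric] d_def[symmetric] e1
    by (rule lborel_prod_component(1)[OF i1])
  have "(LINT \<omega>|M. (W t \<omega> - W s \<omega>) $ i) = (\<Prod>l\<in>UNIV. LINT x|lborel. g1 l x)"
    unfolding increment_integral(1)[OF st m1] \<sigma>_def[symmetric] d_def[symmetric] e1
    by (rule lborel_prod_component(2)[OF i1])
  also have "\<dots> = 0"
    using d1 by (intro prod_zero bexI[of _ i]) (auto simp: g1_def has_bochner_integral_iff)
  finally show "(LINT \<omega>|M. (W t \<omega> - W s \<omega>) $ i) = 0" .
  define g2 where "g2 l x = d x * (if l = i then x else 1) * (if l = j then x else 1)" for l :: 'k and x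
  have g2: "g2 l = (if l = i then if l = j then (\<lambda>x. d x * (x * x)) else (\<lambda>x. d x * x)
      else if l = j then (\<lambda>x. d x * x) else d)" for l
    by (auto simp: g2_def)
  have i2: "integrable lborel (g2 l)" for l
    using d0 d1 d2 by (auto simp: g2 has_bochner_integral_iff)
  have e2: "(\<Prod>l\<in>UNIV. d (x $ l)) * (x $ i * x $ j) = (\<Prod>l\<in>UNIV. g2 l (x $ l))" for x :: "real^'k"
    by (simp add: g2_def prod.distrib prod.delta)
  have m2: "(\<lambda>x::real^'k. x $ i * x $ j) \<in> borel_measurable borel" by measurable
  show "integrable M (\<lambda>\<omega>. (W t \<omega> - W s \<omega>) $ i * (W t \<omega> - W s \<omega>) $ j)"
    unfolding increment_integral(2)[OF st m2] \<sigma>_def[symmetric] d_def[symmetric] e2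
    by (rule lborel_prod_component(1)[OF i2])
  have "(LINT \<omega>|M. (W t \<omega> - W s \<omega>) $ i * (W t \<omega> - W s \<omega>) $ j) = (\<Prod>l\<in>UNIV. LINT x|lborel. g2 l x)"
    unfolding increment_integral(1)[OF st m2] \<sigma>_def[symmetric] d_def[symmetric] e2
    by (rule lborel_prod_component(2)[OF i2])
  also have "\<dots> = (if i = j then t - s else 0)"
  proof (cases "i = j")
    case True
    then have "(LINT x|lborel. g2 l x) = (if l = i then t - s else 1)" for l
      using d0 d2 by (auto simp: g2 has_bochner_integral_iff)
    then show ?thesis using True by (simp add: prod.delta)
  next
    case False
    then show ?thesis
      using d1 by (auto simp: g2 has_bochner_integral_iff intro!: prod_zero bexI[of _ i])
  qed
  finally show "(LINT \<omega>|M. (W t \<omega> - W s \<omega>) $ i * (W t \<omega> - W s \<omega>) $ j) = (if i = j then t - s else 0)" .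
qed

lemma integral_times_increment:
  assumes st: "0 \<le> s" "s < t" "t \<le> T"
    and X: "X \<in> borel_measurable (F s)" "integrable M X"
    and g: "g \<in> borel_measurable borel" "integrable M (\<lambda>\<omega>. g (W t \<omega> - W s \<omega>))"
  shows "integrable M (\<lambda>\<omega>. X \<omega> * g (W t \<omega> - W s \<omega>) :: real)"
    and "(LINT \<omega>|M. X \<omega> * g (W t \<omega> - W s \<omega>)) = (LINT \<omega>|M. X \<omega>) * (LINT \<omega>|M. g (W t \<omega> - W s \<omega>))"
  using indep_var_integrable[OF indep_var_increment[OF st X(1) g(1)] X(2) g(2)]
    indep_var_lebesgue_integral[OF indep_var_increment[OF st X(1) g(1)] X(2) g(2)] by auto

lemma integrable_norm_increment_sq:
  assumes st: "0 \<le> s" "s < t" "t \<le> T"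
  shows "integrable M (\<lambda>\<omega>. (norm (W t \<omega> - W s \<omega>))\<^sup>2)"
proof -
  have "(norm (W t \<omega> - W s \<omega>))\<^sup>2 = (\<Sum>i\<in>UNIV. (W t \<omega> - W s \<omega>) $ i * (W t \<omega> - W s \<omega>) $ i)" for \<omega>
    by (simp add: power2_norm_eq_inner inner_vec_def)
  then show ?thesis
    using increment_moments(3)[OF st] by simp
qed

end

section \<open>Processes as functions on the product with time\<close>

abbreviation with_time :: "'a measure \<Rightarrow> ('a \<times> real) measure" where
  "with_time M \<equiv> M \<Otimes>\<^sub>M lborel"

text \<open>The identity is measurable in both directions between the two spaces, which have the
  same underlying set.\<close>

lemma sets_restrict_pair_measure:
  assumes "A \<in> sets N"
  shows "sets (M \<Otimes>\<^sub>M restrict_space N A) = sets (restrict_space (M \<Otimes>\<^sub>M N) (space M \<times> A))" (is "sets ?L = sets ?R")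
proof -
  have sp: "space ?L = space M \<times> A" "space ?R = space M \<times> A"
    using sets.sets_into_space[OF assms] by (simp_all add: space_pair_measure space_restrict_space) blast+
  have 1: "(\<lambda>x. x) \<in> ?R \<rightarrow>\<^sub>M ?L"
  proof (rule measurable_pair)
    show "fst \<circ> (\<lambda>x. x) \<in> ?R \<rightarrow>\<^sub>M M"
      by (auto simp: comp_def intro: measurable_restrict_space1)
    show "snd \<circ> (\<lambda>x. x) \<in> ?R \<rightarrow>\<^sub>M restrict_space N A"
    proof (rule measurable_restrict_space2)
      show "snd \<circ> (\<lambda>x. x) \<in> space ?R \<rightarrow> A" unfolding sp by auto
      show "snd \<circ> (\<lambda>x. x) \<in> ?R \<rightarrow>\<^sub>M N"
        by (auto simp: comp_def intro: measurable_restrict_space1)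
    qed
  qed
  have 2: "(\<lambda>x. x) \<in> ?L \<rightarrow>\<^sub>M ?R"
  proof (rule measurable_restrict_space2)
    show "(\<lambda>x. x) \<in> space ?L \<rightarrow> space M \<times> A" by (simp add: sp)
    have "snd \<in> ?L \<rightarrow>\<^sub>M N"
      by (rule measurable_compose[OF measurable_snd]) (simp add: measurable_restrict_space1)
    then show "(\<lambda>x. x) \<in> ?L \<rightarrow>\<^sub>M M \<Otimes>\<^sub>M N"
      by (intro measurable_pair) (auto simp: comp_def)
  qed
  show ?thesis
  proof (intro equalityI subsetI)
    fix X assume "X \<in> sets ?L"
    then show "X \<in> sets ?R"
      using measurable_sets[OF 1, of X] sets.sets_into_space[of X ?L] sp by (simp add: Int_absorb2)
  next
    fix X assume "X \<in> sets ?R"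
    then show "X \<in> sets ?L"
      using measurable_sets[OF 2, of X] sets.sets_into_space[of X ?R] sp by (simp add: Int_absorb2)
  qed
qed

lemma time_product_eq:
  assumes "sigma_finite_measure M"
  shows "time_product M t = restrict_space (with_time M) (space M \<times> {0..t})"
  unfolding time_product_def
proof (rule pair_measure_eqI)
  interpret M: sigma_finite_measure M by fact
  show "sigma_finite_measure (restrict_space lborel {0..t})"
    by (intro finite_measure.axioms(1) finite_measureI) (simp add: space_restrict_space emeasure_restrict_space emeasure_lborel_Icc_eq)
  fix A and B :: "real set" assume A: "A \<in> sets M" and "B \<in> sets (restrict_space lborel {0..t})"
  then have B: "B \<in> sets lborel" "B \<subseteq> {0..t}"
    by (auto simp: sets_restrict_space_iff)
  have "emeasure (restrict_space (with_time M) (space M \<times> {0..t})) (A \<times> B) = emeasure (with_time M) (A \<times> B)"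
    using A B sets.sets_into_space[OF A] by (intro emeasure_restrict_space) auto
  also have "\<dots> = emeasure M A * emeasure lborel B"
    using A B by (intro lborel.emeasure_pair_measure_Times) auto
  finally show "emeasure M A * emeasure (restrict_space lborel {0..t}) B =
      emeasure (restrict_space (with_time M) (space M \<times> {0..t})) (A \<times> B)"
    using B by (simp add: emeasure_restrict_space)
qed (use assms in \<open>auto simp: sets_restrict_pair_measure\<close>)

text \<open>
  Functions on $\Omega\times[0,t]$ are represented by functions on $\Omega\times\mathbb{R}$ that vanish
  outside $[0,t]$, so that the measure does not change with $t$ and time shifts are defined.
\<close>

definition time_cut :: "real \<Rightarrow> real \<Rightarrow> ('a \<times> real \<Rightarrow> 'e::real_vector) \<Rightarrow> 'a \<times> real \<Rightarrow> 'e" where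
  "time_cut a b f = (\<lambda>x. indicator {a..b} (snd x) *\<^sub>R f x)"

context prob_space
begin

lemma sigma_finite_M: "sigma_finite_measure M"
  by unfold_locales

lemma time_cut_indicator: "x \<in> space (with_time M) \<Longrightarrow> indicator (space M \<times> {0..t::real}) x = (indicator {0..t} (snd x) :: 'c::zero_neq_one)"
  by (auto simp: space_pair_measure indicator_def split: prod.splits)

lemma sets_time_slab [simp]: "(space M \<times> {0..t::real}) \<inter> space (with_time M) \<in> sets (with_time M)"
proof -
  have "space M \<times> {0..t} \<in> sets (with_time M)" by (intro pair_measureI) auto
  then show ?thesis by (intro sets.Int sets.top)
qed

lemma borel_measurable_time_product:
  fixes f :: "'a \<times> real \<Rightarrow> 'e::real_normed_vector"
  shows "f \<in> borel_measurable (time_product M t) \<longleftrightarrow> time_cut 0 t f \<in> borel_measurable (with_time M)"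
  unfolding time_product_eq[OF sigma_finite_M] borel_measurable_restrict_space_iff[OF sets_time_slab] time_cut_def
  by (intro measurable_cong) (simp add: time_cut_indicator)

lemma integral_time_product:
  fixes f :: "'a \<times> real \<Rightarrow> 'e::{banach, second_countable_topology}"
  shows "integral\<^sup>L (time_product M t) f = integral\<^sup>L (with_time M) (time_cut 0 t f)"
  unfolding time_product_eq[OF sigma_finite_M] integral_restrict_space[OF sets_time_slab] time_cut_def
  by (intro Bochner_Integration.integral_cong) (simp_all add: time_cut_indicator)

lemma integrable_time_product:
  fixes f :: "'a \<times> real \<Rightarrow> 'e::{banach, second_countable_topology}"
  shows "integrable (time_product M t) f \<longleftrightarrow> integrable (with_time M) (time_cut 0 t f)"
  unfolding time_product_eq[OF sigma_finite_M] integrable_restrict_space[OF sets_time_slab] time_cut_def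
  by (intro Bochner_Integration.integrable_cong) (simp_all add: time_cut_indicator)

lemma time_cut_powr: "p > 0 \<Longrightarrow> time_cut a b (\<lambda>x. norm (f x) powr p) = (\<lambda>x. norm (time_cut a b f x) powr p)"
  by (auto simp: time_cut_def indicator_def fun_eq_iff)

lemma Lp_space_time_product:
  "p > 0 \<Longrightarrow> f \<in> Lp_space (time_product M t) p \<longleftrightarrow> time_cut 0 t f \<in> Lp_space (with_time M) p"
  by (simp add: Lp_space_def borel_measurable_time_product integrable_time_product time_cut_powr)

lemma Lp_norm_time_product:
  "p > 0 \<Longrightarrow> Lp_norm (time_product M t) p f = Lp_norm (with_time M) p (time_cut 0 t f)"
  by (simp add: Lp_norm_def integral_time_product time_cut_powr)

lemma time_cut_add: "time_cut a b (\<lambda>x. f x + g x) = (\<lambda>x. time_cut a b f x + time_cut a b g x)"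
  and time_cut_scaleR: "time_cut a b (\<lambda>x. c *\<^sub>R f x) = (\<lambda>x. c *\<^sub>R time_cut a b f x)"
  and time_cut_diff: "time_cut a b (\<lambda>x. f x - g x) = (\<lambda>x. time_cut a b f x - time_cut a b g x)"
  by (auto simp: time_cut_def algebra_simps)

lemma finite_measure_time_product: "finite_measure (time_product M t)"
proof -
  interpret R: finite_measure "restrict_space lborel {0..t}"
    by (intro finite_measureI) (simp add: space_restrict_space emeasure_restrict_space emeasure_lborel_Icc_eq)
  show ?thesis
    unfolding time_product_def by (rule finite_measure_pair_measure) unfold_locales
qed

text \<open>Extension by zero is linear and preserves the seminorm, so a functional on the large
  space pulls back with the same constant.\<close>

lemma Lp_converges_weakly_time_product:
  assumes conv: "Lp_converges_weakly (time_product M t) p f g" and p: "p > 0"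
  shows "Lp_converges_weakly (with_time M) p (\<lambda>n. time_cut 0 t (f n)) (time_cut 0 t g)"
proof -
  have "(\<lambda>n. \<phi> (time_cut 0 t (f n))) \<longlonglongrightarrow> \<phi> (time_cut 0 t g)" if \<phi>: "\<phi> \<in> Lp_dual (with_time M) p" for \<phi>
  proof -
    have "(\<lambda>u. \<phi> (time_cut 0 t u)) \<in> Lp_dual (time_product M t) p"
    proof -
      obtain C where C: "\<And>f. f \<in> Lp_space (with_time M) p \<Longrightarrow> \<bar>\<phi> f\<bar> \<le> C * Lp_norm (with_time M) p f"
        using Lp_dual_bound[OF \<phi>] by metis
      show ?thesis
        unfolding Lp_dual_def mem_Collect_eq using p
        by (intro conjI exI[of _ C])
          (auto simp: Lp_space_time_product Lp_norm_time_product time_cut_add time_cut_scaleR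
            intro!: Lp_dual_add[OF \<phi>] Lp_dual_scaleR[OF \<phi>] C)
    qed
    moreover have "\<psi> \<in> Lp_dual (time_product M t) p \<Longrightarrow> (\<lambda>n. \<psi> (f n)) \<longlonglongrightarrow> \<psi> g" for \<psi>
      using conv by (simp add: Lp_converges_weakly_def)
    ultimately show ?thesis by blast
  qed
  then show ?thesis
    using conv p by (simp add: Lp_converges_weakly_def Lp_space_time_product)
qed

lemma integrable_pair_mult:
  fixes g :: "'a \<Rightarrow> real" and h :: "real \<Rightarrow> real"
  assumes "integrable M g" "integrable lborel h"
  shows "integrable (with_time M) (\<lambda>x. g (fst x) * h (snd x))"
    and "(LINT x|with_time M. g (fst x) * h (snd x)) = (LINT \<omega>|M. g \<omega>) * (LINT s|lborel. h s)"
proof -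
  interpret P: pair_sigma_finite M lborel ..
  have [measurable]: "g \<in> borel_measurable M" "h \<in> borel_measurable borel"
    using assms by (auto simp: integrable_iff_bounded)
  show int: "integrable (with_time M) (\<lambda>x. g (fst x) * h (snd x))"
    using assms
    by (intro P.Fubini_integrable)
      (auto simp: abs_mult integrable_mult_right_iff)
  have "(LINT x|with_time M. g (fst x) * h (snd x)) = (LINT \<omega>|M. (LINT s|lborel. g \<omega> * h s))"
    using P.integral_fst'[OF int] by simp
  then show "(LINT x|with_time M. g (fst x) * h (snd x)) = (LINT \<omega>|M. g \<omega>) * (LINT s|lborel. h s)"
    by simp
qed

end

section \<open>Step processes and the Ito isometry\<close>

text \<open>The norm of a matrix here is the Euclidean norm of all its entries, so Cauchy-Schwarz in
  each row, squared and summed, suffices.\<close>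

lemma norm_matrix_vector_mult_le:
  fixes A :: "real^'k^'m"
  shows "norm (A *v x) \<le> norm A * norm x"
proof (rule power2_le_imp_le)
  have "(norm (A *v x))\<^sup>2 = (\<Sum>i\<in>UNIV. (A $ i \<bullet> x)\<^sup>2)"
    unfolding power2_norm_eq_inner inner_vec_def[of "A *v x"] matrix_vector_mul_component
    by (simp add: power2_eq_square)
  also have "\<dots> \<le> (\<Sum>i\<in>UNIV. (norm (A $ i))\<^sup>2 * (norm x)\<^sup>2)"
    by (intro sum_mono) (metis Cauchy_Schwarz_ineq power2_norm_eq_inner)
  also have "\<dots> = (norm A * norm x)\<^sup>2"
    by (simp add: power_mult_distrib sum_distrib_right[symmetric] power2_norm_eq_inner inner_vec_def[of A])
  finally show "(norm (A *v x))\<^sup>2 \<le> (norm A * norm x)\<^sup>2" .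
qed simp

lemma borel_measurable_component [measurable (raw)]:
  fixes f :: "'a \<Rightarrow> 'e::real_normed_vector ^ 'k"
  assumes "f \<in> borel_measurable M"
  shows "(\<lambda>x. f x $ i) \<in> borel_measurable M"
  using assms by (rule measurable_compose)
    (intro borel_measurable_continuous_onI continuous_intros)

lemma borel_measurable_matrix_vector_mult [measurable (raw)]:
  fixes A :: "'a \<Rightarrow> real^'k^'m"
  assumes "A \<in> borel_measurable M" "f \<in> borel_measurable M"
  shows "(\<lambda>x. A x *v f x) \<in> borel_measurable M"
proof (rule borel_measurable_continuous_Pair[OF assms])
  show "continuous_on UNIV (\<lambda>x :: (real^'k^'m) \<times> (real^'k). fst x *v snd x)"
    unfolding matrix_vector_mult_def by (intro continuous_intros)
qed

context wiener_process
begin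

text \<open>After a pointwise bound by the product of norms, independence factorizes the integral of
  the squares, so square integrability of each factor is enough. The function h is the identity for
  step integrals and \<open>x - truncate K x\<close> for the truncation error.\<close>

lemma step_block_L2:
  fixes \<xi> :: "'a \<Rightarrow> real^'k^'m" and h :: "real^'k \<Rightarrow> real^'k"
  assumes st: "0 \<le> s" "s < t" "t \<le> T"
    and \<xi>: "\<xi> \<in> borel_measurable (F s)" "\<xi> \<in> Lp_space M 2"
    and h: "h \<in> borel_measurable borel" "integrable M (\<lambda>\<omega>. (norm (h (W t \<omega> - W s \<omega>)))\<^sup>2)"
  shows "(\<lambda>\<omega>. \<xi> \<omega> *v h (W t \<omega> - W s \<omega>)) \<in> Lp_space M 2"
    and "(LINT \<omega>|M. (norm (\<xi> \<omega> *v h (W t \<omega> - W s \<omega>)))\<^sup>2) \<le>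
      (LINT \<omega>|M. (norm (\<xi> \<omega>))\<^sup>2) * (LINT \<omega>|M. (norm (h (W t \<omega> - W s \<omega>)))\<^sup>2)"
proof -
  have s: "s \<in> {0..T}" "t \<in> {0..T}" using st by auto
  have [measurable]: "\<xi> \<in> borel_measurable M" "h \<in> borel_measurable borel"
    "W s \<in> borel_measurable M" "W t \<in> borel_measurable M"
    using \<xi> h measurable_W s by (auto simp: Lp_space_def)
  have sq: "(\<lambda>\<omega>. (norm (\<xi> \<omega>))\<^sup>2) \<in> borel_measurable (F s)" using \<xi>(1) by measurable
  have g: "(\<lambda>x. (norm (h x))\<^sup>2) \<in> borel_measurable borel" by measurable
  have int\<xi>: "integrable M (\<lambda>\<omega>. (norm (\<xi> \<omega>))\<^sup>2)" using \<xi>(2) by (simp add: Lp_space_2_iff)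
  note prod = integral_times_increment[OF st sq int\<xi> g h(2)]
  have le: "(norm (\<xi> \<omega> *v h (W t \<omega> - W s \<omega>)))\<^sup>2 \<le> (norm (\<xi> \<omega>))\<^sup>2 * (norm (h (W t \<omega> - W s \<omega>)))\<^sup>2" for \<omega>
    unfolding power_mult_distrib[symmetric] by (intro power_mono norm_matrix_vector_mult_le) simp
  have int: "integrable M (\<lambda>\<omega>. (norm (\<xi> \<omega> *v h (W t \<omega> - W s \<omega>)))\<^sup>2)"
    by (rule Bochner_Integration.integrable_bound[OF prod(1)]) (use le in auto)
  then show "(\<lambda>\<omega>. \<xi> \<omega> *v h (W t \<omega> - W s \<omega>)) \<in> Lp_space M 2"
    unfolding Lp_space_2_iff by simp
  show "(LINT \<omega>|M. (norm (\<xi> \<omega> *v h (W t \<omega> - W s \<omega>)))\<^sup>2) \<le>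
      (LINT \<omega>|M. (norm (\<xi> \<omega>))\<^sup>2) * (LINT \<omega>|M. (norm (h (W t \<omega> - W s \<omega>)))\<^sup>2)"
    unfolding prod(2)[symmetric] by (intro integral_mono int prod(1) le)
qed

definition block :: "('a \<Rightarrow> real^'k^'m) \<Rightarrow> real \<Rightarrow> real \<Rightarrow> 'a \<Rightarrow> real^'m" where
  "block \<xi> a b \<omega> = \<xi> \<omega> *v (W b \<omega> - W a \<omega>)"

lemma block_same [simp]: "block \<xi> a a = (\<lambda>\<omega>. 0)"
  by (simp add: block_def fun_eq_iff)

lemma block_split: "block \<xi> a c \<omega> = block \<xi> a b \<omega> + block \<xi> b c \<omega>"
  by (simp add: block_def algebra_simps flip: matrix_vector_right_distrib)

text \<open>Coefficients of elementary processes are bounded, but time averages of the integrands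
  are only square integrable. The isometry is therefore developed for this larger class and linked
  to elementary processes by \<open>elementary_approximates_L2_step\<close>.\<close>

definition L2_at :: "real \<Rightarrow> ('a \<Rightarrow> real^'k^'m) set" where
  "L2_at s = {\<xi>. \<xi> \<in> borel_measurable (F s) \<and> \<xi> \<in> Lp_space M 2}"

lemma L2_at_mono: "0 \<le> s \<Longrightarrow> s \<le> t \<Longrightarrow> t \<le> T \<Longrightarrow> \<xi> \<in> L2_at s \<Longrightarrow> \<xi> \<in> L2_at t"
  unfolding L2_at_def using measurable_F_mono by blast

lemma block_L2:
  assumes "0 \<le> a" "a \<le> b" "b \<le> T" "\<xi> \<in> L2_at a"
  shows "block \<xi> a b \<in> Lp_space M 2"
proof (cases "a = b")
  case False
  with assms step_block_L2(1)[of a b \<xi> "\<lambda>x. x"] integrable_norm_increment_sq[of a b]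
  show ?thesis by (simp add: block_def[abs_def] L2_at_def)
qed (simp add: Lp_space_zero)

lemma measurable_block:
  assumes "0 \<le> a" "a \<le> b" "b \<le> c" "c \<le> T" "\<xi> \<in> borel_measurable (F a)"
  shows "block \<xi> a b \<in> borel_measurable (F c)"
proof -
  have [measurable]: "\<xi> \<in> borel_measurable (F c)" "W a \<in> borel_measurable (F c)" "W b \<in> borel_measurable (F c)"
    using assms adapted[of a] adapted[of b]
    by (auto intro: measurable_F_mono[of a c] measurable_F_mono[of b c])
  show ?thesis unfolding block_def by measurable
qed

lemma integral_inner_increment:
  assumes st: "0 \<le> s" "s < t" "t \<le> T" and G: "G \<in> borel_measurable (F s)" "integrable M G"
  shows "(LINT \<omega>|M. G \<omega> \<bullet> (W t \<omega> - W s \<omega>)) = 0"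
proof -
  have i: "integrable M (\<lambda>\<omega>. G \<omega> $ i * (W t \<omega> - W s \<omega>) $ i)"
    and e: "(LINT \<omega>|M. G \<omega> $ i * (W t \<omega> - W s \<omega>) $ i) = 0" for i
  proof -
    have "(\<lambda>\<omega>. G \<omega> $ i) \<in> borel_measurable (F s)" "integrable M (\<lambda>\<omega>. G \<omega> $ i)"
      using G by (auto intro!: integrable_bounded_linear[OF bounded_linear_vec_nth])
    from integral_times_increment[OF st this _ increment_moments(1)[OF st], of i] increment_moments(2)[OF st, of i]
    show "integrable M (\<lambda>\<omega>. G \<omega> $ i * (W t \<omega> - W s \<omega>) $ i)"
      "(LINT \<omega>|M. G \<omega> $ i * (W t \<omega> - W s \<omega>) $ i) = 0" by auto
  qed
  have "G \<omega> \<bullet> (W t \<omega> - W s \<omega>) = (\<Sum>i\<in>UNIV. G \<omega> $ i * (W t \<omega> - W s \<omega>) $ i)" for \<omega>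
    by (simp add: inner_vec_def)
  then show ?thesis using i e by simp
qed

text \<open>The first block is known at time c. Moving the matrix \<eta> to its side by
  transposition leaves the inner product of an \<open>F c\<close>-measurable vector with a later
  increment, which is independent of it and has mean zero.\<close>

lemma block_disjoint:
  fixes \<xi> \<eta> :: "'a \<Rightarrow> real^'k^'m"
  assumes abcd: "0 \<le> a" "a \<le> b" "b \<le> c" "c \<le> d" "d \<le> T" and \<xi>: "\<xi> \<in> L2_at a" and \<eta>: "\<eta> \<in> L2_at c"
  shows "(LINT \<omega>|M. block \<xi> a b \<omega> \<bullet> block \<eta> c d \<omega>) = 0"
proof (cases "c = d")
  case False
  define G where "G \<omega> = transpose (\<eta> \<omega>) *v block \<xi> a b \<omega>" for \<omega>
  have eq: "block \<xi> a b \<omega> \<bullet> block \<eta> c d \<omega> = G \<omega> \<bullet> (W d \<omega> - W c \<omega>)" for \<omega>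
    unfolding G_def by (subst block_def[of \<eta>]) (simp only: dot_lmul_matrix transpose_matrix_vector)
  have nt: "norm (transpose A) = norm A" for A :: "real^'k^'m"
  proof -
    have "(norm (transpose A))\<^sup>2 = (norm A)\<^sup>2"
      unfolding power2_norm_eq_inner inner_vec_def transpose_def by (simp, rule sum.swap)
    then show ?thesis by simp
  qed
  have bl: "block \<xi> a b \<in> borel_measurable (F c)"
    using abcd \<xi> by (intro measurable_block) (auto simp: L2_at_def)
  have "transpose \<in> borel_measurable (borel :: (real^'k^'m) measure)"
    unfolding transpose_def by (intro borel_measurable_continuous_onI continuous_intros)
  then have tr: "(\<lambda>\<omega>. transpose (\<eta> \<omega>)) \<in> borel_measurable (F c)"
    using \<eta> by (auto simp: L2_at_def intro: measurable_compose)
  have G: "G \<in> borel_measurable (F c)"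
    unfolding G_def using bl tr by measurable
  have bL2: "block \<xi> a b \<in> Lp_space M 2" using abcd by (intro block_L2 \<xi>) auto
  have "integrable M G"
  proof (rule Bochner_Integration.integrable_bound)
    show "integrable M (\<lambda>\<omega>. (norm (\<eta> \<omega>))\<^sup>2 + (norm (block \<xi> a b \<omega>))\<^sup>2)"
      using \<eta> bL2 by (auto simp: L2_at_def Lp_space_2_iff)
    show "G \<in> borel_measurable M"
      using G abcd measurable_F[of c] by auto
    have "norm (G \<omega>) \<le> (norm (\<eta> \<omega>))\<^sup>2 + (norm (block \<xi> a b \<omega>))\<^sup>2" for \<omega>
    proof -
      have "norm (G \<omega>) \<le> norm (\<eta> \<omega>) * norm (block \<xi> a b \<omega>)"
        unfolding G_def using norm_matrix_vector_mult_le[of "transpose (\<eta> \<omega>)"] by (simp add: nt)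
      moreover have "0 \<le> norm (\<eta> \<omega>) * norm (block \<xi> a b \<omega>)" by simp
      ultimately show ?thesis
        using sum_squares_bound[of "norm (\<eta> \<omega>)" "norm (block \<xi> a b \<omega>)"] by linarith
    qed
    then show "AE \<omega> in M. norm (G \<omega>) \<le> norm ((norm (\<eta> \<omega>))\<^sup>2 + (norm (block \<xi> a b \<omega>))\<^sup>2)"
      by (auto simp: add_nonneg_nonneg)
  qed
  then show ?thesis
    unfolding eq using False abcd G by (intro integral_inner_increment) auto
qed simp

text \<open>In coordinates, independence splits off the second moments of the increment, and their
  diagonal covariance collapses the double sum over columns to a single one.\<close>

lemma block_same_interval:
  fixes \<xi> \<eta> :: "'a \<Rightarrow> real^'k^'m"
  assumes st: "0 \<le> s" "s \<le> t" "t \<le> T" and \<xi>: "\<xi> \<in> L2_at s" and \<eta>: "\<eta> \<in> L2_at s"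
  shows "(LINT \<omega>|M. block \<xi> s t \<omega> \<bullet> block \<eta> s t \<omega>) = (t - s) * (LINT \<omega>|M. \<xi> \<omega> \<bullet> \<eta> \<omega>)"
proof (cases "s = t")
  case False
  then have st': "0 \<le> s" "s < t" "t \<le> T" using st by auto
  have L2c: "(\<lambda>\<omega>. \<zeta> \<omega> $ i $ j) \<in> Lp_space M 2" if "\<zeta> \<in> L2_at s" for \<zeta> :: "'a \<Rightarrow> real^'k^'m" and i j
    using that Lp_space_bounded_linear[OF bounded_linear_compose[OF bounded_linear_vec_nth bounded_linear_vec_nth], of \<zeta> M 2]
    by (simp add: L2_at_def)
  have int: "integrable M (\<lambda>\<omega>. \<xi> \<omega> $ i $ j * \<eta> \<omega> $ i $ l)" for i j l
    using integrable_inner_L2[OF L2c[OF \<xi>] L2c[OF \<eta>]] by simp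
  have meas: "(\<lambda>\<omega>. \<xi> \<omega> $ i $ j * \<eta> \<omega> $ i $ l) \<in> borel_measurable (F s)" for i j l
    using \<xi> \<eta> by (auto simp: L2_at_def)
  have m2: "(\<lambda>x::real^'k. x $ j * x $ l) \<in> borel_measurable borel" for j l by measurable
  note prod = integral_times_increment[OF st' meas int m2 increment_moments(3)[OF st']]
  have eq: "block \<xi> s t \<omega> \<bullet> block \<eta> s t \<omega> = (\<Sum>i\<in>UNIV. \<Sum>j\<in>UNIV. \<Sum>l\<in>UNIV.
      (\<xi> \<omega> $ i $ j * \<eta> \<omega> $ i $ l) * ((W t \<omega> - W s \<omega>) $ j * (W t \<omega> - W s \<omega>) $ l))" for \<omega>
    by (simp add: block_def inner_vec_def matrix_vector_mult_def sum_product mult_ac)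
      (rule sum.cong[OF refl], subst sum.swap, intro sum.cong refl, simp add: mult_ac)
  have "(LINT \<omega>|M. block \<xi> s t \<omega> \<bullet> block \<eta> s t \<omega>) = (\<Sum>i\<in>UNIV. \<Sum>j\<in>UNIV. \<Sum>l\<in>UNIV.
      (LINT \<omega>|M. \<xi> \<omega> $ i $ j * \<eta> \<omega> $ i $ l) * (if j = l then t - s else 0))"
    unfolding eq using prod increment_moments(4)[OF st'] by simp
  also have "\<dots> = (t - s) * (\<Sum>i\<in>UNIV. \<Sum>j\<in>UNIV. (LINT \<omega>|M. \<xi> \<omega> $ i $ j * \<eta> \<omega> $ i $ j))"
  proof -
    have "(\<Sum>l\<in>UNIV. e l * (if j = l then t - s else 0)) = (t - s) * e j" for e :: "'k \<Rightarrow> real" and j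
      using sum.delta[of UNIV j "\<lambda>l. (t - s) * e l"]
      by (simp add: if_distrib[of "\<lambda>x. _ * x"] mult.commute cong: if_cong)
    then show ?thesis by (simp add: sum_distrib_left)
  qed
  also have "(\<Sum>i\<in>UNIV. \<Sum>j\<in>UNIV. (LINT \<omega>|M. \<xi> \<omega> $ i $ j * \<eta> \<omega> $ i $ j)) = (LINT \<omega>|M. \<xi> \<omega> \<bullet> \<eta> \<omega>)"
    using int by (simp add: inner_vec_def)
  finally show ?thesis .
qed simp

text \<open>Cutting the intervals at c and at the smaller right endpoint leaves one common interval;
  all other pairs of pieces are disjoint, hence orthogonal. Treating arbitrary overlaps here allows
  step processes on different grids to be compared without a common refinement.\<close>

lemma block_inner_le:
  fixes \<xi> \<eta> :: "'a \<Rightarrow> real^'k^'m"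
  assumes "0 \<le> a" "a \<le> b" "b \<le> T" "c \<le> d" "d \<le> T" "a \<le> c" and \<xi>: "\<xi> \<in> L2_at a" and \<eta>: "\<eta> \<in> L2_at c"
  shows "(LINT \<omega>|M. block \<xi> a b \<omega> \<bullet> block \<eta> c d \<omega>) = max 0 (min b d - max a c) * (LINT \<omega>|M. \<xi> \<omega> \<bullet> \<eta> \<omega>)"
proof (cases "b \<le> c")
  case True
  then show ?thesis using block_disjoint[of a b c d \<xi> \<eta>] assms by auto
next
  case False
  have \<xi>c: "\<xi> \<in> L2_at c" using L2_at_mono[OF _ _ _ \<xi>, of c] assms by auto
  have L: "block \<xi> x y \<in> Lp_space M 2" "block \<eta> x y \<in> Lp_space M 2" if "c \<le> x" "x \<le> y" "y \<le> T" for x y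
    using assms that L2_at_mono[OF _ _ _ \<xi>, of x] L2_at_mono[OF _ _ _ \<eta>, of x] by (auto intro!: block_L2)
  have L0: "block \<xi> a c \<in> Lp_space M 2" using assms by (intro block_L2) auto
  have "(LINT \<omega>|M. block \<xi> a b \<omega> \<bullet> block \<eta> c d \<omega>) =
      (LINT \<omega>|M. block \<xi> a c \<omega> \<bullet> block \<eta> c d \<omega>) + (LINT \<omega>|M. block \<xi> c b \<omega> \<bullet> block \<eta> c d \<omega>)"
    unfolding block_split[of \<xi> a b _ c] inner_add_left
    using False assms by (intro Bochner_Integration.integral_add integrable_inner_L2 L L0) auto
  also have "(LINT \<omega>|M. block \<xi> a c \<omega> \<bullet> block \<eta> c d \<omega>) = 0"
    using assms by (intro block_disjoint) auto
  also have "(LINT \<omega>|M. block \<xi> c b \<omega> \<bullet> block \<eta> c d \<omega>) = (min b d - c) * (LINT \<omega>|M. \<xi> \<omega> \<bullet> \<eta> \<omega>)"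
  proof (cases "b \<le> d")
    case True
    have "(LINT \<omega>|M. block \<xi> c b \<omega> \<bullet> block \<eta> c d \<omega>) =
        (LINT \<omega>|M. block \<xi> c b \<omega> \<bullet> block \<eta> c b \<omega>) + (LINT \<omega>|M. block \<xi> c b \<omega> \<bullet> block \<eta> b d \<omega>)"
      unfolding block_split[of \<eta> c d _ b] inner_add_right
      using False True assms by (intro Bochner_Integration.integral_add integrable_inner_L2 L) auto
    also have "(LINT \<omega>|M. block \<xi> c b \<omega> \<bullet> block \<eta> b d \<omega>) = 0"
      using assms False True \<xi>c L2_at_mono[OF _ _ _ \<eta>, of b] by (intro block_disjoint) auto
    also have "(LINT \<omega>|M. block \<xi> c b \<omega> \<bullet> block \<eta> c b \<omega>) = (b - c) * (LINT \<omega>|M. \<xi> \<omega> \<bullet> \<eta> \<omega>)"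
      using assms False \<xi>c by (intro block_same_interval) auto
    finally show ?thesis using True by simp
  next
    case F2: False
    have "(LINT \<omega>|M. block \<xi> c b \<omega> \<bullet> block \<eta> c d \<omega>) =
        (LINT \<omega>|M. block \<xi> c d \<omega> \<bullet> block \<eta> c d \<omega>) + (LINT \<omega>|M. block \<xi> d b \<omega> \<bullet> block \<eta> c d \<omega>)"
      unfolding block_split[of \<xi> c b _ d] inner_add_left
      using False F2 assms by (intro Bochner_Integration.integral_add integrable_inner_L2 L) auto
    also have "(LINT \<omega>|M. block \<xi> d b \<omega> \<bullet> block \<eta> c d \<omega>) = 0"
      using assms False F2 L2_at_mono[OF _ _ _ \<xi>, of d]
      by (subst inner_commute, intro block_disjoint) auto
    also have "(LINT \<omega>|M. block \<xi> c d \<omega> \<bullet> block \<eta> c d \<omega>) = (d - c) * (LINT \<omega>|M. \<xi> \<omega> \<bullet> \<eta> \<omega>)"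
      using assms False \<xi>c by (intro block_same_interval) auto
    finally show ?thesis using F2 by simp
  qed
  finally show ?thesis using False assms by (simp add: max_def min_def)
qed

lemma block_inner:
  fixes \<xi> \<eta> :: "'a \<Rightarrow> real^'k^'m"
  assumes "0 \<le> a" "a \<le> b" "b \<le> T" "0 \<le> c" "c \<le> d" "d \<le> T" and \<xi>: "\<xi> \<in> L2_at a" and \<eta>: "\<eta> \<in> L2_at c"
  shows "(LINT \<omega>|M. block \<xi> a b \<omega> \<bullet> block \<eta> c d \<omega>) =
    measure lborel ({a<..b} \<inter> {c<..d}) * (LINT \<omega>|M. \<xi> \<omega> \<bullet> \<eta> \<omega>)"
proof -
  have "{a<..b} \<inter> {c<..d} = {max a c<..min b d}" by auto
  then have m: "measure lborel ({a<..b} \<inter> {c<..d}) = max 0 (min b d - max a c)"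
    using measure_lborel_Ioc[of "max a c" "min b d"]
    by (cases "max a c \<le> min b d") (simp_all only: max_absorb1 max_absorb2 diff_ge_0_iff_ge
      greaterThanAtMost_empty measure_empty linear not_le diff_le_0_iff_le less_imp_le if_False if_True)
  show ?thesis
  proof (cases "a \<le> c")
    case True
    then show ?thesis using block_inner_le[of a b c d \<xi> \<eta>] assms m by simp
  next
    case False
    then show ?thesis using block_inner_le[of c d a b \<eta> \<xi>] assms m
      by (simp add: inner_commute min.commute max.commute)
  qed
qed

end

text \<open>A fast subsequence converges almost everywhere, and Fatou's lemma upgrades this to
  convergence of the full sequence in the seminorm. The Ito integral is obtained as such a
  limit.\<close>

lemma (in prob_space) L2_complete:
  fixes f :: "nat \<Rightarrow> 'a \<Rightarrow> 'e::euclidean_space"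
  assumes L2: "\<And>n. f n \<in> Lp_space M 2"
    and Cauchy: "\<And>e. e > 0 \<Longrightarrow> \<exists>N. \<forall>m\<ge>N. \<forall>n\<ge>N. (LINT x|M. (norm (f m x - f n x))\<^sup>2) \<le> e"
  obtains g where "g \<in> Lp_space M 2" "(\<lambda>n. LINT x|M. (norm (f n x - g x))\<^sup>2) \<longlonglongrightarrow> 0"
proof -
  have [measurable]: "f n \<in> borel_measurable M" for n
    using L2[of n] by (simp add: Lp_space_def)
  have int: "integrable M (\<lambda>x. (norm (f m x - f n x))\<^sup>2)" for m n
    using Lp_space_diff[OF L2 L2, of m n] by (simp add: Lp_space_2_iff)
  obtain N where N: "\<And>e m n. e > 0 \<Longrightarrow> m \<ge> N e \<Longrightarrow> n \<ge> N e \<Longrightarrow> (LINT x|M. (norm (f m x - f n x))\<^sup>2) \<le> e"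
    using Cauchy by metis
  \<comment> \<open>Summing the thresholds up to k makes both \<open>r k\<close> and
    \<open>r (Suc k)\<close> at least the k-th threshold; the added k makes r unbounded.\<close>
  define r where "r k = (\<Sum>i\<le>k. N ((1 / 4) ^ i)) + k" for k :: nat
  have r: "N ((1 / 4) ^ k) \<le> r k" "N ((1 / 4) ^ k) \<le> r (Suc k)" "k \<le> r k" for k
    using member_le_sum[of k "{..k}" "\<lambda>i. N ((1 / 4) ^ i)"]
      member_le_sum[of k "{..Suc k}" "\<lambda>i. N ((1 / 4) ^ i)"] by (auto simp: r_def)
  define d where "d k x = f (r (Suc k)) x - f (r k) x" for k x
  have [measurable]: "d k \<in> borel_measurable M" for k unfolding d_def by measurable
  have d: "(LINT x|M. (norm (d k x))\<^sup>2) \<le> (1 / 4) ^ k" for k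
    unfolding d_def by (rule N) (use r in auto)
  have intd: "integrable M (\<lambda>x. (norm (d k x))\<^sup>2)" for k
    unfolding d_def by (rule int)
  have "(\<integral>\<^sup>+x. (\<Sum>k. ennreal (2 ^ k * (norm (d k x))\<^sup>2)) \<partial>M) = (\<Sum>k. \<integral>\<^sup>+x. ennreal (2 ^ k * (norm (d k x))\<^sup>2) \<partial>M)"
    by (rule nn_integral_suminf) measurable
  also have "\<dots> \<le> (\<Sum>k. ennreal ((1 / 2) ^ k))"
  proof (intro suminf_le)
    fix k
    have "(\<integral>\<^sup>+x. ennreal (2 ^ k * (norm (d k x))\<^sup>2) \<partial>M) = ennreal (LINT x|M. 2 ^ k * (norm (d k x))\<^sup>2)"
      using intd by (intro nn_integral_eq_integral) auto
    also have "\<dots> \<le> ennreal (2 ^ k * (1 / 4) ^ k)"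
      using d[of k] by (intro ennreal_leI) simp
    also have "2 ^ k * (1 / 4 :: real) ^ k = (1 / 2) ^ k"
      by (simp flip: power_mult_distrib)
    finally show "(\<integral>\<^sup>+x. ennreal (2 ^ k * (norm (d k x))\<^sup>2) \<partial>M) \<le> ennreal ((1 / 2) ^ k)" .
  qed auto
  also have "\<dots> < \<infinity>"
    by (subst suminf_ennreal2) (auto simp: summable_geometric)
  finally have "AE x in M. (\<Sum>k. ennreal (2 ^ k * (norm (d k x))\<^sup>2)) \<noteq> \<infinity>"
    by (intro nn_integral_PInf_AE) auto
  then have conv: "AE x in M. convergent (\<lambda>k. f (r k) x)"
  proof eventually_elim
    case (elim x)
    then have s: "summable (\<lambda>k. 2 ^ k * (norm (d k x))\<^sup>2)"
      by (intro summable_suminf_not_top) auto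
    have "summable (\<lambda>k. (1 / 2) ^ k + 2 ^ k * (norm (d k x))\<^sup>2)"
      by (intro summable_add s) (simp add: summable_geometric)
    then have "summable (\<lambda>k. d k x)"
    proof (rule summable_comparison_test[rotated], intro exI allI impI)
      fix k
      \<comment> \<open>For y = \<open>2 ^ k * norm (d k x)\<close> this gives y at most 1 plus the
        square of y. Divided by \<open>2 ^ k\<close>, it turns summability of the weighted squares
        into summability of the norms.\<close>
      have "0 \<le> (1 - 2 ^ k * norm (d k x))\<^sup>2" by simp
      then have "2 * (2 ^ k * norm (d k x)) \<le> 1 + (2 ^ k * norm (d k x))\<^sup>2"
        by (simp add: power2_diff)
      then have "2 ^ k * norm (d k x) \<le> 1 + (2 ^ k * norm (d k x))\<^sup>2" by (smt (verit) mult_nonneg_nonneg norm_ge_zero zero_le_power)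
      then have "(1 / 2) ^ k * (2 ^ k * norm (d k x)) \<le> (1 / 2) ^ k * (1 + (2 ^ k * norm (d k x))\<^sup>2)"
        by (intro mult_left_mono) auto
      then show "norm (d k x) \<le> (1 / 2) ^ k + 2 ^ k * (norm (d k x))\<^sup>2"
        by (simp add: field_simps power2_eq_square)
    qed
    then have "convergent (\<lambda>k. f (r 0) x + (\<Sum>j<k. d j x))"
      by (intro convergent_add convergent_const) (simp add: summable_iff_convergent)
    also have "(\<lambda>k. f (r 0) x + (\<Sum>j<k. d j x)) = (\<lambda>k. f (r k) x)"
      using sum_lessThan_telescope[of "\<lambda>k. f (r k) x"] by (simp add: d_def)
    finally show ?case .
  qed
  define g where "g x = lim (\<lambda>k. f (r k) x)" for x
  have [measurable]: "g \<in> borel_measurable M" unfolding g_def by measurable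
  have lim: "AE x in M. (\<lambda>k. f (r k) x) \<longlonglongrightarrow> g x"
    using conv by eventually_elim (simp add: g_def convergent_LIMSEQ_iff)
  \<comment> \<open>Fatou along the subsequence with n fixed, so the estimate holds for every large
    n and not only along r.\<close>
  have bound: "(\<integral>\<^sup>+x. ennreal ((norm (f n x - g x))\<^sup>2) \<partial>M) \<le> ennreal e" if e: "e > 0" and n: "n \<ge> N e" for e n
  proof -
    have "(\<integral>\<^sup>+x. ennreal ((norm (f n x - g x))\<^sup>2) \<partial>M)
        = (\<integral>\<^sup>+x. liminf (\<lambda>k. ennreal ((norm (f n x - f (r k) x))\<^sup>2)) \<partial>M)"
    proof (rule nn_integral_cong_AE)
      show "AE x in M. ennreal ((norm (f n x - g x))\<^sup>2) = liminf (\<lambda>k. ennreal ((norm (f n x - f (r k) x))\<^sup>2))"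
        using lim
      proof eventually_elim
        case (elim x)
        have "(\<lambda>k. ennreal ((norm (f n x - f (r k) x))\<^sup>2)) \<longlonglongrightarrow> ennreal ((norm (f n x - g x))\<^sup>2)"
          by (intro tendsto_intros elim)
        then show ?case by (intro lim_imp_Liminf[symmetric]) auto
      qed
    qed
    also have "\<dots> \<le> liminf (\<lambda>k. \<integral>\<^sup>+x. ennreal ((norm (f n x - f (r k) x))\<^sup>2) \<partial>M)"
      by (intro nn_integral_liminf) measurable
    also have "\<dots> \<le> ennreal e"
    proof (rule Liminf_le)
      show "\<forall>\<^sub>F k in sequentially. (\<integral>\<^sup>+x. ennreal ((norm (f n x - f (r k) x))\<^sup>2) \<partial>M) \<le> ennreal e"
        using eventually_ge_at_top[of "N e"]
      proof eventually_elim
        case (elim k)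
        then have "r k \<ge> N e" using r(3)[of k] by simp
        then show ?case
          using N[OF e n] by (subst nn_integral_eq_integral) (auto intro!: int ennreal_leI)
      qed
    qed simp
    finally show ?thesis .
  qed
  have fin: "integrable M (\<lambda>x. (norm (f n x - g x))\<^sup>2)" if "e > 0" "n \<ge> N e" for e n
    using bound[OF that] by (intro integrableI_bounded) (auto simp: le_less_trans ennreal_less_top)
  have small: "(LINT x|M. (norm (f n x - g x))\<^sup>2) \<le> e" if "e > 0" "n \<ge> N e" for e n
    using bound[OF that] nn_integral_eq_integral[OF fin[OF that]] that by (simp add: ennreal_le_iff)
  have "(\<lambda>x. f (N 1) x - g x) \<in> Lp_space M 2"
    using fin[of 1 "N 1"] by (simp add: Lp_space_2_iff)
  from Lp_space_diff[OF L2[of "N 1"] this] have g: "g \<in> Lp_space M 2" by simp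
  moreover have "(\<lambda>n. LINT x|M. (norm (f n x - g x))\<^sup>2) \<longlonglongrightarrow> 0"
  proof (rule LIMSEQ_I)
    fix e :: real assume "e > 0"
    show "\<exists>no. \<forall>n\<ge>no. norm ((LINT x|M. (norm (f n x - g x))\<^sup>2) - 0) < e"
    proof (intro exI allI impI)
      fix n assume "n \<ge> N (e / 2)"
      with small[of "e / 2" n] \<open>e > 0\<close>
      show "norm ((LINT x|M. (norm (f n x - g x))\<^sup>2) - 0) < e" by simp
    qed
  qed
  ultimately show ?thesis by (rule that)
qed

section \<open>The isometry for step processes and the Ito integral\<close>

abbreviation process_of :: "nat \<Rightarrow> (nat \<Rightarrow> real) \<Rightarrow> (nat \<Rightarrow> 'a \<Rightarrow> real^'k^'m) \<Rightarrow> 'a \<times> real \<Rightarrow> real^'k^'m" where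
  "process_of N \<tau> \<xi> \<equiv> \<lambda>(\<omega>, s). elementary_process N \<tau> \<xi> s \<omega>"

lemma process_of_eq:
  "process_of N \<tau> \<xi> = (\<lambda>x. \<Sum>i<N. indicator {\<tau> i<..\<tau> (Suc i)} (snd x) *\<^sub>R \<xi> i (fst x))"
  by (auto simp: elementary_process_def)

lemma (in prob_space) indicator_times_L2:
  fixes f :: "'a \<Rightarrow> 'e::euclidean_space"
  assumes "f \<in> Lp_space M 2"
  shows "(\<lambda>x. indicator {a<..b::real} (snd x) *\<^sub>R f (fst x)) \<in> Lp_space (with_time M) 2"
proof -
  have [measurable]: "f \<in> borel_measurable M" using assms by (simp add: Lp_space_def)
  have "integrable lborel (indicator {a<..b} :: real \<Rightarrow> real)"
    using emeasure_bounded_finite[OF bounded_subset[OF bounded_closed_interval greaterThanAtMost_subseteq_atLeastAtMost_iff[THEN iffD2]], of a b a b]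
    by (intro integrable_real_indicator) auto
  moreover have "integrable M (\<lambda>x. (norm (f x))\<^sup>2)" using assms by (simp add: Lp_space_2_iff)
  ultimately have "integrable (with_time M) (\<lambda>x. (norm (f (fst x)))\<^sup>2 * indicator {a<..b} (snd x))"
    by (intro integrable_pair_mult)
  also have "(\<lambda>x::'a \<times> real. (norm (f (fst x)))\<^sup>2 * indicator {a<..b} (snd x))
      = (\<lambda>x. (norm (indicator {a<..b} (snd x) *\<^sub>R f (fst x)))\<^sup>2)"
    by (auto simp: indicator_def fun_eq_iff)
  finally show ?thesis by (simp add: Lp_space_2_iff)
qed

context wiener_process
begin

definition L2_step :: "real \<Rightarrow> nat \<Rightarrow> (nat \<Rightarrow> real) \<Rightarrow> (nat \<Rightarrow> 'a \<Rightarrow> real^'k^'m) \<Rightarrow> bool" where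
  "L2_step t N \<tau> \<xi> \<longleftrightarrow> mono_on {..N} \<tau> \<and> \<tau> ` {..N} \<subseteq> {0..t} \<and> (\<forall>i<N. \<xi> i \<in> L2_at (\<tau> i))"

lemma L2_stepD:
  assumes "L2_step t N \<tau> \<xi>" "i < N" "t \<le> T"
  shows "0 \<le> \<tau> i" "\<tau> i \<le> \<tau> (Suc i)" "\<tau> (Suc i) \<le> t" "\<tau> (Suc i) \<le> T"
    "\<xi> i \<in> L2_at (\<tau> i)" "\<xi> i \<in> Lp_space M 2"
proof -
  have mono: "mono_on {..N} \<tau>" and sub: "\<tau> ` {..N} \<subseteq> {0..t}"
    using assms(1) by (simp_all add: L2_step_def)
  have "\<tau> i \<in> {0..t}" "\<tau> (Suc i) \<in> {0..t}"
    by (rule subsetD[OF sub], use assms(2) in simp)+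
  moreover have "\<tau> i \<le> \<tau> (Suc i)"
    by (rule mono_onD[OF mono]) (use assms(2) in auto)
  ultimately show "0 \<le> \<tau> i" "\<tau> i \<le> \<tau> (Suc i)" "\<tau> (Suc i) \<le> t" "\<tau> (Suc i) \<le> T"
    using assms by auto
  show "\<xi> i \<in> L2_at (\<tau> i)" "\<xi> i \<in> Lp_space M 2"
    using assms by (auto simp: L2_step_def L2_at_def)
qed

lemma elementary_L2_step:
  assumes el: "elementary M F t N \<tau> \<xi>" and t: "t \<le> T"
  shows "L2_step t N \<tau> \<xi>"
proof -
  have "\<xi> i \<in> L2_at (\<tau> i)" if i: "i < N" for i
  proof -
    have "\<tau> ` {..N} \<subseteq> {0..t}" using el by (simp add: elementary_def)
    then have "\<tau> i \<in> {0..t}" by (rule subsetD) (use i in simp)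
    with t have \<tau>: "\<tau> i \<in> {0..T}" by simp
    have \<xi>: "\<xi> i \<in> borel_measurable (F (\<tau> i))" using el i by (simp add: elementary_def)
    have [measurable]: "\<xi> i \<in> borel_measurable M" by (rule measurable_F[OF \<tau> \<xi>])
    have "\<exists>C. \<forall>\<omega>\<in>space M. norm (\<xi> i \<omega>) \<le> C"
      using el i by (simp add: elementary_def)
    then obtain C where C: "\<And>\<omega>. \<omega> \<in> space M \<Longrightarrow> norm (\<xi> i \<omega>) \<le> C"
      by blast
    have "integrable M (\<lambda>\<omega>. (norm (\<xi> i \<omega>))\<^sup>2)"
    proof (rule integrable_const_bound)
      show "AE \<omega> in M. norm ((norm (\<xi> i \<omega>))\<^sup>2) \<le> C\<^sup>2"
        using C by (intro AE_I2) (auto intro!: power_mono)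
    qed measurable
    then show ?thesis using \<xi> by (simp add: L2_at_def Lp_space_2_iff)
  qed
  then show ?thesis using el by (simp add: L2_step_def elementary_def)
qed

lemma elementary_integral_eq:
  "elementary_integral W N \<tau> \<xi> = (\<lambda>\<omega>. \<Sum>i<N. block (\<xi> i) (\<tau> i) (\<tau> (Suc i)) \<omega>)"
  by (simp add: elementary_integral_def block_def fun_eq_iff)

lemma elementary_integral_L2:
  assumes "L2_step t N \<tau> \<xi>" "t \<le> T"
  shows "elementary_integral W N \<tau> \<xi> \<in> Lp_space M 2"
  unfolding elementary_integral_eq
  using L2_stepD[OF assms(1) _ assms(2)] by (intro Lp_space_sum block_L2) auto

lemma process_of_L2:
  assumes "L2_step t N \<tau> \<xi>" "t \<le> T"
  shows "process_of N \<tau> \<xi> \<in> Lp_space (with_time M) 2"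
  unfolding process_of_eq
  using L2_stepD[OF assms(1) _ assms(2)] by (intro Lp_space_sum indicator_times_L2) auto

lemma time_cut_process_of:
  assumes "L2_step t N \<tau> \<xi>" "t \<le> T"
  shows "time_cut 0 t (process_of N \<tau> \<xi>) = process_of N \<tau> \<xi>"
proof
  fix x :: "'a \<times> real"
  show "time_cut 0 t (process_of N \<tau> \<xi>) x = process_of N \<tau> \<xi> x"
  proof (cases "snd x \<in> {0..t}")
    case False
    have "indicator {\<tau> i<..\<tau> (Suc i)} (snd x) *\<^sub>R \<xi> i (fst x) = 0" if "i < N" for i
      using L2_stepD(1,3)[OF assms(1) that assms(2)] False by (auto simp: indicator_def)
    then have "process_of N \<tau> \<xi> x = 0"
      unfolding process_of_eq by (intro sum.neutral) auto
    then show ?thesis unfolding time_cut_def by simp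
  qed (simp add: time_cut_def)
qed

text \<open>Both sides are bilinear in the steps. For a single pair of steps
  \<open>block_inner\<close> produces the length of the overlap of the two intervals, which is the
  time integral of the product of their indicators.\<close>

lemma ito_isometry_inner:
  assumes a: "L2_step t N \<tau> \<xi>" and b: "L2_step t N' \<tau>' \<xi>'" and t: "t \<le> T"
  shows "(LINT \<omega>|M. elementary_integral W N \<tau> \<xi> \<omega> \<bullet> elementary_integral W N' \<tau>' \<xi>' \<omega>) =
    (LINT x|with_time M. process_of N \<tau> \<xi> x \<bullet> process_of N' \<tau>' \<xi>' x)"
proof -
  let ?b = "\<lambda>i. block (\<xi> i) (\<tau> i) (\<tau> (Suc i))" and ?b' = "\<lambda>j. block (\<xi>' j) (\<tau>' j) (\<tau>' (Suc j))"
  let ?I = "\<lambda>i. {\<tau> i<..\<tau> (Suc i)}" and ?I' = "\<lambda>j. {\<tau>' j<..\<tau>' (Suc j)}"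
  let ?X = "\<lambda>i x. indicator (?I i) (snd x) *\<^sub>R \<xi> i (fst x)" and ?X' = "\<lambda>j x. indicator (?I' j) (snd x) *\<^sub>R \<xi>' j (fst x)"
  note A = L2_stepD[OF a _ t] and B = L2_stepD[OF b _ t]
  have "(LINT \<omega>|M. elementary_integral W N \<tau> \<xi> \<omega> \<bullet> elementary_integral W N' \<tau>' \<xi>' \<omega>) =
     (LINT \<omega>|M. (\<Sum>i<N. \<Sum>j<N'. ?b i \<omega> \<bullet> ?b' j \<omega>))"
    by (simp only: elementary_integral_eq inner_sum_left inner_sum_right)
      (intro Bochner_Integration.integral_cong refl sum.swap)
  also have "\<dots> = (\<Sum>i<N. \<Sum>j<N'. LINT \<omega>|M. ?b i \<omega> \<bullet> ?b' j \<omega>)"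
    using A B by (subst Bochner_Integration.integral_sum)
      (auto intro!: Bochner_Integration.integrable_sum integrable_inner_L2 block_L2
        sum.cong Bochner_Integration.integral_sum)
  also have "\<dots> = (\<Sum>i<N. \<Sum>j<N'. LINT x|with_time M. ?X i x \<bullet> ?X' j x)"
  proof (intro sum.cong refl)
    fix i j assume "i \<in> {..<N}" "j \<in> {..<N'}"
    then have i: "i < N" and j: "j < N'" by auto
    have "(LINT \<omega>|M. ?b i \<omega> \<bullet> ?b' j \<omega>) =
        measure lborel (?I i \<inter> ?I' j) * (LINT \<omega>|M. \<xi> i \<omega> \<bullet> \<xi>' j \<omega>)"
      using A(1,2,4,5)[OF i] B(1,2,4,5)[OF j] by (intro block_inner)
    also have "\<dots> = (LINT \<omega>|M. \<xi> i \<omega> \<bullet> \<xi>' j \<omega>) * (LINT s|lborel. indicator (?I i \<inter> ?I' j) s)"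
      by simp
    also have "\<dots> = (LINT x|with_time M. (\<xi> i (fst x) \<bullet> \<xi>' j (fst x)) *
        indicator (?I i \<inter> ?I' j) (snd x))"
    proof (rule integrable_pair_mult(2)[symmetric])
      show "integrable M (\<lambda>\<omega>. \<xi> i \<omega> \<bullet> \<xi>' j \<omega>)"
        by (intro integrable_inner_L2 A(6)[OF i] B(6)[OF j])
      show "integrable lborel (indicator (?I i \<inter> ?I' j) :: real \<Rightarrow> real)"
      proof (rule integrable_real_indicator)
        have "emeasure lborel (?I i \<inter> ?I' j) \<le> emeasure lborel (?I i)"
          by (intro emeasure_mono) auto
        then show "emeasure lborel (?I i \<inter> ?I' j) < \<infinity>"
          using A(2)[OF i] by (auto elim: le_less_trans)
      qed simp
    qed
    also have "\<dots> = (LINT x|with_time M. ?X i x \<bullet> ?X' j x)"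
      by (intro Bochner_Integration.integral_cong) (auto simp: indicator_def)
    finally show "(LINT \<omega>|M. ?b i \<omega> \<bullet> ?b' j \<omega>) =
      (LINT x|with_time M. ?X i x \<bullet> ?X' j x)" .
  qed
  also have "\<dots> = (LINT x|with_time M. (\<Sum>i<N. \<Sum>j<N'. ?X i x \<bullet> ?X' j x))"
    using integrable_inner_L2[OF indicator_times_L2[OF A(6)] indicator_times_L2[OF B(6)]]
    by (subst Bochner_Integration.integral_sum)
      (auto intro!: Bochner_Integration.integrable_sum sum.cong Bochner_Integration.integral_sum[symmetric]
        simp del: inner_scaleR_left inner_scaleR_right)
  also have "\<dots> = (LINT x|with_time M. process_of N \<tau> \<xi> x \<bullet> process_of N' \<tau>' \<xi>' x)"
    by (simp only: process_of_eq inner_sum_left inner_sum_right)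
      (intro Bochner_Integration.integral_cong refl sum.swap)
  finally show ?thesis .
qed

lemma ito_isometry_diff:
  assumes a: "L2_step t N \<tau> \<xi>" and b: "L2_step t N' \<tau>' \<xi>'" and t: "t \<le> T"
  shows "(LINT \<omega>|M. (norm (elementary_integral W N \<tau> \<xi> \<omega> - elementary_integral W N' \<tau>' \<xi>' \<omega>))\<^sup>2) =
    (LINT x|with_time M. (norm (process_of N \<tau> \<xi> x - process_of N' \<tau>' \<xi>' x))\<^sup>2)"
  by (subst (1 2) integral_square_norm_diff)
    (simp_all only: elementary_integral_L2[OF a t] elementary_integral_L2[OF b t]
      process_of_L2[OF a t] process_of_L2[OF b t]
      ito_isometry_inner[OF a a t] ito_isometry_inner[OF a b t] ito_isometry_inner[OF b b t])

text \<open>Coefficient values of norm above n are set to zero, which keeps them adapted and bounds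
  them. The error tends to zero pointwise and is dominated by the step function G built from the
  norms of the original coefficients.\<close>

lemma elementary_approximates_L2_step:
  assumes st: "L2_step t N \<tau> \<xi>" and t: "t \<le> T" and e: "e > 0"
  obtains \<xi>' where "elementary M F t N \<tau> \<xi>'"
    "(LINT x|with_time M. (norm (process_of N \<tau> \<xi>' x - process_of N \<tau> \<xi> x))\<^sup>2) < e"
proof -
  note S = L2_stepD[OF st _ t]
  define \<zeta> where "\<zeta> n i \<omega> = (if norm (\<xi> i \<omega>) \<le> real n then \<xi> i \<omega> else 0)" for n :: nat and i \<omega>
  have el: "elementary M F t N \<tau> (\<zeta> n)" for n
    unfolding elementary_def
  proof (intro conjI allI impI)
    fix i assume i: "i < N"
    then have [measurable]: "\<xi> i \<in> borel_measurable (F (\<tau> i))"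
      using S(5) by (simp add: L2_at_def)
    show "\<zeta> n i \<in> borel_measurable (F (\<tau> i))" unfolding \<zeta>_def by measurable
    show "\<exists>C. \<forall>\<omega>\<in>space M. norm (\<zeta> n i \<omega>) \<le> C" by (intro exI[of _ "real n"]) (simp add: \<zeta>_def)
  qed (use st in \<open>auto simp: L2_step_def\<close>)
  define G where "G x = (\<Sum>i<N. indicator {\<tau> i<..\<tau> (Suc i)} (snd x) *\<^sub>R norm (\<xi> i (fst x)))" for x :: "'a \<times> real"
  have "(\<lambda>\<omega>. norm (\<xi> i \<omega>)) \<in> Lp_space M 2" if "i < N" for i
    using S(6)[OF that] by (auto simp: Lp_space_2_iff)
  then have "G \<in> Lp_space (with_time M) 2"
    unfolding G_def by (intro Lp_space_sum indicator_times_L2) auto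
  then have G: "integrable (with_time M) (\<lambda>x. (G x)\<^sup>2)" by (simp add: Lp_space_2_iff)
  have diff: "process_of N \<tau> (\<zeta> n) x - process_of N \<tau> \<xi> x =
      (\<Sum>i<N. indicator {\<tau> i<..\<tau> (Suc i)} (snd x) *\<^sub>R (\<zeta> n i (fst x) - \<xi> i (fst x)))" for n x
    by (simp add: process_of_eq sum_subtractf scaleR_diff_right)
  have "(\<lambda>n. LINT x|with_time M. (norm (process_of N \<tau> (\<zeta> n) x - process_of N \<tau> \<xi> x))\<^sup>2)
      \<longlonglongrightarrow> (LINT x|with_time M. 0)"
  proof (rule integral_dominated_convergence[OF _ _ G])
    show "AE x in with_time M. (\<lambda>n. (norm (process_of N \<tau> (\<zeta> n) x - process_of N \<tau> \<xi> x))\<^sup>2) \<longlonglongrightarrow> 0"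
    proof (rule AE_I2)
      fix x :: "'a \<times> real"
      have "(\<lambda>n. \<zeta> n i (fst x)) \<longlonglongrightarrow> \<xi> i (fst x)" for i
      proof (rule tendsto_eventually)
        obtain n0 :: nat where "norm (\<xi> i (fst x)) \<le> real n0" using real_arch_simple by blast
        then show "\<forall>\<^sub>F n in sequentially. \<zeta> n i (fst x) = \<xi> i (fst x)"
          unfolding eventually_sequentially by (intro exI[of _ n0]) (auto simp: \<zeta>_def)
      qed
      then have "(\<lambda>n. (norm (process_of N \<tau> (\<zeta> n) x - process_of N \<tau> \<xi> x))\<^sup>2)
          \<longlonglongrightarrow> (norm (\<Sum>i<N. indicator {\<tau> i<..\<tau> (Suc i)} (snd x) *\<^sub>R (\<xi> i (fst x) - \<xi> i (fst x))))\<^sup>2"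
        unfolding diff by (intro tendsto_intros)
      then show "(\<lambda>n. (norm (process_of N \<tau> (\<zeta> n) x - process_of N \<tau> \<xi> x))\<^sup>2) \<longlonglongrightarrow> 0"
        by simp
    qed
    fix n
    have "norm (process_of N \<tau> (\<zeta> n) x - process_of N \<tau> \<xi> x) \<le> G x" for x
      unfolding diff G_def
      by (intro sum_norm_le) (auto simp: \<zeta>_def indicator_def)
    then show "AE x in with_time M. norm ((norm (process_of N \<tau> (\<zeta> n) x - process_of N \<tau> \<xi> x))\<^sup>2) \<le> (G x)\<^sup>2"
      by (auto intro!: power_mono)
    show "(\<lambda>x. (norm (process_of N \<tau> (\<zeta> n) x - process_of N \<tau> \<xi> x))\<^sup>2) \<in> borel_measurable (with_time M)"
      using Lp_space_diff[OF process_of_L2[OF elementary_L2_step[OF el t] t] process_of_L2[OF st t], of n]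
      by (auto simp: Lp_space_2_iff)
  qed simp
  then have "\<forall>\<^sub>F n in sequentially. (LINT x|with_time M. (norm (process_of N \<tau> (\<zeta> n) x - process_of N \<tau> \<xi> x))\<^sup>2) < e"
    using e by (intro order_tendstoD) simp_all
  then obtain n where "(LINT x|with_time M. (norm (process_of N \<tau> (\<zeta> n) x - process_of N \<tau> \<xi> x))\<^sup>2) < e"
    by (auto simp: eventually_sequentially)
  then show ?thesis using el that by blast
qed

lemma Lp_converges_process_iff:
  fixes h :: "'a \<times> real \<Rightarrow> real^'k^'m"
  assumes st: "\<And>j. L2_step t (N j) (\<tau> j) (\<xi> j)" and t: "t \<le> T"
  shows "Lp_converges (time_product M t) 2 (\<lambda>j. process_of (N j) (\<tau> j) (\<xi> j)) h \<longleftrightarrow>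
    time_cut 0 t h \<in> Lp_space (with_time M) 2 \<and>
    (\<lambda>j. LINT x|with_time M. (norm (process_of (N j) (\<tau> j) (\<xi> j) x - time_cut 0 t h x))\<^sup>2) \<longlonglongrightarrow> 0"
proof -
  have "Lp_norm (time_product M t) 2 (\<lambda>x. process_of (N j) (\<tau> j) (\<xi> j) x - h x) =
     sqrt (LINT x|with_time M. (norm (process_of (N j) (\<tau> j) (\<xi> j) x - time_cut 0 t h x))\<^sup>2)" for j
    by (subst Lp_norm_time_product) (simp_all only: time_cut_diff time_cut_process_of[OF st t] Lp_norm_2 zero_less_numeral)
  moreover have "process_of (N j) (\<tau> j) (\<xi> j) \<in> Lp_space (time_product M t) 2" for j
    unfolding Lp_space_time_product[of 2, simplified] time_cut_process_of[OF st t] by (rule process_of_L2[OF st t])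
  moreover have "(\<lambda>j. sqrt (a j)) \<longlonglongrightarrow> 0 \<longleftrightarrow> a \<longlonglongrightarrow> 0" if "\<And>j. a j \<ge> 0" for a :: "nat \<Rightarrow> real"
    using tendsto_power[of "\<lambda>j. sqrt (a j)" 0 sequentially 2] tendsto_real_sqrt[of a 0 sequentially] that
    by auto
  ultimately show ?thesis
    unfolding Lp_converges_def Lp_space_time_product[of 2, simplified] by simp
qed

lemma Lp_converges_2_iff:
  fixes f :: "nat \<Rightarrow> 'b \<Rightarrow> 'e::real_normed_vector"
  shows "Lp_converges N 2 f g \<longleftrightarrow> (\<forall>n. f n \<in> Lp_space N 2) \<and> g \<in> Lp_space N 2 \<and>
    (\<lambda>n. LINT x|N. (norm (f n x - g x))\<^sup>2) \<longlonglongrightarrow> 0"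
proof -
  have "(\<lambda>j. sqrt (a j)) \<longlonglongrightarrow> 0 \<longleftrightarrow> a \<longlonglongrightarrow> 0" if "\<And>j. a j \<ge> 0" for a :: "nat \<Rightarrow> real"
    using tendsto_power[of "\<lambda>j. sqrt (a j)" 0 sequentially 2] tendsto_real_sqrt[of a 0 sequentially] that
    by auto
  then show ?thesis by (simp add: Lp_converges_def Lp_norm_2)
qed

text \<open>Approximability of the given integrand is a hypothesis here; in the application the grid
  averages verify it. The isometry makes the elementary integrals a Cauchy sequence, and
  \<open>L2_complete\<close> gives the limit.\<close>

lemma has_ito_integral_exists:
  fixes \<Phi> :: "real \<Rightarrow> 'a \<Rightarrow> real^'k^'m" and t :: real
  defines "g \<equiv> time_cut 0 t (\<lambda>(\<omega>, s). \<Phi> s \<omega>)"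
  assumes t: "t \<le> T" and g: "g \<in> Lp_space (with_time M) 2"
    and approx: "\<And>e. e > 0 \<Longrightarrow> \<exists>N \<tau> \<xi>. L2_step t N \<tau> \<xi> \<and>
      (LINT x|with_time M. (norm (process_of N \<tau> \<xi> x - g x))\<^sup>2) < e"
  shows "\<exists>Y. has_ito_integral M F W \<Phi> t Y"
proof -
  have "\<exists>N \<tau> \<xi>. elementary M F t N \<tau> \<xi> \<and> (LINT x|with_time M. (norm (process_of N \<tau> \<xi> x - g x))\<^sup>2) < e"
    if e: "e > 0" for e
  proof -
    obtain N \<tau> \<xi> where st: "L2_step t N \<tau> \<xi>"
      and close: "(LINT x|with_time M. (norm (process_of N \<tau> \<xi> x - g x))\<^sup>2) < e / 4"
      using approx[of "e / 4"] e by auto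
    obtain \<xi>' where el: "elementary M F t N \<tau> \<xi>'"
      and close': "(LINT x|with_time M. (norm (process_of N \<tau> \<xi>' x - process_of N \<tau> \<xi> x))\<^sup>2) < e / 4"
      using elementary_approximates_L2_step[OF st t, of "e / 4"] e by auto
    have "(LINT x|with_time M. (norm (process_of N \<tau> \<xi>' x - g x))\<^sup>2) < e"
      using integral_square_norm_triangle[OF process_of_L2[OF elementary_L2_step[OF el t] t] process_of_L2[OF st t] g]
        close close' by linarith
    then show ?thesis using el by blast
  qed
  then have "\<forall>j. \<exists>N \<tau> \<xi>. elementary M F t N \<tau> \<xi> \<and>
      (LINT x|with_time M. (norm (process_of N \<tau> \<xi> x - g x))\<^sup>2) < 1 / real (Suc j)"
    by simp
  then obtain N \<tau> \<xi> where el: "\<And>j. elementary M F t (N j) (\<tau> j) (\<xi> j)"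
    and close: "\<And>j. (LINT x|with_time M. (norm (process_of (N j) (\<tau> j) (\<xi> j) x - g x))\<^sup>2) < 1 / real (Suc j)"
    unfolding choice_iff by blast
  note st = elementary_L2_step[OF el t]
  note P = process_of_L2[OF st t]
  have I: "elementary_integral W (N j) (\<tau> j) (\<xi> j) \<in> Lp_space M 2" for j
    by (rule elementary_integral_L2[OF st t])
  obtain Y where Y: "Y \<in> Lp_space M 2"
    "(\<lambda>j. LINT \<omega>|M. (norm (elementary_integral W (N j) (\<tau> j) (\<xi> j) \<omega> - Y \<omega>))\<^sup>2) \<longlonglongrightarrow> 0"
  proof (rule L2_complete[OF I])
    fix e :: real assume e: "e > 0"
    \<comment> \<open>Two distances to g, each below \<open>e / 4\<close>, are doubled by the
      squared triangle inequality.\<close>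
    obtain k where k: "1 / real (Suc k) < e / 4"
      using e nat_approx_posE[of "e / 4"] by auto
    show "\<exists>k. \<forall>m\<ge>k. \<forall>n\<ge>k. (LINT x|M. (norm (elementary_integral W (N m) (\<tau> m) (\<xi> m) x -
        elementary_integral W (N n) (\<tau> n) (\<xi> n) x))\<^sup>2) \<le> e"
    proof (intro exI[of _ k] allI impI)
      fix m n assume "m \<ge> k" "n \<ge> k"
      then have *: "1 / real (Suc m) \<le> 1 / real (Suc k)" "1 / real (Suc n) \<le> 1 / real (Suc k)"
        by (auto simp: field_simps)
      show "(LINT x|M. (norm (elementary_integral W (N m) (\<tau> m) (\<xi> m) x -
        elementary_integral W (N n) (\<tau> n) (\<xi> n) x))\<^sup>2) \<le> e"
        unfolding ito_isometry_diff[OF st st t]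
        using integral_square_norm_triangle[OF P[of m] g P[of n]] close[of m] close[of n] * k
        by (simp only: norm_minus_commute[of "g x" for x])
    qed
  qed
  have "(\<lambda>j. LINT x|with_time M. (norm (process_of (N j) (\<tau> j) (\<xi> j) x - g x))\<^sup>2) \<longlonglongrightarrow> 0"
  proof (rule tendsto_sandwich[OF _ _ tendsto_const LIMSEQ_Suc[OF lim_1_over_n]])
    show "\<forall>\<^sub>F j in sequentially. (LINT x|with_time M. (norm (process_of (N j) (\<tau> j) (\<xi> j) x - g x))\<^sup>2) \<le> 1 / real (Suc j)"
      using close by (intro always_eventually allI less_imp_le)
  qed simp
  then have "Lp_converges (time_product M t) 2 (\<lambda>j. process_of (N j) (\<tau> j) (\<xi> j)) (\<lambda>(\<omega>, s). \<Phi> s \<omega>)"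
    using g by (subst Lp_converges_process_iff[OF st t]) (simp add: g_def)
  then show ?thesis
    using el Y I unfolding has_ito_integral_def Lp_converges_2_iff[of M] by blast
qed

text \<open>Valid for every version Y, so the choice made by \<open>ito_integral\<close> is
  harmless. Going through the defining sequence costs two squared triangle inequalities, hence the
  constant 4 in place of the 1 of the isometry.\<close>

lemma has_ito_integral_estimate:
  fixes \<Phi> :: "real \<Rightarrow> 'a \<Rightarrow> real^'k^'m" and t :: real
  defines "g \<equiv> time_cut 0 t (\<lambda>(\<omega>, s). \<Phi> s \<omega>)"
  assumes ito: "has_ito_integral M F W \<Phi> t Y" and t: "t \<le> T" and st: "L2_step t N \<tau> \<xi>"
  shows "Y \<in> Lp_space M 2"
    and "(LINT \<omega>|M. (norm (Y \<omega> - elementary_integral W N \<tau> \<xi> \<omega>))\<^sup>2) \<le>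
      4 * (LINT x|with_time M. (norm (g x - process_of N \<tau> \<xi> x))\<^sup>2)"
proof -
  obtain N' \<tau>' \<xi>' where el: "\<And>j. elementary M F t (N' j) (\<tau>' j) (\<xi>' j)"
    and p: "Lp_converges (time_product M t) 2 (\<lambda>j. process_of (N' j) (\<tau>' j) (\<xi>' j)) (\<lambda>(\<omega>, s). \<Phi> s \<omega>)"
    and i: "Lp_converges M 2 (\<lambda>j. elementary_integral W (N' j) (\<tau>' j) (\<xi>' j)) Y"
    using ito unfolding has_ito_integral_def by blast
  note st' = elementary_L2_step[OF el t]
  have g: "g \<in> Lp_space (with_time M) 2"
    and pg: "(\<lambda>j. LINT x|with_time M. (norm (process_of (N' j) (\<tau>' j) (\<xi>' j) x - g x))\<^sup>2) \<longlonglongrightarrow> 0"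
    using p unfolding Lp_converges_process_iff[OF st' t] by (auto simp: g_def)
  show Y: "Y \<in> Lp_space M 2" using i by (simp add: Lp_converges_2_iff)
  have iY: "(\<lambda>j. LINT \<omega>|M. (norm (elementary_integral W (N' j) (\<tau>' j) (\<xi>' j) \<omega> - Y \<omega>))\<^sup>2) \<longlonglongrightarrow> 0"
    using i by (simp add: Lp_converges_2_iff)
  let ?D = "LINT \<omega>|M. (norm (Y \<omega> - elementary_integral W N \<tau> \<xi> \<omega>))\<^sup>2"
  let ?E = "LINT x|with_time M. (norm (g x - process_of N \<tau> \<xi> x))\<^sup>2"
  have "?D \<le> 2 * (LINT \<omega>|M. (norm (elementary_integral W (N' j) (\<tau>' j) (\<xi>' j) \<omega> - Y \<omega>))\<^sup>2)
      + 2 * (2 * (LINT x|with_time M. (norm (process_of (N' j) (\<tau>' j) (\<xi>' j) x - g x))\<^sup>2) + 2 * ?E)" for j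
    using integral_square_norm_triangle[OF Y elementary_integral_L2[OF st' t] elementary_integral_L2[OF st t], of j]
      integral_square_norm_triangle[OF process_of_L2[OF st' t, of j] g process_of_L2[OF st t]]
    unfolding ito_isometry_diff[OF st' st t] by (simp add: norm_minus_commute)
  then have "?D \<le> 2 * 0 + 2 * (2 * 0 + 2 * ?E)"
    by (intro LIMSEQ_le_const[OF tendsto_add[OF tendsto_mult[OF tendsto_const iY]
      tendsto_mult[OF tendsto_const tendsto_add[OF tendsto_mult[OF tendsto_const pg] tendsto_const]]]])
      auto
  then show "?D \<le> 4 * ?E" by simp
qed

end

section \<open>Averaging in time\<close>

text \<open>On paths whose restriction to the interval is not integrable, the integral takes its
  default value 0, so the average is a total function and needs no correction on a null set.\<close>

definition time_avg :: "real \<Rightarrow> real \<Rightarrow> ('a \<times> real \<Rightarrow> 'e::euclidean_space) \<Rightarrow> 'a \<Rightarrow> 'e" where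
  "time_avg a b f \<omega> = (1 / (b - a)) *\<^sub>R (LINT s|lborel. indicator {a..b} s *\<^sub>R f (\<omega>, s))"

lemma integrable_of_square_integrable:
  fixes h :: "real \<Rightarrow> 'e::euclidean_space"
  assumes h: "h \<in> borel_measurable borel" and int: "integrable lborel (\<lambda>s. (norm (h s))\<^sup>2)"
  shows "integrable lborel (\<lambda>s. indicator {a..b} s *\<^sub>R h s)"
proof (rule Bochner_Integration.integrable_bound)
  show "integrable lborel (\<lambda>s. indicator {a..b} s + (norm (h s))\<^sup>2)"
    by (intro Bochner_Integration.integrable_add int integrable_real_indicator)
      (auto simp: emeasure_lborel_Icc_eq)
  have "x \<le> 1 + x\<^sup>2" for x :: real
    using zero_le_power2[of "x - 1"] zero_le_power2[of x] by (simp add: power2_diff) (smt (verit) zero_le_power2)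
  then show "AE s in lborel. norm (indicator {a..b} s *\<^sub>R h s) \<le> norm (indicator {a..b} s + (norm (h s))\<^sup>2)"
    by (auto simp: indicator_def abs_of_nonneg add_nonneg_nonneg)
qed (use h in measurable)

text \<open>The integral of \<open>(norm (y - h s))\<^sup>2\<close> over the interval is a quadratic
  polynomial in y. Its nonnegativity at the mean x bounds the norm of x, and inserting this into its
  value at c gives the inequality.\<close>

lemma jensen_square:
  fixes h :: "real \<Rightarrow> 'e::euclidean_space"
  assumes ab: "a < b" and h: "h \<in> borel_measurable borel" and int: "integrable lborel (\<lambda>s. (norm (h s))\<^sup>2)"
  defines "x \<equiv> (1 / (b - a)) *\<^sub>R (LINT s|lborel. indicator {a..b} s *\<^sub>R h s)"
  shows "(norm (c - x))\<^sup>2 \<le> (1 / (b - a)) * (LINT s|lborel. indicator {a..b} s * (norm (c - h s))\<^sup>2)"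
    and "integrable lborel (\<lambda>s. indicator {a..b} s * (norm (c - h s))\<^sup>2)"
proof -
  define H where "H s = indicator {a..b} s *\<^sub>R h s" for s
  have H: "integrable lborel H" unfolding H_def by (rule integrable_of_square_integrable[OF h int])
  have Q: "integrable lborel (\<lambda>s. indicator {a..b} s * (norm (h s))\<^sup>2)"
    using integrable_mult_indicator[OF _ int, of "{a..b}"] by simp
  have I: "integrable lborel (indicator {a..b} :: real \<Rightarrow> real)"
    by (intro integrable_real_indicator) (auto simp: emeasure_lborel_Icc_eq)
  have x: "(LINT s|lborel. H s) = (b - a) *\<^sub>R x" using ab by (simp add: x_def H_def)
  have eq: "indicator {a..b} s * (norm (y - h s))\<^sup>2 =
      (y \<bullet> y) * indicator {a..b} s - 2 * (y \<bullet> H s) + indicator {a..b} s * (norm (h s))\<^sup>2" for y s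
    by (auto simp: H_def indicator_def power2_norm_eq_inner inner_diff_left inner_diff_right inner_commute)
  have int: "integrable lborel (\<lambda>s. indicator {a..b} s * (norm (y - h s))\<^sup>2)" for y
    unfolding eq by (intro Bochner_Integration.integrable_add Bochner_Integration.integrable_diff Q
        integrable_mult_right integrable_inner_right I H)
  have J: "(LINT s|lborel. indicator {a..b} s * (norm (y - h s))\<^sup>2) =
      (b - a) * (y \<bullet> y) - 2 * (b - a) * (y \<bullet> x) + (LINT s|lborel. indicator {a..b} s * (norm (h s))\<^sup>2)" for y
    unfolding eq using Q I H ab by (simp add: x)
  have "0 \<le> (LINT s|lborel. indicator {a..b} s * (norm (x - h s))\<^sup>2)"
    by (intro integral_nonneg_AE) auto
  then have "(b - a) * (x \<bullet> x) \<le> (LINT s|lborel. indicator {a..b} s * (norm (h s))\<^sup>2)"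
    unfolding J by (simp add: algebra_simps)
  moreover have "(b - a) * (norm (c - x))\<^sup>2 = (b - a) * (c \<bullet> c) - 2 * (b - a) * (c \<bullet> x) + (b - a) * (x \<bullet> x)"
    unfolding power2_norm_eq_inner inner_diff_left inner_diff_right inner_commute[of x c]
    by (simp add: algebra_simps)
  ultimately have "(b - a) * (norm (c - x))\<^sup>2 \<le> (LINT s|lborel. indicator {a..b} s * (norm (c - h s))\<^sup>2)"
    unfolding J by linarith
  then show "(norm (c - x))\<^sup>2 \<le> (1 / (b - a)) * (LINT s|lborel. indicator {a..b} s * (norm (c - h s))\<^sup>2)"
    using ab by (simp add: field_simps)
  show "integrable lborel (\<lambda>s. indicator {a..b} s * (norm (c - h s))\<^sup>2)" by (rule int)
qed

text \<open>For nonnegative u the restriction to \<open>{u..T}\<close> keeps both times inside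
  \<open>{0..T}\<close>, so the jumps created by extension by zero are not seen. The integral of its
  norm is the quantity in the hypothesis on time increments, see
  \<open>lag_time_cut_integral\<close>.\<close>

definition lag :: "real \<Rightarrow> real \<Rightarrow> ('a \<times> real \<Rightarrow> 'e::real_vector) \<Rightarrow> 'a \<times> real \<Rightarrow> 'e" where
  "lag T u f x = indicator {u..T} (snd x) *\<^sub>R (f x - f (fst x, snd x - u))"

definition grid :: "real \<Rightarrow> nat \<Rightarrow> real" where
  "grid \<delta> i = real i * \<delta>"

text \<open>
  On each grid interval the average over the preceding interval is used, so that the step
  process is adapted.
\<close>

definition grid_avg :: "real \<Rightarrow> ('a \<times> real \<Rightarrow> 'e::euclidean_space) \<Rightarrow> nat \<Rightarrow> 'a \<Rightarrow> 'e" where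
  "grid_avg \<delta> f i = (if i = 0 then (\<lambda>_. 0) else time_avg (grid \<delta> (i - 1)) (grid \<delta> i) f)"

abbreviation grid_process :: "real \<Rightarrow> nat \<Rightarrow> ('a \<times> real \<Rightarrow> real^'k^'m) \<Rightarrow> 'a \<times> real \<Rightarrow> real^'k^'m" where
  "grid_process \<delta> N f \<equiv> process_of N (grid \<delta>) (grid_avg \<delta> f)"

lemma process_of_grid:
  assumes "\<delta> > 0" "i < N" "s \<in> {grid \<delta> i<..grid \<delta> (Suc i)}"
  shows "process_of N (grid \<delta>) \<xi> (\<omega>, s) = \<xi> i \<omega>"
proof -
  have "indicator {grid \<delta> j<..grid \<delta> (Suc j)} s *\<^sub>R \<xi> j \<omega> = (if j = i then \<xi> i \<omega> else 0)" for j
  proof (cases "j = i")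
    case False
    have "s \<notin> {grid \<delta> j<..grid \<delta> (Suc j)}"
    proof
      assume "s \<in> {grid \<delta> j<..grid \<delta> (Suc j)}"
      with assms(3) have "real j * \<delta> < real (Suc i) * \<delta>" "real i * \<delta> < real (Suc j) * \<delta>"
        by (auto simp: grid_def)
      with \<open>\<delta> > 0\<close> have "real j < real (Suc i)" "real i < real (Suc j)"
        by (auto simp: mult_less_cancel_right)
      with False show False by simp
    qed
    with False show ?thesis by simp
  qed (use assms in simp)
  then show ?thesis
    using assms(2) by (simp only: process_of_eq fst_conv snd_conv) (simp add: sum.delta)
qed

lemma in_grid_interval:
  assumes "\<delta> > 0" "0 < s" "s \<le> real N * \<delta>"
  obtains i where "i < N" "s \<in> {grid \<delta> i<..grid \<delta> (Suc i)}"
proof -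
  \<comment> \<open>The ceiling and not the floor, because the grid intervals are open on the left
    and closed on the right.\<close>
  define i where "i = nat (\<lceil>s / \<delta>\<rceil> - 1)"
  have "\<lceil>s / \<delta>\<rceil> \<ge> 1" using assms by simp
  then have i: "real i = real_of_int \<lceil>s / \<delta>\<rceil> - 1" by (simp add: i_def)
  have "real i < s / \<delta>" "s / \<delta> \<le> real (Suc i)"
    using ceiling_correct[of "s / \<delta>"] i by auto
  then have s: "real i * \<delta> < s" "s \<le> real (Suc i) * \<delta>"
    using assms by (auto simp: field_simps)
  moreover have "i < N"
  proof -
    have "real i * \<delta> < real N * \<delta>" using s(1) assms(3) by linarith
    then show ?thesis using \<open>\<delta> > 0\<close> by (simp add: mult_less_cancel_right)
  qed
  ultimately show ?thesis by (intro that) (auto simp: grid_def)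
qed

text \<open>
  Comparing $f(s)$ with the average of $f$ over the preceding grid interval involves only lags
  between $0$ and $2\delta$.
\<close>

lemma grid_avg_pointwise:
  fixes f :: "'a \<times> real \<Rightarrow> real^'k^'m"
  assumes meas: "(\<lambda>s. f (\<omega>, s)) \<in> borel_measurable borel" and int: "integrable lborel (\<lambda>s. (norm (f (\<omega>, s)))\<^sup>2)"
    and \<delta>: "\<delta> > 0" and s: "0 < s" "s \<le> real N * \<delta>" "s \<le> T"
  shows "ennreal ((norm (grid_process \<delta> N f (\<omega>, s) - f (\<omega>, s)))\<^sup>2) \<le>
    ennreal ((norm (time_cut 0 \<delta> f (\<omega>, s)))\<^sup>2) +
    ennreal (1 / \<delta>) * (\<integral>\<^sup>+u. indicator {0..2 * \<delta>} u * ennreal ((norm (lag T u f (\<omega>, s)))\<^sup>2) \<partial>lborel)"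
proof -
  obtain i where i: "i < N" "s \<in> {grid \<delta> i<..grid \<delta> (Suc i)}"
    using in_grid_interval[OF \<delta> s(1,2)] .
  note p = process_of_grid[OF \<delta> i, of "grid_avg \<delta> f" \<omega>]
  show ?thesis
  proof (cases "i = 0")
    \<comment> \<open>There is no preceding interval, so the step process is 0 here and the error is
      f itself on \<open>{0..\<delta>}\<close>, the first term of the bound.\<close>
    case True
    then have "s \<in> {0..\<delta>}" using i s by (auto simp: grid_def)
    then show ?thesis using True unfolding p by (simp add: grid_avg_def time_cut_def)
  next
    case False
    define a b where "a = grid \<delta> (i - 1)" and "b = grid \<delta> i"
    have ba: "b - a = \<delta>" using False by (simp add: a_def b_def grid_def of_nat_diff algebra_simps)
    have a0: "a \<ge> 0" using \<delta> by (simp add: a_def grid_def)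
    have s2: "b < s" "s \<le> b + \<delta>" using i by (auto simp: b_def grid_def algebra_simps)
    have [measurable]: "(\<lambda>s. f (\<omega>, s)) \<in> borel_measurable borel" by (rule meas)
    note J = jensen_square[OF _ meas int, of a b "f (\<omega>, s)"]
    have "ennreal ((norm (grid_process \<delta> N f (\<omega>, s) - f (\<omega>, s)))\<^sup>2)
        = ennreal ((norm (f (\<omega>, s) - time_avg a b f \<omega>))\<^sup>2)"
      unfolding p using False by (simp add: grid_avg_def a_def b_def norm_minus_commute)
    also have "\<dots> \<le> ennreal ((1 / \<delta>) * (LINT r|lborel. indicator {a..b} r * (norm (f (\<omega>, s) - f (\<omega>, r)))\<^sup>2))"
      using J(1) ba \<delta> by (intro ennreal_leI) (simp add: time_avg_def)
    also have "\<dots> = ennreal (1 / \<delta>) * (\<integral>\<^sup>+r. ennreal (indicator {a..b} r * (norm (f (\<omega>, s) - f (\<omega>, r)))\<^sup>2) \<partial>lborel)"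
      using \<delta> J(2) ba
      by (subst ennreal_mult; (subst nn_integral_eq_integral)?) (auto intro!: integral_nonneg_AE)
    \<comment> \<open>Substituting \<open>u = s - r\<close> turns the average over the preceding
      interval into an average over lags.\<close>
    also have "(\<integral>\<^sup>+r. ennreal (indicator {a..b} r * (norm (f (\<omega>, s) - f (\<omega>, r)))\<^sup>2) \<partial>lborel)
        = (\<integral>\<^sup>+u. ennreal (indicator {a..b} (s - u) * (norm (f (\<omega>, s) - f (\<omega>, s - u)))\<^sup>2) \<partial>lborel)"
      by (subst nn_integral_real_affine[where c = "- 1" and t = s]) simp_all
    \<comment> \<open>With \<open>s - u\<close> in \<open>{a..b}\<close> and s in
      \<open>{b<..b + \<delta>}\<close>, the lag u lies between 0 and \<open>2 * \<delta>\<close>;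
      since a is nonnegative, u is at most s, so the cut in \<open>lag\<close> is inactive.\<close>
    also have "\<dots> \<le> (\<integral>\<^sup>+u. indicator {0..2 * \<delta>} u * ennreal ((norm (lag T u f (\<omega>, s)))\<^sup>2) \<partial>lborel)"
      using a0 s2 ba s(3) \<delta> by (intro nn_integral_mono) (auto simp: indicator_def lag_def)
    finally show ?thesis
      by (simp add: add_increasing mult_left_mono)
  qed
qed

context prob_space
begin

lemma AE_square_integrable:
  fixes f :: "'a \<times> real \<Rightarrow> 'e::euclidean_space"
  assumes "f \<in> Lp_space (with_time M) 2"
  shows "AE \<omega> in M. (\<lambda>s. f (\<omega>, s)) \<in> borel_measurable borel \<and> integrable lborel (\<lambda>s. (norm (f (\<omega>, s)))\<^sup>2)"
proof -
  interpret P: pair_sigma_finite M lborel ..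
  have f [measurable]: "f \<in> borel_measurable (with_time M)" and int: "integrable (with_time M) (\<lambda>x. (norm (f x))\<^sup>2)"
    using assms by (auto simp: Lp_space_2_iff)
  have "AE \<omega> in M. (\<lambda>s. f (\<omega>, s)) \<in> borel_measurable borel"
    by (rule AE_I2) (use measurable_compose_Pair1[OF _ f] in simp)
  with P.AE_integrable_fst'[OF int] show ?thesis by eventually_elim simp
qed

lemma AE_fst_pair:
  assumes "AE \<omega> in M. Q \<omega>"
  shows "AE x in with_time M. Q (fst x)"
proof -
  obtain N where N: "{\<omega> \<in> space M. \<not> Q \<omega>} \<subseteq> N" "N \<in> null_sets M"
    using assms by (auto simp: eventually_ae_filter)
  then have "N \<times> UNIV \<in> null_sets (with_time M)"
    by (auto simp: null_sets_def lborel.emeasure_pair_measure_Times)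
  then show ?thesis
    by (rule AE_I') (use N in \<open>auto simp: space_pair_measure\<close>)
qed

text \<open>The integral over \<open>{a..b}\<close> sees only the cut at b, and a parameter integral
  is measurable on the whole space. Applied with N = \<open>F b\<close>, this makes the average
  known at time b exactly and not just up to a null set, as \<open>L2_at\<close> demands.\<close>

lemma measurable_time_avg:
  fixes f :: "'a \<times> real \<Rightarrow> 'e::euclidean_space"
  assumes f: "time_cut 0 b f \<in> borel_measurable (N \<Otimes>\<^sub>M lborel)" and "0 \<le> a"
  shows "time_avg a b f \<in> borel_measurable N"
proof -
  have "(\<lambda>\<omega>. LINT s|lborel. indicator {a..b} s *\<^sub>R time_cut 0 b f (\<omega>, s)) \<in> borel_measurable N"
  proof (rule lborel.borel_measurable_lebesgue_integral)
    show "(\<lambda>(\<omega>, s). indicator {a..b} s *\<^sub>R time_cut 0 b f (\<omega>, s)) \<in> borel_measurable (N \<Otimes>\<^sub>M lborel)"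
      using f by (simp add: case_prod_beta')
  qed
  also have "(\<lambda>\<omega>. LINT s|lborel. indicator {a..b} s *\<^sub>R time_cut 0 b f (\<omega>, s)) =
      (\<lambda>\<omega>. LINT s|lborel. indicator {a..b} s *\<^sub>R f (\<omega>, s))"
    using \<open>0 \<le> a\<close> by (intro ext Bochner_Integration.integral_cong) (auto simp: time_cut_def indicator_def)
  finally show ?thesis unfolding time_avg_def by measurable
qed

lemma time_avg_square_le:
  fixes f :: "'a \<times> real \<Rightarrow> 'e::euclidean_space"
  assumes f: "f \<in> Lp_space (with_time M) 2" and ab: "a < b"
  shows "AE \<omega> in M. (norm (time_avg a b f \<omega>))\<^sup>2 \<le> (1 / (b - a)) * (LINT s|lborel. indicator {a..b} s * (norm (f (\<omega>, s)))\<^sup>2)"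
  using AE_square_integrable[OF f]
proof eventually_elim
  case (elim \<omega>)
  then show ?case using jensen_square(1)[OF ab, of "\<lambda>s. f (\<omega>, s)" 0] by (simp add: time_avg_def)
qed

lemma time_avg_L2:
  fixes f :: "'a \<times> real \<Rightarrow> 'e::euclidean_space"
  assumes f: "f \<in> Lp_space (with_time M) 2" and ab: "a < b"
  shows "time_avg a b f \<in> Lp_space M 2"
    and "(LINT \<omega>|M. (norm (time_avg a b f \<omega>))\<^sup>2) \<le> (1 / (b - a)) * (LINT x|with_time M. (norm (f x))\<^sup>2)"
proof -
  interpret P: pair_sigma_finite M lborel ..
  have fm [measurable]: "f \<in> borel_measurable (with_time M)" and int: "integrable (with_time M) (\<lambda>x. (norm (f x))\<^sup>2)"
    using f by (auto simp: Lp_space_2_iff)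
  have [measurable]: "time_avg a b f \<in> borel_measurable M"
    unfolding time_avg_def by measurable
  have le: "AE \<omega> in M. (norm (time_avg a b f \<omega>))\<^sup>2 \<le> (1 / (b - a)) * (LINT s|lborel. (norm (f (\<omega>, s)))\<^sup>2)"
    using time_avg_square_le[OF f ab] AE_square_integrable[OF f]
  proof eventually_elim
    case (elim \<omega>)
    have "(LINT s|lborel. indicator {a..b} s * (norm (f (\<omega>, s)))\<^sup>2) \<le> (LINT s|lborel. (norm (f (\<omega>, s)))\<^sup>2)"
      using elim(2) integrable_mult_indicator[of "{a..b}" lborel "\<lambda>s. (norm (f (\<omega>, s)))\<^sup>2"]
      by (intro integral_mono) (auto simp: indicator_def)
    with elim(1) ab show ?case
      by (smt (verit) divide_nonneg_nonneg mult_left_mono)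
  qed
  have int': "integrable M (\<lambda>\<omega>. (1 / (b - a)) * (LINT s|lborel. (norm (f (\<omega>, s)))\<^sup>2))"
    using P.integrable_fst'[OF int] by simp
  have "integrable M (\<lambda>\<omega>. (norm (time_avg a b f \<omega>))\<^sup>2)"
    by (rule Bochner_Integration.integrable_bound[OF int']) (use le ab in \<open>auto elim!: eventually_mono\<close>)
  then show "time_avg a b f \<in> Lp_space M 2" by (simp add: Lp_space_2_iff)
  have "(LINT \<omega>|M. (norm (time_avg a b f \<omega>))\<^sup>2) \<le> (LINT \<omega>|M. (1 / (b - a)) * (LINT s|lborel. (norm (f (\<omega>, s)))\<^sup>2))"
    by (intro integral_mono_AE le int') fact
  also have "\<dots> = (1 / (b - a)) * (LINT x|with_time M. (norm (f x))\<^sup>2)"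
    using P.integral_fst'[OF int] by simp
  finally show "(LINT \<omega>|M. (norm (time_avg a b f \<omega>))\<^sup>2) \<le> (1 / (b - a)) * (LINT x|with_time M. (norm (f x))\<^sup>2)" .
qed

lemma measurable_lag [measurable]:
  fixes f :: "'a \<times> real \<Rightarrow> 'e::euclidean_space"
  assumes [measurable]: "f \<in> borel_measurable (with_time M)"
  shows "lag T u f \<in> borel_measurable (with_time M)"
  unfolding lag_def[abs_def] by measurable

lemma nn_integral_shift_time:
  assumes [measurable]: "g \<in> borel_measurable (with_time M)"
  shows "(\<integral>\<^sup>+x. g (fst x, snd x - (u::real)) \<partial>(with_time M)) = (\<integral>\<^sup>+x. g x \<partial>(with_time M))"
proof -
  have "(\<integral>\<^sup>+x. g (fst x, snd x - u) \<partial>(with_time M)) = (\<integral>\<^sup>+\<omega>. \<integral>\<^sup>+s. g (\<omega>, s - u) \<partial>lborel \<partial>M)"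
    by (subst lborel.nn_integral_fst[symmetric]) simp_all
  also have "\<dots> = (\<integral>\<^sup>+\<omega>. \<integral>\<^sup>+s. g (\<omega>, s) \<partial>lborel \<partial>M)"
  proof (rule nn_integral_cong)
    fix \<omega> assume "\<omega> \<in> space M"
    then have [measurable]: "(\<lambda>s. g (\<omega>, s)) \<in> borel_measurable borel"
      using measurable_compose_Pair1[OF _ assms] by simp
    show "(\<integral>\<^sup>+s. g (\<omega>, s - u) \<partial>lborel) = (\<integral>\<^sup>+s. g (\<omega>, s) \<partial>lborel)"
      by (subst (2) nn_integral_real_affine[where c = 1 and t = "- u"]) simp_all
  qed
  also have "\<dots> = (\<integral>\<^sup>+x. g x \<partial>(with_time M))"
    by (rule lborel.nn_integral_fst) simp
  finally show ?thesis .
qed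

lemma integrable_shift_time:
  fixes g :: "'a \<times> real \<Rightarrow> 'e::euclidean_space"
  assumes "integrable (with_time M) g"
  shows "integrable (with_time M) (\<lambda>x. g (fst x, snd x - u))"
proof -
  have [measurable]: "g \<in> borel_measurable (with_time M)" using assms by auto
  show ?thesis
    using assms nn_integral_shift_time[of "\<lambda>x. ennreal (norm (g x))" u]
    by (simp add: integrable_iff_bounded)
qed

lemma integral_shift_time:
  fixes g :: "'a \<times> real \<Rightarrow> real"
  assumes int: "integrable (with_time M) g" and nn: "\<And>x. g x \<ge> 0"
  shows "(LINT x|with_time M. g (fst x, snd x - u)) = (LINT x|with_time M. g x)"
proof -
  have [measurable]: "g \<in> borel_measurable (with_time M)" using assms by auto
  show ?thesis
    using nn nn_integral_shift_time[of "\<lambda>x. ennreal (g x)" u]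
    by (simp add: integral_eq_nn_integral)
qed

text \<open>Translation invariance of Lebesgue measure gives the shifted function the same integral
  as f, so the bound does not depend on u.\<close>

lemma lag_Lp:
  fixes f :: "'a \<times> real \<Rightarrow> 'e::euclidean_space"
  assumes f: "f \<in> Lp_space (with_time M) p" and p: "p \<ge> 0"
  shows "lag T u f \<in> Lp_space (with_time M) p"
    and "(LINT x|with_time M. norm (lag T u f x) powr p) \<le> 2 powr p * (2 * (LINT x|with_time M. norm (f x) powr p))"
proof -
  have [measurable]: "f \<in> borel_measurable (with_time M)" and int: "integrable (with_time M) (\<lambda>x. norm (f x) powr p)"
    using f by (auto simp: Lp_space_def)
  note int' = integrable_shift_time[OF int, of u]
  have le: "norm (lag T u f x) powr p \<le> 2 powr p * (norm (f x) powr p + norm (f (fst x, snd x - u)) powr p)" for x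
    using powr_norm_add_le[OF p, of "f x" "- f (fst x, snd x - u)"] by (auto simp: lag_def indicator_def)
  have i: "integrable (with_time M) (\<lambda>x. 2 powr p * (norm (f x) powr p + norm (f (fst x, snd x - u)) powr p))"
    using int int' by simp
  have il: "integrable (with_time M) (\<lambda>x. norm (lag T u f x) powr p)"
    by (rule Bochner_Integration.integrable_bound[OF i]) (use le in \<open>auto simp: abs_of_nonneg\<close>)
  then show "lag T u f \<in> Lp_space (with_time M) p" by (simp add: Lp_space_def)
  have "(LINT x|with_time M. norm (lag T u f x) powr p) \<le>
      (LINT x|with_time M. 2 powr p * (norm (f x) powr p + norm (f (fst x, snd x - u)) powr p))"
    by (intro integral_mono il i le)
  also have "\<dots> = 2 powr p * (2 * (LINT x|with_time M. norm (f x) powr p))"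
    using int int' integral_shift_time[OF int, of u] by simp
  finally show "(LINT x|with_time M. norm (lag T u f x) powr p) \<le>
      2 powr p * (2 * (LINT x|with_time M. norm (f x) powr p))" .
qed

lemma lag_L2:
  fixes f :: "'a \<times> real \<Rightarrow> 'e::euclidean_space"
  assumes f: "f \<in> Lp_space (with_time M) 2"
  shows "lag T u f \<in> Lp_space (with_time M) 2"
    and "(LINT x|with_time M. (norm (lag T u f x))\<^sup>2) \<le> 8 * (LINT x|with_time M. (norm (f x))\<^sup>2)"
  using lag_Lp[OF f, of T u] by simp_all

lemma time_cut_L2:
  fixes f :: "'a \<times> real \<Rightarrow> 'e::euclidean_space"
  assumes "f \<in> Lp_space (with_time M) 2"
  shows "time_cut a b f \<in> Lp_space (with_time M) 2"
proof -
  have [measurable]: "f \<in> borel_measurable (with_time M)" and int: "integrable (with_time M) (\<lambda>x. (norm (f x))\<^sup>2)"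
    using assms by (auto simp: Lp_space_2_iff)
  have "integrable (with_time M) (\<lambda>x. (norm (time_cut a b f x))\<^sup>2)"
    by (rule Bochner_Integration.integrable_bound[OF int])
      (auto simp: time_cut_def indicator_def)
  then show ?thesis by (auto simp: Lp_space_2_iff time_cut_def)
qed

text \<open>Integrating the bound of \<open>grid_avg_pointwise\<close> and exchanging the order of
  integration puts the lag outside. Each lag contributes at most \<eta>, the lags fill an interval
  of length \<open>2 * \<delta>\<close>, and the factor \<open>1 / \<delta>\<close> leaves
  \<open>2 * \<eta>\<close>.\<close>

lemma grid_avg_estimate:
  fixes f :: "'a \<times> real \<Rightarrow> real^'k^'m"
  assumes f: "f \<in> Lp_space (with_time M) 2" and \<delta>: "\<delta> > 0" and t: "real N * \<delta> = t" "t \<le> T"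
    and \<eta>: "\<And>u. 0 < u \<Longrightarrow> u \<le> 2 * \<delta> \<Longrightarrow> (LINT x|with_time M. (norm (lag T u f x))\<^sup>2) \<le> \<eta>"
    and p: "grid_process \<delta> N f \<in> Lp_space (with_time M) 2"
  shows "(LINT x|with_time M. (norm (grid_process \<delta> N f x - time_cut 0 t f x))\<^sup>2)
    \<le> (LINT x|with_time M. (norm (time_cut 0 \<delta> f x))\<^sup>2) + 2 * \<eta>"
proof -
  let ?P = "with_time M"
  interpret P: pair_sigma_finite M lborel ..
  interpret Q: pair_sigma_finite ?P lborel ..
  have [measurable]: "f \<in> borel_measurable ?P" and intf: "integrable ?P (\<lambda>x. (norm (f x))\<^sup>2)"
    using f by (auto simp: Lp_space_2_iff)
  note cutL2 = time_cut_L2[OF f, of 0]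
  have [measurable]: "time_cut 0 c f \<in> borel_measurable ?P" for c
    using cutL2 by (simp add: Lp_space_2_iff)
  let ?R = "grid_process \<delta> N f"
  have [measurable]: "?R \<in> borel_measurable ?P" using p by (simp only: Lp_space_2_iff)
  have "\<eta> \<ge> 0" using order_trans[OF _ \<eta>[of \<delta>]] \<delta> by simp
  \<comment> \<open>At time 0 the step process vanishes because its intervals are open on the left,
    while f need not; this time is discarded as a null set.\<close>
  have ae0: "AE x in ?P. snd x \<noteq> 0"
  proof (rule P.AE_pair_measure)
    show "{x \<in> space ?P. snd x \<noteq> 0} \<in> sets ?P" by measurable
    show "AE \<omega> in M. AE s in lborel. snd (\<omega>, s) \<noteq> 0"
      using AE_lborel_singleton[of 0] by simp
  qed
  have aef: "AE x in ?P. (\<lambda>s. f (fst x, s)) \<in> borel_measurable borel \<and> integrable lborel (\<lambda>s. (norm (f (fst x, s)))\<^sup>2)"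
    by (rule AE_fst_pair[OF AE_square_integrable[OF f]])
  have ptw: "AE x in ?P. ennreal ((norm (?R x - time_cut 0 t f x))\<^sup>2) \<le> ennreal ((norm (time_cut 0 \<delta> f x))\<^sup>2) +
    ennreal (1 / \<delta>) * (\<integral>\<^sup>+u. indicator {0..2 * \<delta>} u * ennreal ((norm (lag T u f x))\<^sup>2) \<partial>lborel)"
    using ae0 aef
  proof eventually_elim
    case (elim x)
    obtain \<omega> s where x: "x = (\<omega>, s)" by (cases x)
    show ?case
    proof (cases "0 < s \<and> s \<le> t")
      case True
      then have "time_cut 0 t f x = f (\<omega>, s)" by (simp add: x time_cut_def)
      then show ?thesis
        using grid_avg_pointwise[of f \<omega> \<delta> s N T] elim True \<delta> t by (simp add: x)
    next
      case False
      then have out: "s \<notin> {0..t}" using elim(1) by (auto simp: x)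
      have "s \<notin> {grid \<delta> i<..grid \<delta> (Suc i)}" if "i < N" for i
      proof -
        have "real (Suc i) * \<delta> \<le> real N * \<delta>" using that \<delta> by (intro mult_right_mono) auto
        moreover have "0 \<le> real i * \<delta>" using \<delta> by simp
        ultimately show ?thesis using out t by (auto simp: grid_def)
      qed
      then have "?R x = 0" by (auto simp: x process_of_eq intro!: sum.neutral)
      moreover have "time_cut 0 t f x = 0" using out by (simp add: x time_cut_def)
      ultimately show ?thesis by simp
    qed
  qed
  \<comment> \<open>The interval in \<open>lag\<close> moves with u, so joint measurability in time
    and lag has to be checked before the integrals are exchanged.\<close>
  have lagm: "(\<lambda>(x, u). indicator {0..2 * \<delta>} u * ennreal ((norm (lag T u f x))\<^sup>2)) \<in> borel_measurable (?P \<Otimes>\<^sub>M lborel)"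
  proof -
    have "(\<lambda>x. f (fst (fst x), snd (fst x) - snd x)) \<in> borel_measurable (?P \<Otimes>\<^sub>M lborel)"
      by measurable
    moreover have "(\<lambda>x. indicator {snd x..T} (snd (fst x)) :: real) \<in> borel_measurable (?P \<Otimes>\<^sub>M lborel)"
    proof -
      have "(\<lambda>x. indicator {snd x..T} (snd (fst x)) :: real) =
        (\<lambda>x::('a \<times> real) \<times> real. if snd x \<le> snd (fst x) \<and> snd (fst x) \<le> T then 1 else 0)"
        by (auto simp: fun_eq_iff indicator_def)
      then show ?thesis by simp
    qed
    ultimately show ?thesis unfolding lag_def[abs_def] case_prod_beta' by measurable
  qed
  have "(\<integral>\<^sup>+x. ennreal ((norm (?R x - time_cut 0 t f x))\<^sup>2) \<partial>?P) \<le>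
    (\<integral>\<^sup>+x. ennreal ((norm (time_cut 0 \<delta> f x))\<^sup>2) +
    ennreal (1 / \<delta>) * (\<integral>\<^sup>+u. indicator {0..2 * \<delta>} u * ennreal ((norm (lag T u f x))\<^sup>2) \<partial>lborel) \<partial>?P)"
    by (rule nn_integral_mono_AE[OF ptw])
  also have "\<dots> = (\<integral>\<^sup>+x. ennreal ((norm (time_cut 0 \<delta> f x))\<^sup>2) \<partial>?P) +
    ennreal (1 / \<delta>) * (\<integral>\<^sup>+x. (\<integral>\<^sup>+u. indicator {0..2 * \<delta>} u * ennreal ((norm (lag T u f x))\<^sup>2) \<partial>lborel) \<partial>?P)"
    using lborel.borel_measurable_nn_integral[OF lagm]
    by (subst nn_integral_add) (auto simp: nn_integral_cmult)
  also have "(\<integral>\<^sup>+x. (\<integral>\<^sup>+u. indicator {0..2 * \<delta>} u * ennreal ((norm (lag T u f x))\<^sup>2) \<partial>lborel) \<partial>?P)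
     = (\<integral>\<^sup>+u. (\<integral>\<^sup>+x. indicator {0..2 * \<delta>} u * ennreal ((norm (lag T u f x))\<^sup>2) \<partial>?P) \<partial>lborel)"
    by (rule Q.Fubini'[OF lagm, symmetric])
  also have "\<dots> \<le> (\<integral>\<^sup>+u. indicator {0..2 * \<delta>} u * ennreal \<eta> \<partial>lborel)"
  proof (rule nn_integral_mono_AE)
    \<comment> \<open>The bound \<eta> is assumed only for positive lags; the lag 0 is a null
      set.\<close>
    show "AE u in lborel. (\<integral>\<^sup>+x. indicator {0..2 * \<delta>} u * ennreal ((norm (lag T u f x))\<^sup>2) \<partial>?P) \<le> indicator {0..2 * \<delta>} u * ennreal \<eta>"
      using AE_lborel_singleton[of 0]
    proof eventually_elim
      case (elim u)
      show ?case
      proof (cases "u \<in> {0..2 * \<delta>}")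
        case True
        have "integrable ?P (\<lambda>x. (norm (lag T u f x))\<^sup>2)"
          using lag_L2(1)[OF f] by (simp add: Lp_space_2_iff)
        then have "(\<integral>\<^sup>+x. ennreal ((norm (lag T u f x))\<^sup>2) \<partial>?P) \<le> ennreal \<eta>"
          using \<eta>[of u] True elim by (subst nn_integral_eq_integral) (auto intro!: ennreal_leI)
        then show ?thesis using True by simp
      qed simp
    qed
  qed
  also have "\<dots> = ennreal (2 * \<delta>) * ennreal \<eta>"
    using \<delta> by (subst nn_integral_multc) auto
  finally have le: "(\<integral>\<^sup>+x. ennreal ((norm (?R x - time_cut 0 t f x))\<^sup>2) \<partial>?P) \<le>
    (\<integral>\<^sup>+x. ennreal ((norm (time_cut 0 \<delta> f x))\<^sup>2) \<partial>?P) + ennreal (1 / \<delta>) * (ennreal (2 * \<delta>) * ennreal \<eta>)"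
    by (simp add: mult_left_mono add_left_mono)
  have "integrable ?P (\<lambda>x. (norm (?R x - time_cut 0 t f x))\<^sup>2)"
    using Lp_space_diff[OF p cutL2[of t]] by (simp add: Lp_space_2_iff)
  moreover have ic: "integrable ?P (\<lambda>x. (norm (time_cut 0 \<delta> f x))\<^sup>2)"
    using cutL2[of \<delta>] by (simp add: Lp_space_2_iff)
  ultimately have "ennreal (LINT x|?P. (norm (?R x - time_cut 0 t f x))\<^sup>2) \<le>
    ennreal (LINT x|?P. (norm (time_cut 0 \<delta> f x))\<^sup>2) + ennreal (1 / \<delta>) * (ennreal (2 * \<delta>) * ennreal \<eta>)"
    using le by (simp add: nn_integral_eq_integral)
  also have "\<dots> = ennreal ((LINT x|?P. (norm (time_cut 0 \<delta> f x))\<^sup>2) + 2 * \<eta>)"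
    using \<delta> \<open>\<eta> \<ge> 0\<close> by (simp add: ennreal_mult[symmetric] ennreal_plus[symmetric] del: ennreal_plus)
  finally show ?thesis
    using \<open>\<eta> \<ge> 0\<close> by (subst (asm) ennreal_le_iff) auto
qed

end

section \<open>Predictable processes\<close>

text \<open>Predictable processes are progressively measurable. It suffices to test generating
  rectangles: after the cut at s, one that starts at a time u up to s has its base in
  \<open>F u\<close>, hence in \<open>F s\<close>, and one that starts later disappears.\<close>

lemma (in filtered_prob_space) predictable_time_cut:
  fixes V :: "real \<Rightarrow> 'a \<Rightarrow> 'e::real_normed_vector"
  assumes V: "predictable M F T V" and s: "s \<in> {0..T}"
  shows "time_cut 0 s (\<lambda>(\<omega>, r). V r \<omega>) \<in> borel_measurable (F s \<Otimes>\<^sub>M lborel)"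
proof -
  have sp: "space (F r) = space M" if "r \<in> {0..T}" for r
    using subalgebra_F[OF that] by (simp add: subalgebra_def)
  let ?R = "restrict_space (F s \<Otimes>\<^sub>M lborel) (space M \<times> {0..s})"
  have slab: "space M \<times> {0..s} \<in> sets (F s \<Otimes>\<^sub>M lborel)"
    using sets.top[of "F s"] sp[OF s] by (intro pair_measureI) auto
  then have slab': "(space M \<times> {0..s}) \<inter> space (F s \<Otimes>\<^sub>M lborel) \<in> sets (F s \<Otimes>\<^sub>M lborel)"
    by (intro sets.Int sets.top)
  have spR: "space ?R = space M \<times> {0..s}"
    using sp[OF s] by (auto simp: space_restrict_space space_pair_measure)
  have "(\<lambda>x. x) \<in> ?R \<rightarrow>\<^sub>M predictable_sigma M F T"
    unfolding predictable_sigma_def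
  proof (rule measurable_measure_of)
    have "A \<subseteq> space M" if "A \<in> sets (F r)" "r \<in> {0..T}" for A r
      using sets.sets_into_space[OF that(1)] sp[OF that(2)] by simp
    then show "{A \<times> {0} |A. A \<in> sets (F 0)} \<union> {A \<times> {s<..t} |A s t. 0 \<le> s \<and> s < t \<and> t \<le> T \<and> A \<in> sets (F s)}
        \<subseteq> Pow (space M \<times> {0..T})"
      using s by fastforce
    show "(\<lambda>x. x) \<in> space ?R \<rightarrow> space M \<times> {0..T}"
      unfolding spR using s by auto
    fix Y assume Y: "Y \<in> {A \<times> {0} |A. A \<in> sets (F 0)} \<union>
      {A \<times> {s<..t} |A s t. 0 \<le> s \<and> s < t \<and> t \<le> T \<and> A \<in> sets (F s)}"
    have "\<exists>Z\<in>sets (F s \<Otimes>\<^sub>M lborel). Y \<inter> (space M \<times> {0..s}) = Z \<inter> (space M \<times> {0..s})"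
      using Y
    proof
      assume "Y \<in> {A \<times> {0} |A. A \<in> sets (F 0)}"
      then obtain A where "Y = A \<times> {0}" "A \<in> sets (F 0)" by auto
      then show ?thesis
        using sets_F_mono[of 0 s] s by (intro bexI[of _ Y]) (auto intro!: pair_measureI)
    next
      assume "Y \<in> {A \<times> {s<..t} |A s t. 0 \<le> s \<and> s < t \<and> t \<le> T \<and> A \<in> sets (F s)}"
      then obtain A u v where A: "Y = A \<times> {u<..v}" "0 \<le> u" "A \<in> sets (F u)" by auto
      show ?thesis
      proof (cases "u \<le> s")
        case True
        then show ?thesis
          using A sets_F_mono[of u s] s by (intro bexI[of _ Y]) (auto intro!: pair_measureI)
      next
        case False
        then show ?thesis using A by (intro bexI[of _ "{}"]) auto
      qed
    qed
    then show "(\<lambda>x. x) -` Y \<inter> space ?R \<in> sets ?R"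
      unfolding spR by (auto simp: sets_restrict_space)
  qed
  from measurable_compose[OF this V[unfolded predictable_def]]
  have "(\<lambda>x. indicator (space M \<times> {0..s}) x *\<^sub>R (\<lambda>(\<omega>, r). V r \<omega>) x) \<in> borel_measurable (F s \<Otimes>\<^sub>M lborel)"
    unfolding borel_measurable_restrict_space_iff[OF slab'] .
  then show ?thesis
    unfolding time_cut_def
    by (rule measurable_cong[THEN iffD1, rotated])
      (auto simp: space_pair_measure sp[OF s] indicator_def)
qed

text \<open>The pointwise part of \<open>dual_pairing\<close>, split off so that the results on
  bounded linear maps apply to it.\<close>

definition entrywise :: "('x::real_normed_vector \<Rightarrow>\<^sub>L real) \<Rightarrow> 'x ^ 'k ^ 'm \<Rightarrow> real ^ 'k ^ 'm" where
  "entrywise \<beta> v = (\<chi> i j. blinfun_apply \<beta> (v $ i $ j))"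

text \<open>The map is a finite sum, over the matrix units \<open>axis a (axis b 1)\<close>, of
  compositions of bounded linear maps.\<close>

lemma bounded_linear_entrywise: "bounded_linear (entrywise \<beta> :: 'x::real_normed_vector ^ 'k ^ 'm \<Rightarrow> _)"
proof -
  have "entrywise \<beta> v $ i $ j =
      (\<Sum>a\<in>UNIV. \<Sum>b\<in>UNIV. blinfun_apply \<beta> (v $ a $ b) *\<^sub>R axis a (axis b 1)) $ i $ j"
    for v :: "'x ^ 'k ^ 'm" and i j
  proof -
    have "(\<Sum>a\<in>UNIV. \<Sum>b\<in>UNIV. blinfun_apply \<beta> (v $ a $ b) *\<^sub>R axis a (axis b 1)) $ i $ j
        = (\<Sum>a\<in>UNIV. \<Sum>b\<in>UNIV. if a = i then if b = j then blinfun_apply \<beta> (v $ a $ b) else 0 else 0)"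
      unfolding sum_component by (intro sum.cong refl) (auto simp: axis_def)
    also have "\<dots> = (\<Sum>a\<in>UNIV. if a = i then blinfun_apply \<beta> (v $ a $ j) else 0)"
      by (intro sum.cong refl) auto
    also have "\<dots> = entrywise \<beta> v $ i $ j" by (simp add: entrywise_def)
    finally show ?thesis ..
  qed
  then have "entrywise \<beta> = (\<lambda>v::'x ^ 'k ^ 'm. \<Sum>a\<in>UNIV. \<Sum>b\<in>UNIV. blinfun_apply \<beta> (v $ a $ b) *\<^sub>R axis a (axis b 1))"
    unfolding fun_eq_iff vec_eq_iff by blast
  moreover have "bounded_linear (\<lambda>v::'x ^ 'k ^ 'm. \<Sum>a\<in>UNIV. \<Sum>b\<in>UNIV.
      blinfun_apply \<beta> (v $ a $ b) *\<^sub>R axis a (axis b 1))"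
    by (intro bounded_linear_sum bounded_linear_compose[OF bounded_linear_scaleR_left]
        bounded_linear_compose[OF blinfun.bounded_linear_right]
        bounded_linear_compose[OF bounded_linear_vec_nth bounded_linear_vec_nth])
  ultimately show ?thesis by simp
qed

lemma predictable_dual_pairing:
  assumes "predictable M F T V"
  shows "predictable M F T (dual_pairing \<beta> V)"
proof -
  have "entrywise \<beta> \<in> borel_measurable borel"
    by (intro borel_measurable_continuous_onI linear_continuous_on bounded_linear_entrywise)
  from measurable_compose[OF assms[unfolded predictable_def] this] show ?thesis
    by (simp add: predictable_def dual_pairing_def entrywise_def case_prod_beta')
qed

section \<open>Uniform smallness of lags\<close>

text \<open>The exponent is strictly negative, so the power tends to 0 at infinity. The levels K and
  L of the splits in the limit arguments are chosen with this.\<close>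

lemma powr_small:
  fixes p A e :: real
  assumes "p > 2" "e > 0"
  obtains K where "K > 0" "K powr (2 - p) * A \<le> e"
proof -
  have "((\<lambda>K. K powr (2 - p) * A) \<longlongrightarrow> 0 * A) at_top"
    using assms by (intro tendsto_intros tendsto_neg_powr filterlim_ident) auto
  then have "eventually (\<lambda>K. K powr (2 - p) * A < e) at_top"
    using assms by (intro order_tendstoD) auto
  then obtain K where "K > 0" "K powr (2 - p) * A < e"
    using eventually_conj[OF _ eventually_gt_at_top[of 0]]
    by (metis (mono_tags, lifting) eventually_at_top_linorder order_refl)
  then show ?thesis using that by auto
qed

context prob_space
begin

lemma integrable_slab: "integrable (with_time M) (\<lambda>x. indicator {a..b::real} (snd x) :: real)"
  and integral_slab: "a \<le> b \<Longrightarrow> (LINT x|with_time M. indicator {a..b} (snd x)) = b - a"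
proof -
  have I: "integrable lborel (indicator {a..b} :: real \<Rightarrow> real)"
    by (intro integrable_real_indicator) (auto simp: emeasure_lborel_Icc_eq)
  show "integrable (with_time M) (\<lambda>x. indicator {a..b::real} (snd x) :: real)"
    using integrable_pair_mult(1)[OF integrable_const I, of 1] by simp
  show "a \<le> b \<Longrightarrow> (LINT x|with_time M. indicator {a..b} (snd x)) = b - a"
    using integrable_pair_mult(2)[OF integrable_const I, of 1] by (simp add: prob_space)
qed

lemma lag_integrable:
  fixes f :: "'a \<times> real \<Rightarrow> 'e::euclidean_space"
  assumes f: "f \<in> Lp_space (with_time M) 2"
  shows "integrable (with_time M) (\<lambda>x. norm (lag T u f x))"
proof (rule Bochner_Integration.integrable_bound)
  show "integrable (with_time M) (\<lambda>x. indicator {u..T} (snd x) + (norm (lag T u f x))\<^sup>2)"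
    using lag_L2(1)[OF f] by (intro Bochner_Integration.integrable_add integrable_slab) (simp add: Lp_space_2_iff)
  have *: "y \<le> 1 + y\<^sup>2" for y :: real
    using zero_le_power2[of "y - 1"] zero_le_power2[of y] by (simp add: power2_diff) (smt (verit) zero_le_power2)
  show "AE x in with_time M. norm (norm (lag T u f x)) \<le> norm (indicator {u..T} (snd x) + (norm (lag T u f x))\<^sup>2)"
    by (rule AE_I2) (use * in \<open>auto simp: lag_def indicator_def abs_of_nonneg add_nonneg_nonneg\<close>)
qed (use f in \<open>auto simp: Lp_space_2_iff\<close>)

text \<open>For t in \<open>{h..T}\<close> both t and \<open>t - h\<close> lie in
  \<open>{0..T}\<close>, so the extension by zero is invisible and Fubini identifies the two
  sides.\<close>

lemma lag_time_cut_integral: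
  fixes \<Phi> :: "real \<Rightarrow> 'a \<Rightarrow> 'e::euclidean_space" and T :: real
  defines "f \<equiv> time_cut 0 T (\<lambda>(\<omega>, s). \<Phi> s \<omega>)"
  assumes f: "f \<in> Lp_space (with_time M) 2" and h: "h \<ge> 0"
  shows "(LINT \<omega>|M. (LBINT t:{h..T}. norm (\<Phi> t \<omega> - \<Phi> (t - h) \<omega>))) = (LINT x|with_time M. norm (lag T h f x))"
proof -
  interpret P: pair_sigma_finite M lborel ..
  have "(LINT x|with_time M. norm (lag T h f x)) = (LINT \<omega>|M. (LINT t|lborel. norm (lag T h f (\<omega>, t))))"
    by (rule P.integral_fst'[OF lag_integrable[OF f], symmetric])
  also have "\<dots> = (LINT \<omega>|M. (LBINT t:{h..T}. norm (\<Phi> t \<omega> - \<Phi> (t - h) \<omega>)))"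
    unfolding set_lebesgue_integral_def
    by (intro Bochner_Integration.integral_cong refl)
      (use h in \<open>auto simp: lag_def f_def time_cut_def indicator_def\<close>)
  finally show ?thesis ..
qed

text \<open>In the level split the first power is small by hypothesis and the p-th power only
  bounded. Hence K is fixed first, from the bound \<open>2 powr p * (2 * C)\<close> of
  \<open>lag_Lp\<close>, and u0 afterwards, so that K times the integral of the norm is at most
  \<open>e / 2\<close>.\<close>

lemma lag_square_small:
  fixes f :: "nat \<Rightarrow> 'a \<times> real \<Rightarrow> 'e::euclidean_space"
  assumes p: "p > 2" and L2: "\<And>n. f n \<in> Lp_space (with_time M) 2"
    and Lp: "\<And>n. f n \<in> Lp_space (with_time M) p"
    and C: "\<And>n. (LINT x|with_time M. norm (f n x) powr p) \<le> C"
    and small: "uniform_limit UNIV (\<lambda>h n. LINT x|with_time M. norm (lag T h (f n) x)) (\<lambda>n. 0) (at_right 0)"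
    and e: "e > 0"
  obtains u0 where "u0 > 0"
    "\<And>u n. 0 < u \<Longrightarrow> u < u0 \<Longrightarrow> (LINT x|with_time M. (norm (lag T u (f n) x))\<^sup>2) \<le> e"
proof -
  obtain K where K: "K > 0" "K powr (2 - p) * (2 powr p * (2 * C)) \<le> e / 2"
    using powr_small[OF p, of "e / 2" "2 powr p * (2 * C)"] e by auto
  have "eventually (\<lambda>h. \<forall>n\<in>UNIV. dist (LINT x|with_time M. norm (lag T h (f n) x)) 0 < e / (2 * K)) (at_right 0)"
    using small K e unfolding uniform_limit_iff by (auto dest!: spec[of _ "e / (2 * K)"])
  then obtain u0 where u0: "u0 > 0"
    "\<And>h n. 0 < h \<Longrightarrow> h < u0 \<Longrightarrow> dist (LINT x|with_time M. norm (lag T h (f n) x)) 0 < e / (2 * K)"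
    unfolding eventually_at_right_field by auto
  show ?thesis
  proof (rule that[OF u0(1)])
    fix u n assume u: "0 < u" "u < u0"
    let ?P = "with_time M"
    note i1 = lag_integrable[OF L2[of n], of T u]
    have i2: "integrable ?P (\<lambda>x. norm (lag T u (f n) x) powr p)"
      using lag_Lp(1)[OF Lp[of n]] p by (simp add: Lp_space_def)
    have "(LINT x|?P. (norm (lag T u (f n) x))\<^sup>2) \<le>
        (LINT x|?P. K * norm (lag T u (f n) x) + K powr (2 - p) * norm (lag T u (f n) x) powr p)"
      using lag_L2(1)[OF L2[of n], of T u] i1 i2 K p
      by (intro integral_mono square_le_linear_plus_powr) (auto simp: Lp_space_2_iff)
    also have "\<dots> = K * (LINT x|?P. norm (lag T u (f n) x)) + K powr (2 - p) * (LINT x|?P. norm (lag T u (f n) x) powr p)"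
      using i1 i2 by simp
    also have "\<dots> \<le> e / 2 + e / 2"
    proof (rule add_mono)
      have "(LINT x|?P. norm (lag T u (f n) x)) \<le> e / (2 * K)"
        using u0(2)[OF u, of n] by (simp add: dist_real_def)
      then show "K * (LINT x|?P. norm (lag T u (f n) x)) \<le> e / 2"
        using K by (simp add: field_simps)
      have "(LINT x|?P. norm (lag T u (f n) x) powr p) \<le> 2 powr p * (2 * C)"
        using lag_Lp(2)[OF Lp[of n], of T u] C[of n] p
        by (smt (verit) mult_left_mono powr_ge_zero)
      then show "K powr (2 - p) * (LINT x|?P. norm (lag T u (f n) x) powr p) \<le> e / 2"
        using K(2) by (smt (verit) mult_left_mono powr_ge_zero)
    qed
    finally show "(LINT x|?P. (norm (lag T u (f n) x))\<^sup>2) \<le> e" by simp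
  qed
qed

text \<open>Weak lower semicontinuity: test the weak convergence with the lag of the limit.\<close>

lemma lag_square_weak_limit:
  fixes f :: "nat \<Rightarrow> 'a \<times> real \<Rightarrow> 'e::euclidean_space"
  assumes conv: "Lp_converges_weakly (with_time M) 2 f g"
    and le: "\<And>n. (LINT x|with_time M. (norm (lag T u (f n) x))\<^sup>2) \<le> e"
  shows "(LINT x|with_time M. (norm (lag T u g x))\<^sup>2) \<le> e"
proof -
  let ?P = "with_time M"
  have f: "f n \<in> Lp_space ?P 2" and g: "g \<in> Lp_space ?P 2" for n
    using conv by (auto simp: Lp_converges_weakly_def)
  let ?G = "LINT x|?P. (norm (lag T u g x))\<^sup>2"
  define \<phi> where "\<phi> v = (LINT x|?P. lag T u g x \<bullet> lag T u v x)" for v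
  have i2: "integrable ?P (\<lambda>x. (norm (lag T u v x))\<^sup>2)" if "v \<in> Lp_space ?P 2" for v :: "'a \<times> real \<Rightarrow> 'e"
    using lag_L2(1)[OF that] by (simp add: Lp_space_2_iff)
  have int: "integrable ?P (\<lambda>x. lag T u g x \<bullet> lag T u v x)" if "v \<in> Lp_space ?P 2" for v
    by (intro integrable_inner_L2 lag_L2(1) g that)
  have le2: "\<bar>a \<bullet> b\<bar> \<le> ((norm a)\<^sup>2 + (norm b)\<^sup>2) / 2" for a b :: 'e
    using Cauchy_Schwarz_ineq2[of a b] sum_squares_bound[of "norm a" "norm b"] by simp
  have bound: "\<bar>\<phi> v\<bar> \<le> (?G + (LINT x|?P. (norm (lag T u v x))\<^sup>2)) / 2" if v: "v \<in> Lp_space ?P 2" for v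
  proof -
    have "\<bar>\<phi> v\<bar> \<le> (LINT x|?P. ((norm (lag T u g x))\<^sup>2 + (norm (lag T u v x))\<^sup>2) / 2)"
      unfolding \<phi>_def
      by (rule order_trans[OF integral_abs_bound], rule integral_mono)
        (use int[OF v] i2[OF g] i2[OF v] le2 in auto)
    also have "\<dots> = (?G + (LINT x|?P. (norm (lag T u v x))\<^sup>2)) / 2"
      using i2[OF g] i2[OF v] by simp
    finally show ?thesis .
  qed
  have "\<phi> \<in> Lp_dual ?P 2"
  proof (rule Lp_dualI[where C = "(?G + 8) / 2"])
    fix v w :: "'a \<times> real \<Rightarrow> 'e" assume "v \<in> Lp_space ?P 2" "w \<in> Lp_space ?P 2"
    moreover have "lag T u (\<lambda>x. v x + w x) x = lag T u v x + lag T u w x" for x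
      by (simp add: lag_def algebra_simps)
    ultimately show "\<phi> (\<lambda>x. v x + w x) = \<phi> v + \<phi> w"
      using int by (simp add: \<phi>_def inner_add_right)
  next
    fix c and v :: "'a \<times> real \<Rightarrow> 'e" assume "v \<in> Lp_space ?P 2"
    have "lag T u (\<lambda>x. c *\<^sub>R v x) x = c *\<^sub>R lag T u v x" for x
      by (simp add: lag_def algebra_simps)
    then show "\<phi> (\<lambda>x. c *\<^sub>R v x) = c * \<phi> v" by (simp add: \<phi>_def)
  next
    fix v :: "'a \<times> real \<Rightarrow> 'e" assume v: "v \<in> Lp_space ?P 2" "(LINT x|?P. norm (v x) powr 2) \<le> 1"
    then show "\<bar>\<phi> v\<bar> \<le> (?G + 8) / 2"
      using bound[OF v(1)] lag_L2(2)[OF v(1), of T u] by simp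
  qed simp
  then have "(\<lambda>n. \<phi> (f n)) \<longlonglongrightarrow> \<phi> g"
    using conv by (simp add: Lp_converges_weakly_def)
  moreover have "\<phi> (f n) \<le> (?G + e) / 2" for n
    using bound[OF f[of n]] le[of n] by simp
  \<comment> \<open>The bound by the mean of two squares is enough in place of Cauchy-Schwarz: since
    \<open>\<phi> g = ?G\<close>, half of \<open>?G\<close> is absorbed on the left and
    \<open>?G \<le> e\<close> remains.\<close>
  ultimately have "\<phi> g \<le> (?G + e) / 2"
    using LIMSEQ_le_const2 by blast
  moreover have "\<phi> g = ?G" by (simp add: \<phi>_def power2_norm_eq_inner)
  ultimately show ?thesis by simp
qed

text \<open>This controls the first grid interval, where no preceding average exists. With K chosen
  large first and \<delta> small afterwards, the bound is small uniformly over families bounded in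
  Lp.\<close>

lemma time_cut_square_le:
  fixes f :: "'a \<times> real \<Rightarrow> 'e::euclidean_space"
  assumes L2: "f \<in> Lp_space (with_time M) 2" and Lp: "f \<in> Lp_space (with_time M) p"
    and "p \<ge> 2" "K > 0" "\<delta> \<ge> 0"
  shows "(LINT x|with_time M. (norm (time_cut 0 \<delta> f x))\<^sup>2) \<le>
    K\<^sup>2 * \<delta> + K powr (2 - p) * (LINT x|with_time M. norm (f x) powr p)"
proof -
  let ?P = "with_time M"
  have [measurable]: "f \<in> borel_measurable ?P" and i2: "integrable ?P (\<lambda>x. (norm (f x))\<^sup>2)"
    and ip: "integrable ?P (\<lambda>x. norm (f x) powr p)"
    using L2 Lp by (auto simp: Lp_space_2_iff Lp_space_def[of _ p])
  have i: "integrable ?P (\<lambda>x. (norm (time_cut 0 \<delta> f x))\<^sup>2)"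
    by (rule Bochner_Integration.integrable_bound[OF i2]) (auto simp: time_cut_def indicator_def)
  have "(LINT x|?P. (norm (time_cut 0 \<delta> f x))\<^sup>2) \<le>
      (LINT x|?P. K\<^sup>2 * indicator {0..\<delta>} (snd x) + K powr (2 - p) * norm (f x) powr p)"
    using square_le_const_plus_powr[OF norm_ge_zero assms(4,3)] ip
    by (intro integral_mono i Bochner_Integration.integrable_add integrable_mult_right integrable_slab)
      (auto simp: time_cut_def indicator_def)
  also have "\<dots> = K\<^sup>2 * \<delta> + K powr (2 - p) * (LINT x|?P. norm (f x) powr p)"
    using ip integral_slab[of 0 \<delta>] \<open>\<delta> \<ge> 0\<close> integrable_slab[of 0 \<delta>] by simp
  finally show ?thesis .
qed

end

section \<open>Passing to the limit in step integrals\<close>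

text \<open>Nearest point projection onto the ball rather than a cutoff to zero: continuity is
  needed to carry the convergence of the increments over to their truncations.\<close>

definition truncate :: "real \<Rightarrow> 'e::euclidean_space \<Rightarrow> 'e" where
  "truncate K = closest_point (cball 0 K)"

lemma truncate:
  fixes x :: "'e::euclidean_space"
  assumes "K \<ge> 0"
  shows norm_truncate_le: "norm (truncate K x) \<le> K"
    and truncate_ident: "norm x \<le> K \<Longrightarrow> truncate K x = x"
    and norm_diff_truncate_le: "norm (x - truncate K x) \<le> norm x"
    and continuous_truncate: "continuous_on UNIV (truncate K :: 'e \<Rightarrow> 'e)"
proof -
  have ne: "closed (cball (0::'e) K)" "convex (cball (0::'e) K)" "cball (0::'e) K \<noteq> {}"
    using assms by auto
  show "norm (truncate K x) \<le> K"
    using closest_point_in_set[OF ne(1,3), of x] by (simp add: truncate_def)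
  show "norm x \<le> K \<Longrightarrow> truncate K x = x"
    by (simp add: truncate_def closest_point_self)
  show "norm (x - truncate K x) \<le> norm x"
    using closest_point_le[OF ne(1), of 0 x] assms by (simp add: truncate_def dist_norm)
  show "continuous_on UNIV (truncate K :: 'e \<Rightarrow> 'e)"
    unfolding truncate_def by (intro continuous_on_closest_point ne(2,1,3))
qed

lemma measurable_truncate [measurable]: "K \<ge> 0 \<Longrightarrow> truncate K \<in> borel_measurable borel"
  by (intro borel_measurable_continuous_onI continuous_truncate)

context prob_space
begin

text \<open>
  A random weight that is bounded and small in $L^2$ makes averages of an $L^p$-bounded family
  small in $L^2$; this is where $p > 2$ enters.
\<close>

lemma weighted_time_avg_le:
  fixes f :: "'a \<times> real \<Rightarrow> 'e::euclidean_space" and d :: "'a \<Rightarrow> real"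
  assumes L2: "f \<in> Lp_space (with_time M) 2" and Lp: "f \<in> Lp_space (with_time M) p"
    and p: "p \<ge> 2" and L: "L > 0" and ab: "a < b"
    and d: "d \<in> borel_measurable M" "\<And>\<omega>. 0 \<le> d \<omega>" "\<And>\<omega>. d \<omega> \<le> K"
  shows "(LINT \<omega>|M. (norm (time_avg a b f \<omega>) * d \<omega>)\<^sup>2) \<le>
    L\<^sup>2 * (LINT \<omega>|M. (d \<omega>)\<^sup>2) + L powr (2 - p) * (K\<^sup>2 / (b - a) * (LINT x|with_time M. norm (f x) powr p))"
proof -
  interpret P: pair_sigma_finite M lborel ..
  have ip: "integrable (with_time M) (\<lambda>x. norm (f x) powr p)"
    using Lp by (simp add: Lp_space_def)
  define R where "R \<omega> = (LINT s|lborel. norm (f (\<omega>, s)) powr p)" for \<omega>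
  have R: "integrable M R" unfolding R_def by (rule P.integrable_fst'[OF ip])
  have avg: "AE \<omega> in M. (norm (time_avg a b f \<omega>))\<^sup>2 \<le> L\<^sup>2 + L powr (2 - p) / (b - a) * R \<omega>"
    using time_avg_square_le[OF L2 ab] AE_square_integrable[OF L2] P.AE_integrable_fst'[OF ip]
  proof eventually_elim
    case (elim \<omega>)
    have I: "integrable lborel (indicator {a..b} :: real \<Rightarrow> real)"
      by (intro integrable_real_indicator) (auto simp: emeasure_lborel_Icc_eq)
    have "(LINT s|lborel. indicator {a..b} s * (norm (f (\<omega>, s)))\<^sup>2) \<le>
        (LINT s|lborel. L\<^sup>2 * indicator {a..b} s + L powr (2 - p) * norm (f (\<omega>, s)) powr p)"
    proof (rule integral_mono)
      show "integrable lborel (\<lambda>s. indicator {a..b} s * (norm (f (\<omega>, s)))\<^sup>2)"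
        using elim(2) integrable_mult_indicator[of "{a..b}" lborel "\<lambda>s. (norm (f (\<omega>, s)))\<^sup>2"] by simp
      show "integrable lborel (\<lambda>s. L\<^sup>2 * indicator {a..b} s + L powr (2 - p) * norm (f (\<omega>, s)) powr p)"
        by (intro Bochner_Integration.integrable_add integrable_mult_right I elim(3))
      show "indicator {a..b} s * (norm (f (\<omega>, s)))\<^sup>2 \<le> L\<^sup>2 * indicator {a..b} s + L powr (2 - p) * norm (f (\<omega>, s)) powr p" for s
        using square_le_const_plus_powr[OF norm_ge_zero L p, of "f (\<omega>, s)"] by (auto simp: indicator_def)
    qed
    also have "\<dots> = L\<^sup>2 * (b - a) + L powr (2 - p) * R \<omega>"
      using elim(3) I ab by (simp add: R_def)
    finally have "(1 / (b - a)) * (LINT s|lborel. indicator {a..b} s * (norm (f (\<omega>, s)))\<^sup>2) \<le>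
        (1 / (b - a)) * (L\<^sup>2 * (b - a) + L powr (2 - p) * R \<omega>)"
      using ab by (intro mult_left_mono) auto
    also have "\<dots> = L\<^sup>2 + L powr (2 - p) / (b - a) * R \<omega>"
      using ab by (simp add: field_simps)
    finally show ?case using elim(1) by linarith
  qed
  have "K \<ge> 0" using d(2,3) by (meson order_trans)
  have dK: "(d \<omega>)\<^sup>2 \<le> K\<^sup>2" for \<omega> using d by (intro power_mono)
  have id: "integrable M (\<lambda>\<omega>. (d \<omega>)\<^sup>2)"
    by (rule integrable_const_bound[of _ "K\<^sup>2"]) (use d dK in auto)
  have R0: "R \<omega> \<ge> 0" for \<omega> unfolding R_def by simp
  have le: "AE \<omega> in M. (norm (time_avg a b f \<omega>) * d \<omega>)\<^sup>2 \<le> L\<^sup>2 * (d \<omega>)\<^sup>2 + (L powr (2 - p) / (b - a) * K\<^sup>2) * R \<omega>"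
    using avg
  proof eventually_elim
    case (elim \<omega>)
    have "(norm (time_avg a b f \<omega>) * d \<omega>)\<^sup>2 \<le> (L\<^sup>2 + L powr (2 - p) / (b - a) * R \<omega>) * (d \<omega>)\<^sup>2"
      unfolding power_mult_distrib using elim by (intro mult_right_mono) auto
    \<comment> \<open>The weight is kept next to the constant, where its L2 smallness counts, and
      replaced by its bound K next to R, where the factor \<open>L powr (2 - p)\<close> provides the
      smallness.\<close>
    also have "\<dots> \<le> L\<^sup>2 * (d \<omega>)\<^sup>2 + (L powr (2 - p) / (b - a) * R \<omega>) * K\<^sup>2"
      unfolding distrib_right using dK R0 ab by (intro add_left_mono mult_left_mono) auto
    finally show ?case by (simp add: mult_ac)
  qed
  have ir: "integrable M (\<lambda>\<omega>. L\<^sup>2 * (d \<omega>)\<^sup>2 + (L powr (2 - p) / (b - a) * K\<^sup>2) * R \<omega>)"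
    using id R by simp
  have "time_avg a b f \<in> borel_measurable M" using time_avg_L2(1)[OF L2 ab] by (simp add: Lp_space_2_iff)
  then have "integrable M (\<lambda>\<omega>. (norm (time_avg a b f \<omega>) * d \<omega>)\<^sup>2)"
    using d(1) by (intro Bochner_Integration.integrable_bound[OF ir])
      (auto intro!: eventually_mono[OF le] elim: order_trans)
  then have "(LINT \<omega>|M. (norm (time_avg a b f \<omega>) * d \<omega>)\<^sup>2) \<le>
      (LINT \<omega>|M. L\<^sup>2 * (d \<omega>)\<^sup>2 + (L powr (2 - p) / (b - a) * K\<^sup>2) * R \<omega>)"
    by (intro integral_mono_AE ir le)
  also have "\<dots> = L\<^sup>2 * (LINT \<omega>|M. (d \<omega>)\<^sup>2) + L powr (2 - p) * (K\<^sup>2 / (b - a) * (LINT \<omega>|M. R \<omega>))"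
    using id R by simp
  also have "(LINT \<omega>|M. R \<omega>) = (LINT x|with_time M. norm (f x) powr p)"
    unfolding R_def by (rule P.integral_fst'[OF ip])
  finally show ?thesis .
qed

text \<open>Off a null set both paths are square integrable, so both time integrals exist; elsewhere
  a default value may spoil additivity.\<close>

lemma time_avg_add_AE:
  fixes f g :: "'a \<times> real \<Rightarrow> 'e::euclidean_space"
  assumes "f \<in> Lp_space (with_time M) 2" "g \<in> Lp_space (with_time M) 2"
  shows "AE \<omega> in M. time_avg a b (\<lambda>x. f x + g x) \<omega> = time_avg a b f \<omega> + time_avg a b g \<omega>"
  using AE_square_integrable[OF assms(1)] AE_square_integrable[OF assms(2)]
  by eventually_elim
    (simp add: time_avg_def scaleR_add_right integrable_of_square_integrable Bochner_Integration.integral_add)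

lemma time_avg_scaleR: "time_avg a b (\<lambda>x. c *\<^sub>R f x) \<omega> = c *\<^sub>R time_avg a b f \<omega>"
  by (simp only: time_avg_def scaleR_left_commute[of _ c] integral_scaleR_right)

lemma bounded_weight_L2:
  fixes \<xi> :: "'a \<Rightarrow> real^'k^'m" and Z :: "'a \<Rightarrow> real^'k"
  assumes \<xi>: "\<xi> \<in> Lp_space M 2" and Z: "Z \<in> borel_measurable M" "\<And>\<omega>. norm (Z \<omega>) \<le> K"
  shows "(\<lambda>\<omega>. \<xi> \<omega> *v Z \<omega>) \<in> Lp_space M 2"
    and "(LINT \<omega>|M. (norm (\<xi> \<omega> *v Z \<omega>))\<^sup>2) \<le> K\<^sup>2 * (LINT \<omega>|M. (norm (\<xi> \<omega>))\<^sup>2)"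
proof -
  have [measurable]: "\<xi> \<in> borel_measurable M" "Z \<in> borel_measurable M"
    and i: "integrable M (\<lambda>\<omega>. K\<^sup>2 * (norm (\<xi> \<omega>))\<^sup>2)"
    using \<xi> Z by (auto simp: Lp_space_2_iff)
  have le: "(norm (\<xi> \<omega> *v Z \<omega>))\<^sup>2 \<le> K\<^sup>2 * (norm (\<xi> \<omega>))\<^sup>2" for \<omega>
  proof -
    have "norm (\<xi> \<omega> *v Z \<omega>) \<le> norm (\<xi> \<omega>) * norm (Z \<omega>)" by (rule norm_matrix_vector_mult_le)
    also have "\<dots> \<le> norm (\<xi> \<omega>) * K" using Z(2) by (intro mult_left_mono) auto
    finally show ?thesis by (simp add: power_mono mult.commute flip: power_mult_distrib)
  qed
  have i': "integrable M (\<lambda>\<omega>. (norm (\<xi> \<omega> *v Z \<omega>))\<^sup>2)"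
    by (rule Bochner_Integration.integrable_bound[OF i]) (use le in auto)
  then show "(\<lambda>\<omega>. \<xi> \<omega> *v Z \<omega>) \<in> Lp_space M 2" by (simp add: Lp_space_2_iff)
  have "(LINT \<omega>|M. (norm (\<xi> \<omega> *v Z \<omega>))\<^sup>2) \<le> (LINT \<omega>|M. K\<^sup>2 * (norm (\<xi> \<omega>))\<^sup>2)"
    by (intro integral_mono i' i le)
  then show "(LINT \<omega>|M. (norm (\<xi> \<omega> *v Z \<omega>))\<^sup>2) \<le> K\<^sup>2 * (LINT \<omega>|M. (norm (\<xi> \<omega>))\<^sup>2)" by simp
qed

text \<open>Averaging and then multiplying by Z is bounded from L2 in sample and time to L2 in the
  sample alone, with squared norm at most \<open>K\<^sup>2 * (1 / (b - a))\<close>, so \<phi> pulls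
  back to a test functional for the assumed convergence.\<close>

lemma weak_limit_bounded_weight:
  fixes f :: "nat \<Rightarrow> 'a \<times> real \<Rightarrow> real^'k^'m" and Z :: "'a \<Rightarrow> real^'k"
  assumes conv: "Lp_converges_weakly (with_time M) 2 f g"
    and Z: "Z \<in> borel_measurable M" "\<And>\<omega>. norm (Z \<omega>) \<le> K"
    and \<phi>: "\<phi> \<in> Lp_dual M 2" and ab: "a < b"
  shows "(\<lambda>n. \<phi> (\<lambda>\<omega>. time_avg a b (f n) \<omega> *v Z \<omega>)) \<longlonglongrightarrow> \<phi> (\<lambda>\<omega>. time_avg a b g \<omega> *v Z \<omega>)"
proof -
  let ?P = "with_time M"
  obtain C where C: "C > 0" "\<And>f. f \<in> Lp_space M 2 \<Longrightarrow> \<bar>\<phi> f\<bar> \<le> C * Lp_norm M 2 f"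
    using Lp_dual_bound[OF \<phi>] by metis
  note L2 = bounded_weight_L2(1)[OF time_avg_L2(1)[OF _ ab] Z]
  have "(\<lambda>v. \<phi> (\<lambda>\<omega>. time_avg a b v \<omega> *v Z \<omega>)) \<in> Lp_dual ?P 2"
  proof (rule Lp_dualI[where C = "C * sqrt (K\<^sup>2 * (1 / (b - a)))"])
    fix u v :: "'a \<times> real \<Rightarrow> real^'k^'m" assume u: "u \<in> Lp_space ?P 2" and v: "v \<in> Lp_space ?P 2"
    \<comment> \<open>Averages add only almost everywhere, a difference that \<phi> does not
      notice.\<close>
    have "\<phi> (\<lambda>\<omega>. time_avg a b (\<lambda>x. u x + v x) \<omega> *v Z \<omega>) =
        \<phi> (\<lambda>\<omega>. time_avg a b u \<omega> *v Z \<omega> + time_avg a b v \<omega> *v Z \<omega>)"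
    proof (rule Lp_dual_cong_AE[OF \<phi>])
      show "(\<lambda>\<omega>. time_avg a b (\<lambda>x. u x + v x) \<omega> *v Z \<omega>) \<in> Lp_space M 2"
        by (intro L2 Lp_space_add u v) simp
      show "(\<lambda>\<omega>. time_avg a b u \<omega> *v Z \<omega> + time_avg a b v \<omega> *v Z \<omega>) \<in> Lp_space M 2"
        by (intro Lp_space_add L2 u v) simp
      show "AE \<omega> in M. time_avg a b (\<lambda>x. u x + v x) \<omega> *v Z \<omega> = time_avg a b u \<omega> *v Z \<omega> + time_avg a b v \<omega> *v Z \<omega>"
        using time_avg_add_AE[OF u v, of a b]
        by eventually_elim (simp add: matrix_vector_mult_add_rdistrib)
    qed simp
    also have "\<dots> = \<phi> (\<lambda>\<omega>. time_avg a b u \<omega> *v Z \<omega>) + \<phi> (\<lambda>\<omega>. time_avg a b v \<omega> *v Z \<omega>)"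
      by (intro Lp_dual_add[OF \<phi>] L2 u v)
    finally show "\<phi> (\<lambda>\<omega>. time_avg a b (\<lambda>x. u x + v x) \<omega> *v Z \<omega>) =
        \<phi> (\<lambda>\<omega>. time_avg a b u \<omega> *v Z \<omega>) + \<phi> (\<lambda>\<omega>. time_avg a b v \<omega> *v Z \<omega>)" .
  next
    fix c and u :: "'a \<times> real \<Rightarrow> real^'k^'m" assume u: "u \<in> Lp_space ?P 2"
    show "\<phi> (\<lambda>\<omega>. time_avg a b (\<lambda>x. c *\<^sub>R u x) \<omega> *v Z \<omega>) = c * \<phi> (\<lambda>\<omega>. time_avg a b u \<omega> *v Z \<omega>)"
      using Lp_dual_scaleR[OF \<phi> L2[OF u], of c] by (simp add: time_avg_scaleR scaleR_matrix_vector_assoc)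
  next
    fix u :: "'a \<times> real \<Rightarrow> real^'k^'m"
    assume u: "u \<in> Lp_space ?P 2" "(LINT x|?P. norm (u x) powr 2) \<le> 1"
    have "(LINT \<omega>|M. (norm (time_avg a b u \<omega> *v Z \<omega>))\<^sup>2) \<le> K\<^sup>2 * (LINT \<omega>|M. (norm (time_avg a b u \<omega>))\<^sup>2)"
      by (rule bounded_weight_L2(2)[OF time_avg_L2(1)[OF u(1) ab] Z])
    also have "\<dots> \<le> K\<^sup>2 * ((1 / (b - a)) * 1)"
    proof (rule mult_left_mono)
      have "(LINT \<omega>|M. (norm (time_avg a b u \<omega>))\<^sup>2) \<le> (1 / (b - a)) * (LINT x|?P. (norm (u x))\<^sup>2)"
        by (rule time_avg_L2(2)[OF u(1) ab])
      also have "\<dots> \<le> (1 / (b - a)) * 1" using u(2) ab by (intro mult_left_mono) auto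
      finally show "(LINT \<omega>|M. (norm (time_avg a b u \<omega>))\<^sup>2) \<le> (1 / (b - a)) * 1" .
    qed simp
    finally have "Lp_norm M 2 (\<lambda>\<omega>. time_avg a b u \<omega> *v Z \<omega>) \<le> sqrt (K\<^sup>2 * (1 / (b - a)))"
      by (simp add: Lp_norm_2)
    then have "C * Lp_norm M 2 (\<lambda>\<omega>. time_avg a b u \<omega> *v Z \<omega>) \<le> C * sqrt (K\<^sup>2 * (1 / (b - a)))"
      using C(1) by (intro mult_left_mono) auto
    then show "\<bar>\<phi> (\<lambda>\<omega>. time_avg a b u \<omega> *v Z \<omega>)\<bar> \<le> C * sqrt (K\<^sup>2 * (1 / (b - a)))"
      using C(2)[OF L2[OF u(1)]] by linarith
  qed simp
  moreover have "\<psi> \<in> Lp_dual ?P 2 \<Longrightarrow> (\<lambda>n. \<psi> (f n)) \<longlonglongrightarrow> \<psi> g" for \<psi>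
    using conv by (simp add: Lp_converges_weakly_def)
  ultimately show ?thesis by blast
qed

end

text \<open>Dominated convergence along integer levels: the error vanishes once the level reaches
  the norm of the increment and never exceeds that norm.\<close>

lemma (in wiener_process) truncation_error_small:
  assumes st: "0 \<le> s" "s < t" "t \<le> T" and e: "e > 0"
  obtains K where "K \<ge> 0" "(LINT \<omega>|M. (norm (W t \<omega> - W s \<omega> - truncate K (W t \<omega> - W s \<omega>)))\<^sup>2) \<le> e"
proof -
  have [measurable]: "W s \<in> borel_measurable M" "W t \<in> borel_measurable M"
    using measurable_W st by auto
  define D where "D \<omega> = W t \<omega> - W s \<omega>" for \<omega>
  have [measurable]: "D \<in> borel_measurable M" unfolding D_def by measurable
  have "(\<lambda>n. LINT \<omega>|M. (norm (D \<omega> - truncate (real n) (D \<omega>)))\<^sup>2) \<longlonglongrightarrow> (LINT \<omega>|M. 0)"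
  proof (rule integral_dominated_convergence)
    show "integrable M (\<lambda>\<omega>. (norm (D \<omega>))\<^sup>2)"
      unfolding D_def by (rule integrable_norm_increment_sq[OF st])
    show "AE \<omega> in M. (\<lambda>n. (norm (D \<omega> - truncate (real n) (D \<omega>)))\<^sup>2) \<longlonglongrightarrow> 0"
    proof (rule AE_I2, rule tendsto_eventually)
      fix \<omega>
      obtain n0 :: nat where "norm (D \<omega>) \<le> real n0" using real_arch_simple by blast
      then show "\<forall>\<^sub>F n in sequentially. (norm (D \<omega> - truncate (real n) (D \<omega>)))\<^sup>2 = 0"
        unfolding eventually_sequentially by (intro exI[of _ n0]) (auto simp: truncate_ident)
    qed
    show "AE \<omega> in M. norm ((norm (D \<omega> - truncate (real n) (D \<omega>)))\<^sup>2) \<le> (norm (D \<omega>))\<^sup>2" for n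
      by (auto intro!: power_mono norm_diff_truncate_le)
  qed measurable
  then have "\<forall>\<^sub>F n in sequentially. (LINT \<omega>|M. (norm (D \<omega> - truncate (real n) (D \<omega>)))\<^sup>2) < e"
    using e by (intro order_tendstoD) simp_all
  then obtain n where "(LINT \<omega>|M. (norm (D \<omega> - truncate (real n) (D \<omega>)))\<^sup>2) < e"
    by (auto simp: eventually_sequentially)
  then show ?thesis using that[of "real n"] by (simp add: D_def)
qed

lemma (in wiener_process) L2_step_grid_avg:
  fixes f :: "'a \<times> real \<Rightarrow> real^'k^'m"
  assumes \<delta>: "\<delta> > 0" and t: "real N * \<delta> = t" "t \<le> T" and f: "f \<in> Lp_space (with_time M) 2"
    and prog: "\<And>s. s \<in> {0..T} \<Longrightarrow> time_cut 0 s f \<in> borel_measurable (F s \<Otimes>\<^sub>M lborel)"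
  shows "L2_step t N (grid \<delta>) (grid_avg \<delta> f)"
  unfolding L2_step_def
proof (intro conjI allI impI)
  show "mono_on {..N} (grid \<delta>)"
    using \<delta> by (intro mono_onI) (simp add: grid_def mult_right_mono)
  have *: "grid \<delta> i \<in> {0..t}" if "i \<le> N" for i
    using that \<delta> t(1)[symmetric] by (simp add: grid_def mult_right_mono)
  then show "grid \<delta> ` {..N} \<subseteq> {0..t}" by auto
  fix i assume i: "i < N"
  show "grid_avg \<delta> f i \<in> L2_at (grid \<delta> i)"
  proof (cases "i = 0")
    case True
    then show ?thesis by (simp add: grid_avg_def L2_at_def Lp_space_zero)
  next
    case False
    have "grid \<delta> i \<in> {0..T}" using *[of i] i t(2) by simp
    moreover have "0 \<le> grid \<delta> (i - 1)" "grid \<delta> (i - 1) < grid \<delta> i"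
      using \<delta> False by (auto simp: grid_def)
    ultimately show ?thesis
      using False measurable_time_avg[OF prog] time_avg_L2(1)[OF f]
      by (simp add: grid_avg_def L2_at_def)
  qed
qed

text \<open>The hypothesis \<open>approx\<close> has two tasks: it yields existence, so that
  \<open>ito_integral\<close> picks a genuine version, and it supplies at least one grid with which
  \<open>has_ito_integral_estimate\<close> shows that this version is square integrable.\<close>

lemma (in wiener_process) ito_integral_grid:
  fixes \<Phi> :: "real \<Rightarrow> 'a \<Rightarrow> real^'k^'m" and t :: real
  assumes f_def: "f = time_cut 0 T (\<lambda>(\<omega>, s). \<Phi> s \<omega>)" and Y_def: "Y = ito_integral M F W \<Phi> t"
    and t: "t \<in> {0..T}" and f: "f \<in> Lp_space (with_time M) 2"
    and prog: "\<And>s. s \<in> {0..T} \<Longrightarrow> time_cut 0 s f \<in> borel_measurable (F s \<Otimes>\<^sub>M lborel)"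
    and approx: "\<And>e. e > 0 \<Longrightarrow> \<exists>N \<delta>. \<delta> > 0 \<and> real N * \<delta> = t \<and>
      (LINT x|with_time M. (norm (grid_process \<delta> N f x - time_cut 0 t f x))\<^sup>2) \<le> e"
  shows "Y \<in> Lp_space M 2"
    and "\<delta> > 0 \<Longrightarrow> real N * \<delta> = t \<Longrightarrow>
      (LINT \<omega>|M. (norm (Y \<omega> - elementary_integral W N (grid \<delta>) (grid_avg \<delta> f) \<omega>))\<^sup>2) \<le>
      4 * (LINT x|with_time M. (norm (grid_process \<delta> N f x - time_cut 0 t f x))\<^sup>2)"
proof -
  have tT: "t \<le> T" using t by simp
  have cut_f: "time_cut 0 t (\<lambda>(\<omega>, s). \<Phi> s \<omega>) = time_cut 0 t f"
    using t by (auto simp: f_def time_cut_def indicator_def fun_eq_iff)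
  have st: "L2_step t N (grid \<delta>) (grid_avg \<delta> f)" if "\<delta> > 0" "real N * \<delta> = t" for N \<delta>
    by (rule L2_step_grid_avg[OF that tT f prog])
  have "\<exists>Y. has_ito_integral M F W \<Phi> t Y"
  proof (rule has_ito_integral_exists[OF tT], unfold cut_f)
    show "time_cut 0 t f \<in> Lp_space (with_time M) 2" by (rule time_cut_L2[OF f])
    fix e :: real assume "e > 0"
    then obtain N \<delta> where N: "\<delta> > 0" "real N * \<delta> = t"
      "(LINT x|with_time M. (norm (grid_process \<delta> N f x - time_cut 0 t f x))\<^sup>2) \<le> e / 2"
      using approx[of "e / 2"] by auto
    with \<open>e > 0\<close> have "(LINT x|with_time M. (norm (grid_process \<delta> N f x - time_cut 0 t f x))\<^sup>2) < e"
      by linarith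
    with st[OF N(1,2)] show "\<exists>N \<tau> \<xi>. L2_step t N \<tau> \<xi> \<and>
        (LINT x|with_time M. (norm (process_of N \<tau> \<xi> x - time_cut 0 t f x))\<^sup>2) < e"
      by blast
  qed
  then have ito: "has_ito_integral M F W \<Phi> t Y"
    unfolding Y_def ito_integral_def by (rule someI_ex)
  obtain N0 \<delta>0 where "\<delta>0 > 0" "real N0 * \<delta>0 = t" using approx[of 1] by auto
  then show "Y \<in> Lp_space M 2" by (intro has_ito_integral_estimate(1)[OF ito tT st])
  assume N: "\<delta> > 0" "real N * \<delta> = t"
  show "(LINT \<omega>|M. (norm (Y \<omega> - elementary_integral W N (grid \<delta>) (grid_avg \<delta> f) \<omega>))\<^sup>2) \<le>
      4 * (LINT x|with_time M. (norm (grid_process \<delta> N f x - time_cut 0 t f x))\<^sup>2)"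
    using has_ito_integral_estimate(2)[OF ito tT st[OF N]]
    unfolding cut_f by (simp only: norm_minus_commute[of "time_cut 0 t f x" for x])
qed

lemma Lp_dual_small:
  assumes "\<And>f. f \<in> Lp_space M 2 \<Longrightarrow> \<bar>\<phi> f\<bar> \<le> C * Lp_norm M 2 f"
    and "C > 0" "e > 0" "f \<in> Lp_space M 2" "(LINT x|M. (norm (f x))\<^sup>2) \<le> (e / C)\<^sup>2"
  shows "\<bar>\<phi> f\<bar> \<le> e"
proof -
  have "Lp_norm M 2 f \<le> sqrt ((e / C)\<^sup>2)"
    unfolding Lp_norm_2 using assms(5) by (rule real_sqrt_le_mono)
  then have "C * Lp_norm M 2 f \<le> C * (e / C)"
    using assms(2,3) by (intro mult_left_mono) auto
  then show ?thesis using assms(1)[OF assms(4)] assms(2) by simp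
qed

text \<open>A chain of comparisons u, v, w, w', u': truncate the increment of \<open>Wn n\<close>,
  replace it by the truncated increment of \<open>W\<close>, pass to the weak limit in the average,
  undo the truncation. The two outer ones use independence of an average from an increment of its
  own Wiener process. The second uses only that the weight is bounded and tends to zero, because the
  average of \<open>f n\<close> need not be independent of \<open>W\<close>.\<close>

lemma block_weak_limit:
  fixes f :: "nat \<Rightarrow> 'a \<times> real \<Rightarrow> real^'k^'m" and W :: "real \<Rightarrow> 'a \<Rightarrow> real^'k"
  assumes Wn: "\<And>n. wiener_process M (Fn n) T (Wn n)" and W: "wiener_process M F T W"
    and p: "p > 2" and conv: "Lp_converges_weakly (with_time M) 2 f g"
    and Lp: "\<And>n. f n \<in> Lp_space (with_time M) p"
    and bound: "\<And>n. (LINT x|with_time M. norm (f n x) powr p) \<le> B"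
    and abc: "0 \<le> a" "a < b" "b < c" "c \<le> T"
    and adapted: "\<And>n. time_avg a b (f n) \<in> borel_measurable (Fn n b)" "time_avg a b g \<in> borel_measurable (F b)"
    and lim: "\<And>s. s \<in> {0..T} \<Longrightarrow> AE \<omega> in M. (\<lambda>n. Wn n s \<omega>) \<longlonglongrightarrow> W s \<omega>"
    and \<phi>: "\<phi> \<in> Lp_dual M 2"
  shows "(\<lambda>n. \<phi> (\<lambda>\<omega>. time_avg a b (f n) \<omega> *v (Wn n c \<omega> - Wn n b \<omega>)))
    \<longlonglongrightarrow> \<phi> (\<lambda>\<omega>. time_avg a b g \<omega> *v (W c \<omega> - W b \<omega>))"
proof (rule LIMSEQ_I)
  fix \<epsilon> :: real assume \<epsilon>: "\<epsilon> > 0"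
  interpret W: wiener_process M F T W by (rule W)
  let ?P = "with_time M"
  have bc: "0 \<le> b" "b < c" "c \<le> T" using abc by auto
  have f: "f n \<in> Lp_space ?P 2" and g: "g \<in> Lp_space ?P 2" for n
    using conv by (auto simp: Lp_converges_weakly_def)
  have [measurable]: "W s \<in> borel_measurable M" "Wn n s \<in> borel_measurable M" if "s \<in> {b, c}" for n s
    using wiener_process.measurable_W[OF W, of s] wiener_process.measurable_W[OF Wn, of s n] that bc by auto
  have Wm [measurable]: "W b \<in> borel_measurable M" "W c \<in> borel_measurable M"
    "Wn n b \<in> borel_measurable M" "Wn n c \<in> borel_measurable M" for n
    by auto
  obtain C where C: "C > 0" "\<And>f. f \<in> Lp_space M 2 \<Longrightarrow> \<bar>\<phi> f\<bar> \<le> C * Lp_norm M 2 f"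
    using Lp_dual_bound[OF \<phi>] by metis
  \<comment> \<open>Four comparisons cost at most e each, and the fifth part is slack. A squared L2
    distance up to \<eta> changes \<phi> by at most e.\<close>
  define e where "e = \<epsilon> / 5"
  define \<eta> where "\<eta> = (e / C)\<^sup>2"
  have e: "e > 0" and \<eta>: "\<eta> > 0" using \<epsilon> C by (auto simp: e_def \<eta>_def)
  note small = Lp_dual_small[OF C(2,1) e, folded \<eta>_def]
  obtain B2 where B2: "\<And>n. (LINT x|?P. norm (f n x) powr 2) \<le> B2"
    using Lp_converges_weakly_bounded[OF conv] by auto
  \<comment> \<open>A common bound for all averages and their limit; the summand 1 makes it
    positive, since the truncation error is measured against \<open>\<eta> / A\<close>.\<close>
  define A where "A = (1 / (b - a)) * max B2 (LINT x|?P. (norm (g x))\<^sup>2) + 1"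
  have Af: "(LINT \<omega>|M. (norm (time_avg a b (f n) \<omega>))\<^sup>2) \<le> A" for n
  proof -
    have "(LINT x|?P. (norm (f n x))\<^sup>2) \<le> max B2 (LINT x|?P. (norm (g x))\<^sup>2)"
      using B2[of n] by simp
    then have "(1 / (b - a)) * (LINT x|?P. (norm (f n x))\<^sup>2) \<le> (1 / (b - a)) * max B2 (LINT x|?P. (norm (g x))\<^sup>2)"
      using abc by (intro mult_left_mono) auto
    then show ?thesis using W.time_avg_L2(2)[OF f[of n] abc(2)] by (simp add: A_def)
  qed
  have Ag: "(LINT \<omega>|M. (norm (time_avg a b g \<omega>))\<^sup>2) \<le> A"
  proof -
    have "(1 / (b - a)) * (LINT x|?P. (norm (g x))\<^sup>2) \<le> (1 / (b - a)) * max B2 (LINT x|?P. (norm (g x))\<^sup>2)"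
      using abc by (intro mult_left_mono) auto
    then show ?thesis using W.time_avg_L2(2)[OF g abc(2)] by (simp add: A_def)
  qed
  have "A \<ge> 0" using order_trans[OF _ Ag] by simp
  have "A > 0"
  proof -
    have "0 \<le> (1 / (b - a)) * max B2 (LINT x|?P. (norm (g x))\<^sup>2)"
      using abc by (intro mult_nonneg_nonneg) (auto simp: le_max_iff_disj)
    then show ?thesis by (simp add: A_def)
  qed
  define \<Delta>n where "\<Delta>n n \<omega> = Wn n c \<omega> - Wn n b \<omega>" for n \<omega>
  define \<Delta> where "\<Delta> \<omega> = W c \<omega> - W b \<omega>" for \<omega>
  have [measurable]: "\<Delta> \<in> borel_measurable M" "\<Delta>n n \<in> borel_measurable M" for n
    unfolding \<Delta>_def \<Delta>n_def by measurable
  obtain K where K: "K \<ge> 0" and \<rho>: "(LINT \<omega>|M. (norm (\<Delta> \<omega> - truncate K (\<Delta> \<omega>)))\<^sup>2) \<le> \<eta> / A"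
    using W.truncation_error_small[OF bc, of "\<eta> / A"] \<eta> \<open>A > 0\<close> unfolding \<Delta>_def by auto
  have tm [measurable]: "truncate K \<in> borel_measurable (borel :: (real^'k) measure)"
    by (rule measurable_truncate[OF K])
  \<comment> \<open>Stated for an arbitrary filtration and Wiener process, so that it serves every n
    and the limit with the same level K.\<close>
  have tail: "(\<lambda>\<omega>. \<xi> \<omega> *v (U c \<omega> - U b \<omega>)) \<in> Lp_space M 2"
      "(LINT \<omega>|M. (norm (\<xi> \<omega> *v (U c \<omega> - U b \<omega>) - \<xi> \<omega> *v truncate K (U c \<omega> - U b \<omega>)))\<^sup>2) \<le> \<eta>"
    if U: "wiener_process M G T U" and \<xi>: "\<xi> \<in> borel_measurable (G b)" "\<xi> \<in> Lp_space M 2"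
      "(LINT \<omega>|M. (norm (\<xi> \<omega>))\<^sup>2) \<le> A" for G U and \<xi> :: "'a \<Rightarrow> real^'k^'m"
  proof -
    interpret U: wiener_process M G T U by (rule U)
    show "(\<lambda>\<omega>. \<xi> \<omega> *v (U c \<omega> - U b \<omega>)) \<in> Lp_space M 2"
      by (rule U.step_block_L2(1)[OF bc \<xi>(1,2), of "\<lambda>x. x"])
        (use U.integrable_norm_increment_sq[OF bc] in auto)
    have m: "(\<lambda>x. x - truncate K x) \<in> borel_measurable (borel :: (real^'k) measure)" by measurable
    have [measurable]: "U b \<in> borel_measurable M" "U c \<in> borel_measurable M"
      using U.measurable_W bc by auto
    have i: "integrable M (\<lambda>\<omega>. (norm (U c \<omega> - U b \<omega> - truncate K (U c \<omega> - U b \<omega>)))\<^sup>2)"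
      by (rule Bochner_Integration.integrable_bound[OF U.integrable_norm_increment_sq[OF bc]])
        (auto intro!: power_mono norm_diff_truncate_le K)
    \<comment> \<open>Both increments have the same law, so the level chosen for \<open>W\<close>
      works for U.\<close>
    have law: "(LINT \<omega>|M. (norm (U c \<omega> - U b \<omega> - truncate K (U c \<omega> - U b \<omega>)))\<^sup>2) =
        (LINT \<omega>|M. (norm (\<Delta> \<omega> - truncate K (\<Delta> \<omega>)))\<^sup>2)"
    proof -
      have g: "(\<lambda>x. (norm (x - truncate K x))\<^sup>2) \<in> borel_measurable (borel :: (real^'k) measure)" by measurable
      show ?thesis
        using U.increment_integral(1)[OF bc g] W.increment_integral(1)[OF bc g] by (simp add: \<Delta>_def)
    qed
    have "(LINT \<omega>|M. (norm (\<xi> \<omega> *v (U c \<omega> - U b \<omega>) - \<xi> \<omega> *v truncate K (U c \<omega> - U b \<omega>)))\<^sup>2) \<le>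
        (LINT \<omega>|M. (norm (\<xi> \<omega>))\<^sup>2) * (LINT \<omega>|M. (norm (U c \<omega> - U b \<omega> - truncate K (U c \<omega> - U b \<omega>)))\<^sup>2)"
      unfolding matrix_vector_mult_diff_distrib[symmetric]
      by (rule U.step_block_L2(2)[OF bc \<xi>(1,2) m i])
    also have "\<dots> \<le> A * (\<eta> / A)"
      unfolding law using \<xi>(3) \<rho> \<open>A > 0\<close> by (intro mult_mono) auto
    finally show "(LINT \<omega>|M. (norm (\<xi> \<omega> *v (U c \<omega> - U b \<omega>) - \<xi> \<omega> *v truncate K (U c \<omega> - U b \<omega>)))\<^sup>2) \<le> \<eta>"
      using \<open>A > 0\<close> by simp
  qed
  note avgL2 = W.time_avg_L2(1)[OF f abc(2)] and avgL2g = W.time_avg_L2(1)[OF g abc(2)]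
  define u v w where "u n \<omega> = time_avg a b (f n) \<omega> *v \<Delta>n n \<omega>"
    and "v n \<omega> = time_avg a b (f n) \<omega> *v truncate K (\<Delta>n n \<omega>)"
    and "w n \<omega> = time_avg a b (f n) \<omega> *v truncate K (\<Delta> \<omega>)" for n \<omega>
  define u' w' where "u' \<omega> = time_avg a b g \<omega> *v \<Delta> \<omega>" and "w' \<omega> = time_avg a b g \<omega> *v truncate K (\<Delta> \<omega>)" for \<omega>
  note trK = norm_truncate_le[OF K]
  have L2: "u n \<in> Lp_space M 2" "v n \<in> Lp_space M 2" "w n \<in> Lp_space M 2" "u' \<in> Lp_space M 2" "w' \<in> Lp_space M 2" for n
    using tail(1)[OF Wn adapted(1) avgL2 Af, of n] tail(1)[OF W adapted(2) avgL2g Ag]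
      W.bounded_weight_L2(1)[OF avgL2[of n] _ trK, of "\<Delta>n n"] W.bounded_weight_L2(1)[OF avgL2[of n] _ trK, of \<Delta>]
      W.bounded_weight_L2(1)[OF avgL2g _ trK, of \<Delta>]
    by (auto simp: u_def[abs_def] v_def[abs_def] w_def[abs_def] u'_def[abs_def] w'_def[abs_def] \<Delta>_def \<Delta>n_def)
  have uv: "\<bar>\<phi> (u n) - \<phi> (v n)\<bar> \<le> e" for n
    unfolding Lp_dual_diff[OF \<phi> L2(1,2), symmetric]
    using tail(2)[OF Wn adapted(1) avgL2 Af, of n]
    by (intro small Lp_space_diff L2) (simp_all add: u_def v_def \<Delta>n_def)
  have uw': "\<bar>\<phi> u' - \<phi> w'\<bar> \<le> e"
    unfolding Lp_dual_diff[OF \<phi> L2(4,5), symmetric]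
    using tail(2)[OF W adapted(2) avgL2g Ag]
    by (intro small Lp_space_diff L2) (simp_all add: u'_def w'_def \<Delta>_def)
  have "(\<lambda>n. \<phi> (w n)) \<longlonglongrightarrow> \<phi> w'"
    unfolding w_def[abs_def] w'_def[abs_def]
    by (rule W.weak_limit_bounded_weight[OF conv _ trK \<phi> abc(2)]) measurable
  then have ww: "\<forall>\<^sub>F n in sequentially. \<bar>\<phi> (w n) - \<phi> w'\<bar> < e"
    unfolding tendsto_iff dist_real_def using e by blast
  define d where "d n \<omega> = norm (truncate K (\<Delta>n n \<omega>) - truncate K (\<Delta> \<omega>))" for n \<omega>
  have [measurable]: "d n \<in> borel_measurable M" for n unfolding d_def by measurable
  have d: "0 \<le> d n \<omega>" "d n \<omega> \<le> 2 * K" for n \<omega>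
    using trK[of "\<Delta>n n \<omega>"] trK[of "\<Delta> \<omega>"] norm_triangle_ineq4[of "truncate K (\<Delta>n n \<omega>)" "truncate K (\<Delta> \<omega>)"]
    by (auto simp: d_def)
  have dsq: "(d n \<omega>)\<^sup>2 \<le> (2 * K)\<^sup>2" for n \<omega> using d by (intro power_mono)
  \<comment> \<open>Only here does the pathwise convergence of \<open>Wn\<close> enter, at the two
    times b and c; continuity of the truncation carries it to d, and \<open>2 * K\<close>
    dominates.\<close>
  have "(\<lambda>n. LINT \<omega>|M. (d n \<omega>)\<^sup>2) \<longlonglongrightarrow> (LINT \<omega>|M. 0)"
  proof (rule integral_dominated_convergence)
    show "integrable M (\<lambda>\<omega>. (2 * K)\<^sup>2)" by simp
    show "AE \<omega> in M. norm ((d n \<omega>)\<^sup>2) \<le> (2 * K)\<^sup>2" for n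
      using dsq by simp
    have "b \<in> {0..T}" "c \<in> {0..T}" using bc by auto
    from lim[OF this(1)] lim[OF this(2)] show "AE \<omega> in M. (\<lambda>n. (d n \<omega>)\<^sup>2) \<longlonglongrightarrow> 0"
    proof eventually_elim
      case (elim \<omega>)
      then have "(\<lambda>n. \<Delta>n n \<omega>) \<longlonglongrightarrow> \<Delta> \<omega>" unfolding \<Delta>n_def \<Delta>_def by (intro tendsto_diff)
      then have "(\<lambda>n. truncate K (\<Delta>n n \<omega>)) \<longlonglongrightarrow> truncate K (\<Delta> \<omega>)"
        using continuous_on_tendsto_compose[OF continuous_truncate[OF K]] by auto
      then have "(\<lambda>n. (norm (truncate K (\<Delta>n n \<omega>) - truncate K (\<Delta> \<omega>)))\<^sup>2) \<longlonglongrightarrow> (norm (truncate K (\<Delta> \<omega>) - truncate K (\<Delta> \<omega>)))\<^sup>2"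
        by (intro tendsto_intros)
      then show ?case by (simp add: d_def)
    qed
  qed measurable
  then have d0: "(\<lambda>n. LINT \<omega>|M. (d n \<omega>)\<^sup>2) \<longlonglongrightarrow> 0" by simp
  \<comment> \<open>L depends on K, the interval, B and \<eta> but not on n; n is taken large
    afterwards, with the L2 size of d measured against L.\<close>
  obtain L where L: "L > 0" "L powr (2 - p) * ((2 * K)\<^sup>2 / (b - a) * B) \<le> \<eta> / 2"
    using powr_small[OF p, of "\<eta> / 2" "(2 * K)\<^sup>2 / (b - a) * B"] \<eta> by auto
  have "\<forall>\<^sub>F n in sequentially. (LINT \<omega>|M. (d n \<omega>)\<^sup>2) < \<eta> / (2 * L\<^sup>2)"
    using \<eta> L by (intro order_tendstoD(2)[OF d0]) simp
  then have vw: "\<forall>\<^sub>F n in sequentially. \<bar>\<phi> (v n) - \<phi> (w n)\<bar> \<le> e"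
  proof eventually_elim
    case (elim n)
    have "(LINT \<omega>|M. (norm (v n \<omega> - w n \<omega>))\<^sup>2) \<le> (LINT \<omega>|M. (norm (time_avg a b (f n) \<omega>) * d n \<omega>)\<^sup>2)"
    proof (rule integral_mono)
      show "integrable M (\<lambda>\<omega>. (norm (v n \<omega> - w n \<omega>))\<^sup>2)"
        using Lp_space_diff[OF L2(2,3), of n n] by (simp add: Lp_space_2_iff)
      show "integrable M (\<lambda>\<omega>. (norm (time_avg a b (f n) \<omega>) * d n \<omega>)\<^sup>2)"
      proof (rule Bochner_Integration.integrable_bound)
        show "integrable M (\<lambda>\<omega>. (norm (time_avg a b (f n) \<omega>))\<^sup>2 * (2 * K)\<^sup>2)"
          using avgL2[of n] by (simp add: Lp_space_2_iff)
        show "(\<lambda>\<omega>. (norm (time_avg a b (f n) \<omega>) * d n \<omega>)\<^sup>2) \<in> borel_measurable M"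
          using avgL2[of n] by (auto simp: Lp_space_2_iff)
        show "AE \<omega> in M. norm ((norm (time_avg a b (f n) \<omega>) * d n \<omega>)\<^sup>2) \<le> norm ((norm (time_avg a b (f n) \<omega>))\<^sup>2 * (2 * K)\<^sup>2)"
          using dsq by (intro AE_I2) (simp add: power_mult_distrib[of "norm _"] mult_left_mono)
      qed
      show "(norm (v n \<omega> - w n \<omega>))\<^sup>2 \<le> (norm (time_avg a b (f n) \<omega>) * d n \<omega>)\<^sup>2" for \<omega>
        unfolding v_def w_def d_def matrix_vector_mult_diff_distrib[symmetric]
        by (intro power_mono norm_matrix_vector_mult_le) simp
    qed
    also have "\<dots> \<le> L\<^sup>2 * (LINT \<omega>|M. (d n \<omega>)\<^sup>2) +
        L powr (2 - p) * ((2 * K)\<^sup>2 / (b - a) * (LINT x|?P. norm (f n x) powr p))"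
      using p L abc d by (intro W.weighted_time_avg_le f Lp) auto
    also have "\<dots> \<le> \<eta> / 2 + \<eta> / 2"
    proof (rule add_mono)
      show "L\<^sup>2 * (LINT \<omega>|M. (d n \<omega>)\<^sup>2) \<le> \<eta> / 2"
        using elim L(1) by (simp add: field_simps)
      have "(2 * K)\<^sup>2 / (b - a) * (LINT x|?P. norm (f n x) powr p) \<le> (2 * K)\<^sup>2 / (b - a) * B"
        using abc bound[of n] by (intro mult_left_mono) auto
      then have "L powr (2 - p) * ((2 * K)\<^sup>2 / (b - a) * (LINT x|?P. norm (f n x) powr p)) \<le>
          L powr (2 - p) * ((2 * K)\<^sup>2 / (b - a) * B)"
        by (rule mult_left_mono) simp
      then show "L powr (2 - p) * ((2 * K)\<^sup>2 / (b - a) * (LINT x|?P. norm (f n x) powr p)) \<le> \<eta> / 2"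
        using L(2) by linarith
    qed
    finally show ?case
      unfolding Lp_dual_diff[OF \<phi> L2(2,3), symmetric] by (intro small Lp_space_diff L2) auto
  qed
  have "\<forall>\<^sub>F n in sequentially. norm (\<phi> (u n) - \<phi> u') < \<epsilon>"
    using ww vw
  proof eventually_elim
    case (elim n)
    moreover have "\<epsilon> = 5 * e" by (simp add: e_def)
    ultimately show ?case using uv[of n] uw' e unfolding real_norm_def by linarith
  qed
  then show "\<exists>no. \<forall>n\<ge>no. norm (\<phi> (\<lambda>\<omega>. time_avg a b (f n) \<omega> *v (Wn n c \<omega> - Wn n b \<omega>)) -
      \<phi> (\<lambda>\<omega>. time_avg a b g \<omega> *v (W c \<omega> - W b \<omega>))) < \<epsilon>"
    unfolding eventually_sequentially u_def[abs_def] u'_def[abs_def] \<Delta>_def[abs_def] \<Delta>n_def[abs_def] .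
qed

text \<open>By linearity \<phi> acts on the grid intervals separately. The first one has coefficient
  0 and contributes nothing; on the others \<open>block_weak_limit\<close> applies, with the average
  over the preceding interval.\<close>

lemma step_integral_weak_limit:
  fixes f :: "nat \<Rightarrow> 'a \<times> real \<Rightarrow> real^'k^'m" and W :: "real \<Rightarrow> 'a \<Rightarrow> real^'k"
  assumes Wn: "\<And>n. wiener_process M (Fn n) T (Wn n)" and W: "wiener_process M F T W"
    and p: "p > 2" and conv: "Lp_converges_weakly (with_time M) 2 f g"
    and Lp: "\<And>n. f n \<in> Lp_space (with_time M) p"
    and bound: "\<And>n. (LINT x|with_time M. norm (f n x) powr p) \<le> B"
    and prog: "\<And>n s. s \<in> {0..T} \<Longrightarrow> time_cut 0 s (f n) \<in> borel_measurable (Fn n s \<Otimes>\<^sub>M lborel)"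
      "\<And>s. s \<in> {0..T} \<Longrightarrow> time_cut 0 s g \<in> borel_measurable (F s \<Otimes>\<^sub>M lborel)"
    and lim: "\<And>s. s \<in> {0..T} \<Longrightarrow> AE \<omega> in M. (\<lambda>n. Wn n s \<omega>) \<longlonglongrightarrow> W s \<omega>"
    and \<phi>: "\<phi> \<in> Lp_dual M 2"
    and \<delta>: "\<delta> > 0" and t: "real N * \<delta> = t" "t \<le> T"
  shows "(\<lambda>n. \<phi> (elementary_integral (Wn n) N (grid \<delta>) (grid_avg \<delta> (f n))))
    \<longlonglongrightarrow> \<phi> (elementary_integral W N (grid \<delta>) (grid_avg \<delta> g))"
proof -
  have f: "f n \<in> Lp_space (with_time M) 2" and g: "g \<in> Lp_space (with_time M) 2" for n
    using conv by (auto simp: Lp_converges_weakly_def)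
  have sum: "\<phi> (elementary_integral U N (grid \<delta>) (grid_avg \<delta> h)) =
      (\<Sum>i<N. \<phi> (\<lambda>\<omega>. grid_avg \<delta> h i \<omega> *v (U (grid \<delta> (Suc i)) \<omega> - U (grid \<delta> i) \<omega>)))"
    if U: "wiener_process M G T U" and h: "h \<in> Lp_space (with_time M) 2"
      and pr: "\<And>s. s \<in> {0..T} \<Longrightarrow> time_cut 0 s h \<in> borel_measurable (G s \<Otimes>\<^sub>M lborel)"
    for G and U :: "real \<Rightarrow> 'a \<Rightarrow> real^'k" and h :: "'a \<times> real \<Rightarrow> real^'k^'m"
  proof -
    interpret U: wiener_process M G T U by (rule U)
    have st: "U.L2_step t N (grid \<delta>) (grid_avg \<delta> h)"
      by (rule U.L2_step_grid_avg[OF \<delta> t h pr])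
    note S = U.L2_stepD[OF st _ t(2)]
    have "(\<lambda>\<omega>. grid_avg \<delta> h i \<omega> *v (U (grid \<delta> (Suc i)) \<omega> - U (grid \<delta> i) \<omega>)) \<in> Lp_space M 2" if "i < N" for i
      using U.block_L2[OF S(1,2,4,5)[OF that]] by (simp add: U.block_def[abs_def])
    then show ?thesis
      unfolding elementary_integral_def[abs_def] by (intro Lp_dual_sum[OF \<phi>]) auto
  qed
  have "\<phi> (elementary_integral (Wn n) N (grid \<delta>) (grid_avg \<delta> (f n))) =
      (\<Sum>i<N. \<phi> (\<lambda>\<omega>. grid_avg \<delta> (f n) i \<omega> *v (Wn n (grid \<delta> (Suc i)) \<omega> - Wn n (grid \<delta> i) \<omega>)))" for n
    by (rule sum[OF Wn f prog(1)])
  moreover have "\<phi> (elementary_integral W N (grid \<delta>) (grid_avg \<delta> g)) =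
      (\<Sum>i<N. \<phi> (\<lambda>\<omega>. grid_avg \<delta> g i \<omega> *v (W (grid \<delta> (Suc i)) \<omega> - W (grid \<delta> i) \<omega>)))"
    by (rule sum[OF W g prog(2)])
  ultimately show ?thesis
  proof (simp only:, intro tendsto_sum)
    fix i assume "i \<in> {..<N}"
    then have i: "i < N" by simp
    show "(\<lambda>n. \<phi> (\<lambda>\<omega>. grid_avg \<delta> (f n) i \<omega> *v (Wn n (grid \<delta> (Suc i)) \<omega> - Wn n (grid \<delta> i) \<omega>)))
      \<longlonglongrightarrow> \<phi> (\<lambda>\<omega>. grid_avg \<delta> g i \<omega> *v (W (grid \<delta> (Suc i)) \<omega> - W (grid \<delta> i) \<omega>))"
    proof (cases "i = 0")
      case False
      have "real (Suc i) * \<delta> \<le> t" using i \<delta> t(1)[symmetric] by (simp add: mult_right_mono del: of_nat_Suc)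
      then have gr: "0 \<le> grid \<delta> (i - 1)" "grid \<delta> (i - 1) < grid \<delta> i" "grid \<delta> i < grid \<delta> (Suc i)" "grid \<delta> (Suc i) \<le> T"
        using \<delta> False t(2) by (auto simp: grid_def)
      then have iT: "grid \<delta> i \<in> {0..T}" by auto
      interpret W: wiener_process M F T W by (rule W)
      have "(\<lambda>n. \<phi> (\<lambda>\<omega>. time_avg (grid \<delta> (i - 1)) (grid \<delta> i) (f n) \<omega> *v (Wn n (grid \<delta> (Suc i)) \<omega> - Wn n (grid \<delta> i) \<omega>)))
        \<longlonglongrightarrow> \<phi> (\<lambda>\<omega>. time_avg (grid \<delta> (i - 1)) (grid \<delta> i) g \<omega> *v (W (grid \<delta> (Suc i)) \<omega> - W (grid \<delta> i) \<omega>))"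
        by (rule block_weak_limit[OF Wn W p conv Lp bound gr _ _ lim \<phi>])
          (intro W.measurable_time_avg prog iT gr(1))+
      then show ?thesis using False by (simp add: grid_avg_def)
    qed (simp add: grid_avg_def)
  qed
qed

section \<open>Uniform grid approximation combined with the limit on a fixed grid\<close>

theorem theorem2p1:
  fixes T p :: real
    and M :: "'a measure"
    and F :: "real \<Rightarrow> 'a measure" and Fn :: "nat \<Rightarrow> real \<Rightarrow> 'a measure"
    and W :: "real \<Rightarrow> 'a \<Rightarrow> real ^ 'k" and Wn :: "nat \<Rightarrow> real \<Rightarrow> 'a \<Rightarrow> real ^ 'k"
    and V :: "real \<Rightarrow> 'a \<Rightarrow> ('x::{real_inner, complete_space, second_countable_topology}) ^ 'k ^ 'm"
    and Vn :: "nat \<Rightarrow> real \<Rightarrow> 'a \<Rightarrow> 'x ^ 'k ^ 'm"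
    and \<beta> :: "'x \<Rightarrow>\<^sub>L real"
  assumes "T > 0"
    and "prob_space M"
    and "\<And>n. wiener_process M (Fn n) T (Wn n)"
    and "wiener_process M F T W"
    and "p > 2"
    and "\<And>n. predictable M (Fn n) T (Vn n)"
    and "predictable M F T V"
    and "Lp_converges_weakly (time_product M T) p (\<lambda>n (\<omega>, t). Vn n t \<omega>) (\<lambda>(\<omega>, t). V t \<omega>)"
    and "AE \<omega> in M. uniform_limit {0..T} (\<lambda>n t. Wn n t \<omega>) (\<lambda>t. W t \<omega>) sequentially"
    and "uniform_limit UNIV
           (\<lambda>h n. \<integral>\<omega>. (LBINT t:{h..T}.
              norm (dual_pairing \<beta> (Vn n) t \<omega> - dual_pairing \<beta> (Vn n) (t - h) \<omega>)) \<partial>M)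
           (\<lambda>n. 0) (at_right 0)"
  shows "\<forall>t\<in>{0..T}. Lp_converges_weakly M 2
           (\<lambda>n. ito_integral M (Fn n) (Wn n) (dual_pairing \<beta> (Vn n)) t)
           (ito_integral M F W (dual_pairing \<beta> V) t)"
proof
  fix t assume t: "t \<in> {0..T}"
  interpret W: wiener_process M F T W by (rule assms(4))
  interpret fm: finite_measure "time_product M T" by (rule W.finite_measure_time_product)
  let ?P = "with_time M"
  define f where "f n = time_cut 0 T (\<lambda>(\<omega>, s). dual_pairing \<beta> (Vn n) s \<omega>)" for n
  define g where "g = time_cut 0 T (\<lambda>(\<omega>, s). dual_pairing \<beta> V s \<omega>)"
  have p: "p \<ge> 2" "p > 0" using \<open>p > 2\<close> by auto
  have pairing: "(\<lambda>x. entrywise \<beta> ((\<lambda>(\<omega>, s). U s \<omega>) x)) = (\<lambda>(\<omega>, s). dual_pairing \<beta> U s \<omega>)" for U :: "real \<Rightarrow> 'a \<Rightarrow> 'x^'k^'m"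
    by (auto simp: dual_pairing_def entrywise_def)
  have conv: "Lp_converges_weakly (time_product M T) p (\<lambda>n (\<omega>, s). dual_pairing \<beta> (Vn n) s \<omega>) (\<lambda>(\<omega>, s). dual_pairing \<beta> V s \<omega>)"
    using Lp_converges_weakly_bounded_linear[OF assms(8) bounded_linear_entrywise[of \<beta>] p(2)]
    unfolding pairing .
  have convp: "Lp_converges_weakly ?P p f g"
    using W.Lp_converges_weakly_time_product[OF conv p(2)] unfolding f_def[abs_def] g_def .
  \<comment> \<open>Lowering the exponent to 2 requires a finite measure, so it is done before the
    extension by zero to all real times.\<close>
  have conv2: "Lp_converges_weakly ?P 2 f g"
    using W.Lp_converges_weakly_time_product[OF fm.Lp_converges_weakly_2[OF conv p(1)]]
    unfolding f_def[abs_def] g_def by simp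
  have fp: "f n \<in> Lp_space ?P p" "f n \<in> Lp_space ?P 2" and gp: "g \<in> Lp_space ?P p" "g \<in> Lp_space ?P 2" for n
    using convp conv2 by (auto simp: Lp_converges_weakly_def)
  obtain B0 where B0: "\<And>n. (LINT x|?P. norm (f n x) powr p) \<le> B0"
    using Lp_converges_weakly_bounded[OF convp p(1)] by blast
  \<comment> \<open>One bound for the sequence and its limit, so that levels chosen from it serve
    both.\<close>
  define B where "B = max B0 (LINT x|?P. norm (g x) powr p)"
  have B: "(LINT x|?P. norm (f n x) powr p) \<le> B" "(LINT x|?P. norm (g x) powr p) \<le> B" for n
    using B0[of n] by (auto simp: B_def)
  have cut_cut: "time_cut 0 s (time_cut 0 T h) = time_cut 0 s h" if "s \<in> {0..T}" for s and h :: "'a \<times> real \<Rightarrow> real^'k^'m"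
    using that by (auto simp: time_cut_def indicator_def fun_eq_iff)
  have progf: "time_cut 0 s (f n) \<in> borel_measurable (Fn n s \<Otimes>\<^sub>M lborel)" if "s \<in> {0..T}" for n s
    unfolding f_def cut_cut[OF that]
    by (rule filtered_prob_space.predictable_time_cut[OF wiener_process.axioms(1)[OF assms(3)]
          predictable_dual_pairing[OF assms(6)] that])
  have progg: "time_cut 0 s g \<in> borel_measurable (F s \<Otimes>\<^sub>M lborel)" if "s \<in> {0..T}" for s
    unfolding g_def cut_cut[OF that]
    by (rule W.predictable_time_cut[OF predictable_dual_pairing[OF assms(7)] that])
  have lim: "AE \<omega> in M. (\<lambda>n. Wn n s \<omega>) \<longlonglongrightarrow> W s \<omega>" if "s \<in> {0..T}" for s
    using assms(9) by eventually_elim (rule tendsto_uniform_limitI[OF _ that])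
  have small: "uniform_limit UNIV (\<lambda>h n. LINT x|?P. norm (lag T h (f n) x)) (\<lambda>n. 0) (at_right 0)"
  proof (rule uniform_limit_cong[THEN iffD1, OF _ _ assms(10)])
    show "\<forall>\<^sub>F h in at_right 0. \<forall>n\<in>UNIV. (LINT \<omega>|M. (LBINT t:{h..T}.
        norm (dual_pairing \<beta> (Vn n) t \<omega> - dual_pairing \<beta> (Vn n) (t - h) \<omega>))) = (LINT x|?P. norm (lag T h (f n) x))"
      using eventually_at_right_less[of 0]
    proof eventually_elim
      case (elim h)
      then show ?case
        using W.lag_time_cut_integral[OF fp(2)[unfolded f_def], of h] unfolding f_def by simp
    qed
  qed simp
  \<comment> \<open>The grid must not depend on n, because the limit in n is taken on it afterwards.
    The same fact gives existence of all the Ito integrals.\<close>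
  have approx: "\<exists>N \<delta>. \<delta> > 0 \<and> real N * \<delta> = t \<and>
      (\<forall>n. (LINT x|?P. (norm (grid_process \<delta> N (f n) x - time_cut 0 t (f n) x))\<^sup>2) \<le> e) \<and>
      (LINT x|?P. (norm (grid_process \<delta> N g x - time_cut 0 t g x))\<^sup>2) \<le> e"
    if e: "e > 0" for e
  proof -
    obtain u0 where u0: "u0 > 0"
      "\<And>u n. 0 < u \<Longrightarrow> u < u0 \<Longrightarrow> (LINT x|?P. (norm (lag T u (f n) x))\<^sup>2) \<le> e / 4"
      using W.lag_square_small[OF \<open>p > 2\<close> fp(2,1) B(1) small, of "e / 4"] e by auto
    have u0g: "(LINT x|?P. (norm (lag T u g x))\<^sup>2) \<le> e / 4" if "0 < u" "u < u0" for u
      using W.lag_square_weak_limit[OF conv2] u0(2)[OF that] by blast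
    obtain K where K: "K > 0" "K powr (2 - p) * B \<le> e / 4"
      using powr_small[OF \<open>p > 2\<close>, of "e / 4" B] e by auto
    \<comment> \<open>The third of u0 keeps all lags up to \<open>2 * \<delta>\<close> strictly
      below u0; the other bound makes \<open>K\<^sup>2 * \<delta>\<close> at most
      \<open>e / 4\<close>.\<close>
    define \<delta>0 where "\<delta>0 = min (u0 / 3) (e / (4 * K\<^sup>2))"
    have \<delta>0: "\<delta>0 > 0" "\<delta>0 \<le> u0 / 3" "\<delta>0 \<le> e / (4 * K\<^sup>2)" using u0 e K by (auto simp: \<delta>0_def)
    \<comment> \<open>The mesh has to divide t exactly, so it is t over a large integer; for t = 0
      the empty grid with N = 0 does.\<close>
    obtain N \<delta> where N: "\<delta> > 0" "\<delta> \<le> \<delta>0" "real N * \<delta> = t"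
    proof (cases "t = 0")
      case True
      then show ?thesis using that[of \<delta>0 0] \<delta>0 by simp
    next
      case False
      obtain N :: nat where N: "t / \<delta>0 \<le> real N" using real_arch_simple by blast
      moreover have "t / \<delta>0 > 0" using False t \<delta>0 by simp
      ultimately have "real N > 0" by linarith
      with N show ?thesis using that[of "t / real N" N] False t \<delta>0 by (simp add: field_simps)
    qed
    have bnd: "(LINT x|?P. (norm (time_cut 0 \<delta> h x))\<^sup>2) \<le> e / 2"
      if h: "h \<in> Lp_space ?P 2" "h \<in> Lp_space ?P p" "(LINT x|?P. norm (h x) powr p) \<le> B" for h :: "'a \<times> real \<Rightarrow> real^'k^'m"
    proof -
      have "K\<^sup>2 * \<delta> \<le> K\<^sup>2 * (e / (4 * K\<^sup>2))"
        using N(2) \<delta>0(3) by (intro mult_left_mono) auto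
      then have "K\<^sup>2 * \<delta> \<le> e / 4" using K(1) by simp
      moreover have "K powr (2 - p) * (LINT x|?P. norm (h x) powr p) \<le> K powr (2 - p) * B"
        using h(3) by (intro mult_left_mono) auto
      ultimately show ?thesis
        using W.time_cut_square_le[OF h(1,2) p(1) K(1), of \<delta>] N(1) K(2) by linarith
    qed
    have tT: "t \<le> T" using t by simp
    have lt: "u < u0" if "u \<le> 2 * \<delta>" for u using that N \<delta>0 u0 by linarith
    have "(LINT x|?P. (norm (grid_process \<delta> N (f n) x - time_cut 0 t (f n) x))\<^sup>2) \<le> e" for n
    proof -
      interpret Wn: wiener_process M "Fn n" T "Wn n" by (rule assms(3))
      have "Wn.L2_step t N (grid \<delta>) (grid_avg \<delta> (f n))"
        by (rule Wn.L2_step_grid_avg[OF N(1,3) tT fp(2) progf])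
      then have "grid_process \<delta> N (f n) \<in> Lp_space ?P 2"
        by (rule Wn.process_of_L2[OF _ tT])
      \<comment> \<open>The first grid interval contributes \<open>e / 2\<close> and the lags twice
        \<open>e / 4\<close>.\<close>
      from W.grid_avg_estimate[OF fp(2) N(1,3) tT u0(2)[OF _ lt] this] bnd[OF fp(2,1) B(1), of n]
      show ?thesis by linarith
    qed
    moreover have "(LINT x|?P. (norm (grid_process \<delta> N g x - time_cut 0 t g x))\<^sup>2) \<le> e"
    proof -
      have "W.L2_step t N (grid \<delta>) (grid_avg \<delta> g)"
        by (rule W.L2_step_grid_avg[OF N(1,3) tT gp(2) progg])
      then have "grid_process \<delta> N g \<in> Lp_space ?P 2"
        by (rule W.process_of_L2[OF _ tT])
      from W.grid_avg_estimate[OF gp(2) N(1,3) tT u0g[OF _ lt] this] bnd[OF gp(2,1) B(2)]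
      show ?thesis by linarith
    qed
    ultimately show ?thesis using N by blast
  qed
  have approxf: "\<exists>N \<delta>. \<delta> > 0 \<and> real N * \<delta> = t \<and>
      (LINT x|?P. (norm (grid_process \<delta> N (f n) x - time_cut 0 t (f n) x))\<^sup>2) \<le> e"
    and approxg: "\<exists>N \<delta>. \<delta> > 0 \<and> real N * \<delta> = t \<and>
      (LINT x|?P. (norm (grid_process \<delta> N g x - time_cut 0 t g x))\<^sup>2) \<le> e"
    if "e > 0" for e n
    using approx[OF that] by blast+
  define Y where "Y n = ito_integral M (Fn n) (Wn n) (dual_pairing \<beta> (Vn n)) t" for n
  define Z where "Z = ito_integral M F W (dual_pairing \<beta> V) t"
  have Y: "Y n \<in> Lp_space M 2" for n
    by (rule wiener_process.ito_integral_grid(1)[OF assms(3) f_def Y_def t fp(2) progf approxf])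
  have Z: "Z \<in> Lp_space M 2"
    by (rule W.ito_integral_grid(1)[OF g_def Z_def t gp(2) progg approxg])
  have "(\<lambda>n. \<phi> (Y n)) \<longlonglongrightarrow> \<phi> Z" if \<phi>: "\<phi> \<in> Lp_dual M 2" for \<phi>
  proof (rule LIMSEQ_I)
    fix \<epsilon> :: real assume "\<epsilon> > 0"
    \<comment> \<open>Three errors of size at most e: two for replacing the integrals by step
      integrals and one for the limit on the grid.\<close>
    define e where "e = \<epsilon> / 4"
    have e: "e > 0" using \<open>\<epsilon> > 0\<close> by (simp add: e_def)
    obtain C where C: "C > 0" "\<And>f. f \<in> Lp_space M 2 \<Longrightarrow> \<bar>\<phi> f\<bar> \<le> C * Lp_norm M 2 f"
      using Lp_dual_bound[OF \<phi>] by metis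
    \<comment> \<open>The quarter cancels the constant 4 in \<open>ito_integral_grid\<close>,
      leaving the threshold of \<open>Lp_dual_small\<close>.\<close>
    have "(e / C)\<^sup>2 / 4 > 0" using e C(1) by simp
    from approx[OF this] obtain N \<delta> where N: "\<delta> > 0" "real N * \<delta> = t"
      and cf: "\<And>n. (LINT x|?P. (norm (grid_process \<delta> N (f n) x - time_cut 0 t (f n) x))\<^sup>2) \<le> (e / C)\<^sup>2 / 4"
      and cg: "(LINT x|?P. (norm (grid_process \<delta> N g x - time_cut 0 t g x))\<^sup>2) \<le> (e / C)\<^sup>2 / 4"
      by blast
    have tT: "t \<le> T" using t by simp
    define I where "I n = elementary_integral (Wn n) N (grid \<delta>) (grid_avg \<delta> (f n))" for n
    define J where "J = elementary_integral W N (grid \<delta>) (grid_avg \<delta> g)"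
    have I: "I n \<in> Lp_space M 2" for n
      unfolding I_def
      by (rule wiener_process.elementary_integral_L2[OF assms(3)
            wiener_process.L2_step_grid_avg[OF assms(3) N tT fp(2) progf] tT])
    have J: "J \<in> Lp_space M 2"
      unfolding J_def by (rule W.elementary_integral_L2[OF W.L2_step_grid_avg[OF N tT gp(2) progg] tT])
    have YI: "\<bar>\<phi> (Y n) - \<phi> (I n)\<bar> \<le> e" for n
    proof -
      have "(LINT \<omega>|M. (norm (Y n \<omega> - I n \<omega>))\<^sup>2) \<le>
          4 * (LINT x|?P. (norm (grid_process \<delta> N (f n) x - time_cut 0 t (f n) x))\<^sup>2)"
        unfolding I_def
        by (rule wiener_process.ito_integral_grid(2)[OF assms(3) f_def Y_def t fp(2) progf approxf N])
      then show ?thesis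
        unfolding Lp_dual_diff[OF \<phi> Y I, symmetric] using cf[of n]
        by (intro Lp_dual_small[OF C(2,1) e] Lp_space_diff Y I) simp_all
    qed
    have ZJ: "\<bar>\<phi> Z - \<phi> J\<bar> \<le> e"
    proof -
      have "(LINT \<omega>|M. (norm (Z \<omega> - J \<omega>))\<^sup>2) \<le>
          4 * (LINT x|?P. (norm (grid_process \<delta> N g x - time_cut 0 t g x))\<^sup>2)"
        unfolding J_def by (rule W.ito_integral_grid(2)[OF g_def Z_def t gp(2) progg approxg N])
      then show ?thesis
        unfolding Lp_dual_diff[OF \<phi> Z J, symmetric] using cg
        by (intro Lp_dual_small[OF C(2,1) e] Lp_space_diff Z J) simp_all
    qed
    have "(\<lambda>n. \<phi> (I n)) \<longlonglongrightarrow> \<phi> J"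
      unfolding I_def J_def
      by (rule step_integral_weak_limit[OF assms(3,4) \<open>p > 2\<close> conv2 fp(1) B(1) progf progg lim \<phi> N tT])
    then have "\<forall>\<^sub>F n in sequentially. \<bar>\<phi> (I n) - \<phi> J\<bar> < e"
      unfolding tendsto_iff dist_real_def using e by blast
    then have "\<forall>\<^sub>F n in sequentially. norm (\<phi> (Y n) - \<phi> Z) < \<epsilon>"
    proof eventually_elim
      case (elim n)
      moreover have "\<epsilon> = 4 * e" by (simp add: e_def)
      ultimately show ?case using YI[of n] ZJ e unfolding real_norm_def by linarith
    qed
    then show "\<exists>no. \<forall>n\<ge>no. norm (\<phi> (Y n) - \<phi> Z) < \<epsilon>"
      unfolding eventually_sequentially .
  qed
  then show "Lp_converges_weakly M 2
           (\<lambda>n. ito_integral M (Fn n) (Wn n) (dual_pairing \<beta> (Vn n)) t)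
           (ito_integral M F W (dual_pairing \<beta> V) t)"
    using Y Z unfolding Lp_converges_weakly_def Y_def Z_def by blast
qed

end
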